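(* Let $1\le p,q\le+\infty$, $T>0$, $x_0,x_T\in\mathbb{R}^d$, let $U\subseteq L^m_q(0,T)$ be a nonempty closed set, $\theta\colon\mathbb{R}^d\times\mathbb{R}^m\times[0,T]\to\mathbb{R}$, $f\colon\mathbb{R}^d\times\mathbb{R}^m\times[0,T]\to\mathbb{R}^d$, and consider $$\min\ \mathcal{I}(x,u)=\int_0^T\theta(x(t),u(t),t)\,dt\quad\text{subject to}\quad\dot x(t)=f(x(t),u(t),t),\ t\in[0,T],\ x(0)=x_0,\ x(T)=x_T,\ u\in U\qquad(\ast)$$ over $(x,u)\in X=W^d_{1,p}(0,T)\times L^m_q(0,T)$. Let $A$ be the set of all $(x,u)\in X$ with $x(0)=x_0$, $u\in U$, $\dot x(t)=f(x(t),u(t),t)$ for a.e. $t\in[0,T]$; put $\varphi(x,u)=|x(T)-x_T|$ and $\Phi_\lambda=\mathcal{I}+\lambda\varphi$. Let $\mathcal{I}^*$ be the optimal value of $(\ast)$. Assume $x_T$ is a non-isolated point of the reachable set $\mathcal{R}(x_0,T)$ and that: 1. $\theta$ is continuous and differentiable in $x$ and $u$, and the functions $\nabla_x\theta$, $\nabla_u\theta$ and $f$ are continuous; 2. either $q=+\infty$, or $\theta$ and $\nabla_x\theta$ satisfy the growth condition of order $(q,1)$ and $\nabla_u\theta$ satisfies the growth condition of order $(q-1,q')$; 3. there exists a globally optimal solution of $(\ast)$; 4. the set $\mathcal{R}(x_0,T)$ has the negative tangent angle property near $x_T$; 5. there exist $\lambda_0>0$, $c>\mathcal{I}^*$ and $\delta>0$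 such that $S_{\lambda_0}(c)\cap\Omega_\delta$ is bounded in $X$, the property $(\mathcal{S})$ is satisfied on $S_{\lambda_0}(c)\cap(\Omega_\delta\setminus\Omega)$, and $\Phi_{\lambda_0}$ is bounded below on $A$. Then there exists $\lambda^*\ge0$ such that for any $\lambda\ge\lambda^*$ the penalty function $\Phi_\lambda$ for problem $(\ast)$ is completely exact on $S_\lambda(c)$.
   Context: Spaces: $L^m_q(0,T)$ is the product of $m$ copies of $L^q(0,T)$ with norm $\|u\|_q=(\int_0^T|u(t)|^q\,dt)^{1/q}$ (ess sup of the Euclidean norm if $q=+\infty$). $W^d_{1,p}(0,T)$ is the space of absolutely continuous $x\colon[0,T]\to\mathbb{R}^d$ with $\dot x\in L^d_p(0,T)$, norm $\|x\|_{1,p}=\|x\|_p+\|\dot x\|_p$. $X$ carries the sum norm. $r'$ is the conjugate exponent of $r$. Growth condition: $g\colon\mathbb{R}^d\times\mathbb{R}^m\times[0,T]\to\mathbb{R}^k$ satisfies the growth condition of order $(l,s)$, $0\le l<+\infty$, $1\le s\le+\infty$, if for any $R>0$ there exist $C_R>0$ and an a.e. nonnegative $\omega_R\in L^s(0,T)$ with $|g(x,u,t)|\le C_R|u|^l+\omega_R(t)$ for a.e. $t\in[0,T]$ and all $(x,u)$ with $|x|\le R$. Reachable set: $\mathcal{R}(x_0,T)=\{\xi\in\mathbb{R}^d\mid\exists(x,u)\in A\colon\xi=x(T)\}$. Negative tangent angle property: $\mathcal{R}(x_0,T)$ has it near $x_T$ if there exist a neighbourhood $\mathcal{O}(x_T)$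 of $x_T$ and $\beta>0$ such that for any $\xi\in\mathcal{O}(x_T)\cap\mathcal{R}(x_0,T)$, $\xi\ne x_T$, there exists a sequence $\{\xi_n\}\subset\mathcal{R}(x_0,T)$ (with $\xi_n\neq\xi$) converging to $\xi$ such that $\left\langle\frac{\xi-x_T}{|\xi-x_T|},\frac{\xi_n-\xi}{|\xi_n-\xi|}\right\rangle\le-\beta$ for all $n\in\mathbb{N}$. Property $(\mathcal{S})$: it is satisfied on a set $K\subset A$ if there exists $C>0$ such that for any $(x,u)\in K$ one can find a neighbourhood $\mathcal{O}(x(T))\subset\mathbb{R}^d$ of $x(T)$ such that for all $\widehat{x}_T\in\mathcal{O}(x(T))\cap\mathcal{R}(x_0,T)$ there exists $(\widehat{x},\widehat{u})\in A$ with $\widehat{x}(T)=\widehat{x}_T$ and $\|u-\widehat{u}\|_q+\|x-\widehat{x}\|_{1,p}\le C|x(T)-\widehat{x}(T)|$. Penalty notation: $\Omega=\{(x,u)\in A\mid\varphi(x,u)=0\}$ is the feasible set of $(\ast)$, $\Omega_\delta=\{(x,u)\in A\mid\varphi(x,u)<\delta\}$, $S_\lambda(c)=\{(x,u)\in A\mid\Phi_\lambda(x,u)<c\}$. For $K\subseteq X$, $f\colon X\to\mathbb{R}$ and $z\in K$, $f^{\downarrow}_K(z)=\liminf_{y\to z,\,y\in K}\frac{f(y)-f(z)}{\|y-z\|_X}$ ($+\infty$ if $z$ is isolated in $K$); $z$ is an inf-stationary point of $f$ on $K$ if $f^{\downarrow}_K(z)\ge0$. $\Phi_\lambda$ is completely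 exact on $S_\lambda(c)$ if: (1) the optimal values of $\min_\Omega\mathcal{I}$ and $\min_A\Phi_\lambda$ coincide; (2) their globally optimal solutions coincide; (3) $z\in S_\lambda(c)$ is a locally optimal solution of $\min_A\Phi_\lambda$ iff $z\in\Omega$ and $z$ is a locally optimal solution of $\min_\Omega\mathcal{I}$; (4) $z\in S_\lambda(c)$ is an inf-stationary point of $\Phi_\lambda$ on $A$ iff $z\in\Omega$ and $z$ is an inf-stationary point of $\mathcal{I}$ on $\Omega$. Local optimality is with respect to the norm of $X$. *)

theory Defs
  imports "HOL-Analysis.Analysis" "HOL-Probability.Essential_Supremum"
begin

text \<open>
  Elements of the function spaces below are represented by functions on the real line of which
  only the values on the interval from 0 to T matter; almost everywhere equality is not
  quotiented out. Hence \<open>Lq_norm\<close>, \<open>W_norm\<close> and \<open>X_dist\<close> are seminorms and a pseudometric, and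
  ``different points of the space'' means ``points at positive distance''.
  Exponents range over the extended nonnegative reals.
\<close>

definition Lq_space :: "ennreal \<Rightarrow> real \<Rightarrow> (real \<Rightarrow> 'a::euclidean_space) set" where
  "Lq_space q T = {u \<in> borel_measurable (lebesgue_on {0..T}).
     if q = \<infinity> then \<exists>C. AE t in lebesgue_on {0..T}. norm (u t) \<le> C
     else integrable (lebesgue_on {0..T}) (\<lambda>t. norm (u t) powr enn2real q)}"

definition Lq_norm :: "ennreal \<Rightarrow> real \<Rightarrow> (real \<Rightarrow> 'a::euclidean_space) \<Rightarrow> real" where
  "Lq_norm q T u =
     (if q = \<infinity> then real_of_ereal (esssup (lebesgue_on {0..T}) (\<lambda>t. ereal (norm (u t))))
      else (LINT t|lebesgue_on {0..T}. norm (u t) powr enn2real q) powr (1 / enn2real q))"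

definition conj_exponent :: "ennreal \<Rightarrow> ennreal" where
  "conj_exponent r =
     (if r = 1 then \<infinity> else if r = \<infinity> then 1 else ennreal (enn2real r / (enn2real r - 1)))"

text \<open>Closedness already makes the set invariant under almost everywhere equality.\<close>

definition Lq_closed :: "ennreal \<Rightarrow> real \<Rightarrow> (real \<Rightarrow> 'a::euclidean_space) set \<Rightarrow> bool" where
  "Lq_closed q T U \<longleftrightarrow> U \<subseteq> Lq_space q T \<and>
     (\<forall>u \<in> Lq_space q T. (\<forall>\<epsilon>>0. \<exists>v\<in>U. Lq_norm q T (\<lambda>t. v t - u t) < \<epsilon>) \<longrightarrow> u \<in> U)"

text \<open>
  The members of a division are closed intervals with pairwise disjoint interiors; degenerate
  ones contribute nothing to either sum.
\<close>

definition absolutely_continuous_on :: "real set \<Rightarrow> (real \<Rightarrow> 'a::real_normed_vector) \<Rightarrow> bool" where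
  "absolutely_continuous_on S x \<longleftrightarrow>
     (\<forall>\<epsilon>>0. \<exists>\<delta>>0. \<forall>D. D division_of \<Union>D \<and> \<Union>D \<subseteq> S \<and> (\<Sum>K\<in>D. measure lborel K) < \<delta>
        \<longrightarrow> (\<Sum>K\<in>D. norm (x (Sup K) - x (Inf K))) < \<epsilon>)"

definition W_space :: "ennreal \<Rightarrow> real \<Rightarrow> (real \<Rightarrow> 'a::euclidean_space) set" where
  "W_space p T = {x. absolutely_continuous_on {0..T} x
     \<and> (\<lambda>t. vector_derivative x (at t)) \<in> Lq_space p T}"

definition W_norm :: "ennreal \<Rightarrow> real \<Rightarrow> (real \<Rightarrow> 'a::euclidean_space) \<Rightarrow> real" where
  "W_norm p T x = Lq_norm p T x + Lq_norm p T (\<lambda>t. vector_derivative x (at t))"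

type_synonym ('d, 'm) traj = "(real \<Rightarrow> real^'d) \<times> (real \<Rightarrow> real^'m)"

definition X_space :: "ennreal \<Rightarrow> ennreal \<Rightarrow> real \<Rightarrow> ('d::finite, 'm::finite) traj set" where
  "X_space p q T = W_space p T \<times> Lq_space q T"

definition X_norm :: "ennreal \<Rightarrow> ennreal \<Rightarrow> real \<Rightarrow> ('d::finite, 'm::finite) traj \<Rightarrow> real" where
  "X_norm p q T = (\<lambda>(x, u). W_norm p T x + Lq_norm q T u)"

definition X_dist ::
  "ennreal \<Rightarrow> ennreal \<Rightarrow> real \<Rightarrow> ('d::finite, 'm::finite) traj \<Rightarrow> ('d, 'm) traj \<Rightarrow> real" where
  "X_dist p q T = (\<lambda>(x, u) (y, v). X_norm p q T (\<lambda>t. x t - y t, \<lambda>t. u t - v t))"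

definition X_bounded ::
  "ennreal \<Rightarrow> ennreal \<Rightarrow> real \<Rightarrow> ('d::finite, 'm::finite) traj set \<Rightarrow> bool" where
  "X_bounded p q T K \<longleftrightarrow> (\<exists>M. \<forall>z\<in>K. X_norm p q T z \<le> M)"

text \<open>The power of order \<open>l = 0\<close> is 1 also at 0, whereas \<open>0 powr 0 = 0\<close>.\<close>

definition growth_condition ::
  "real \<Rightarrow> (real^'d \<Rightarrow> real^'m \<Rightarrow> real \<Rightarrow> 'k::real_normed_vector) \<Rightarrow> real \<Rightarrow> ennreal \<Rightarrow> bool" where
  "growth_condition T g l s \<longleftrightarrow>
     (\<forall>R>0. \<exists>C>0. \<exists>\<omega> \<in> Lq_space s T.
        (AE t in lebesgue_on {0..T}. 0 \<le> (\<omega> t :: real)) \<and>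
        (AE t in lebesgue_on {0..T}. \<forall>x u. norm x \<le> R \<longrightarrow>
           norm (g x u t) \<le> C * (if l = 0 then 1 else norm u powr l) + \<omega> t))"

definition gradient :: "('a::real_inner \<Rightarrow> real) \<Rightarrow> 'a \<Rightarrow> 'a" where
  "gradient F x = (THE D. GDERIV F x :> D)"

definition grad_x :: "(real^'d \<Rightarrow> real^'m \<Rightarrow> real \<Rightarrow> real) \<Rightarrow> real^'d \<Rightarrow> real^'m \<Rightarrow> real \<Rightarrow> real^'d" where
  "grad_x \<theta> x u t = gradient (\<lambda>y. \<theta> y u t) x"

definition grad_u :: "(real^'d \<Rightarrow> real^'m \<Rightarrow> real \<Rightarrow> real) \<Rightarrow> real^'d \<Rightarrow> real^'m \<Rightarrow> real \<Rightarrow> real^'m" where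
  "grad_u \<theta> x u t = gradient (\<lambda>v. \<theta> x v t) u"

definition jointly_continuous ::
  "real \<Rightarrow> (real^'d \<Rightarrow> real^'m \<Rightarrow> real \<Rightarrow> 'k::topological_space) \<Rightarrow> bool" where
  "jointly_continuous T g \<longleftrightarrow> continuous_on (UNIV \<times> UNIV \<times> {0..T}) (\<lambda>(x, u, t). g x u t)"

definition admissible ::
  "ennreal \<Rightarrow> ennreal \<Rightarrow> real \<Rightarrow> (real^'d::finite \<Rightarrow> real^'m::finite \<Rightarrow> real \<Rightarrow> real^'d) \<Rightarrow>
   real^'d \<Rightarrow> (real \<Rightarrow> real^'m) set \<Rightarrow> ('d, 'm) traj set" where
  "admissible p q T f x0 U = {(x, u) \<in> X_space p q T. x 0 = x0 \<and> u \<in> U \<and>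
     (AE t in lebesgue_on {0..T}. (x has_vector_derivative f (x t) (u t) t) (at t))}"

definition reachable :: "real \<Rightarrow> ('d::finite, 'm::finite) traj set \<Rightarrow> (real^'d) set" where
  "reachable T A = {\<xi>. \<exists>(x, u) \<in> A. \<xi> = x T}"

definition cost ::
  "real \<Rightarrow> (real^'d \<Rightarrow> real^'m \<Rightarrow> real \<Rightarrow> real) \<Rightarrow> ('d::finite, 'm::finite) traj \<Rightarrow> real" where
  "cost T \<theta> = (\<lambda>(x, u). LINT t|lebesgue_on {0..T}. \<theta> (x t) (u t) t)"

definition end_error :: "real \<Rightarrow> real^'d \<Rightarrow> ('d::finite, 'm::finite) traj \<Rightarrow> real" where
  "end_error T xT = (\<lambda>(x, u). norm (x T - xT))"

definition penalty ::
  "real \<Rightarrow> (real^'d \<Rightarrow> real^'m \<Rightarrow> real \<Rightarrow> real) \<Rightarrow> real^'d \<Rightarrow> real \<Rightarrow>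
   ('d::finite, 'm::finite) traj \<Rightarrow> real" where
  "penalty T \<theta> xT lam z = cost T \<theta> z + lam * end_error T xT z"

definition negative_tangent_angle :: "'a::real_inner set \<Rightarrow> 'a \<Rightarrow> bool" where
  "negative_tangent_angle R xT \<longleftrightarrow>
     (\<exists>V \<beta>. open V \<and> xT \<in> V \<and> \<beta> > 0 \<and>
        (\<forall>\<xi> \<in> V \<inter> R. \<xi> \<noteq> xT \<longrightarrow>
           (\<exists>\<eta> :: nat \<Rightarrow> 'a. (\<forall>n. \<eta> n \<in> R \<and> \<eta> n \<noteq> \<xi>) \<and> \<eta> \<longlonglongrightarrow> \<xi> \<and>
              (\<forall>n. ((\<xi> - xT) /\<^sub>R norm (\<xi> - xT)) \<bullet> ((\<eta> n - \<xi>) /\<^sub>R norm (\<eta> n - \<xi>)) \<le> - \<beta>))))"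

definition property_S ::
  "ennreal \<Rightarrow> ennreal \<Rightarrow> real \<Rightarrow> ('d::finite, 'm::finite) traj set \<Rightarrow> ('d, 'm) traj set \<Rightarrow> bool" where
  "property_S p q T A K \<longleftrightarrow>
     (\<exists>C>0. \<forall>(x, u) \<in> K. \<exists>V. open V \<and> x T \<in> V \<and>
        (\<forall>\<xi> \<in> V \<inter> reachable T A. \<exists>(y, v) \<in> A. y T = \<xi> \<and>
           Lq_norm q T (\<lambda>t. u t - v t) + W_norm p T (\<lambda>t. x t - y t) \<le> C * norm (x T - y T)))"

text \<open>Optimisation of a real function on a subset of a (pseudo)metric space with distance \<open>d\<close>.\<close>

definition optimal_value :: "('z \<Rightarrow> real) \<Rightarrow> 'z set \<Rightarrow> ereal" where
  "optimal_value F K = (INF z\<in>K. ereal (F z))"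

definition globally_optimal :: "('z \<Rightarrow> real) \<Rightarrow> 'z set \<Rightarrow> 'z \<Rightarrow> bool" where
  "globally_optimal F K z \<longleftrightarrow> z \<in> K \<and> (\<forall>y\<in>K. F z \<le> F y)"

definition locally_optimal :: "('z \<Rightarrow> 'z \<Rightarrow> real) \<Rightarrow> ('z \<Rightarrow> real) \<Rightarrow> 'z set \<Rightarrow> 'z \<Rightarrow> bool" where
  "locally_optimal d F K z \<longleftrightarrow> z \<in> K \<and> (\<exists>r>0. \<forall>y\<in>K. d y z < r \<longrightarrow> F z \<le> F y)"

text \<open>
  The filter describes \<open>d y z\<close> tending to 0 from the right with \<open>y \<in> K\<close>; it is trivial, and the
  lower limit is \<open>\<infinity>\<close>, exactly when \<open>z\<close> is isolated in \<open>K\<close>.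
\<close>

definition steepest_descent_rate ::
  "('z \<Rightarrow> 'z \<Rightarrow> real) \<Rightarrow> ('z \<Rightarrow> real) \<Rightarrow> 'z set \<Rightarrow> 'z \<Rightarrow> ereal" where
  "steepest_descent_rate d F K z =
     Liminf (inf (filtercomap (\<lambda>y. d y z) (at_right 0)) (principal K))
       (\<lambda>y. ereal ((F y - F z) / d y z))"

definition inf_stationary :: "('z \<Rightarrow> 'z \<Rightarrow> real) \<Rightarrow> ('z \<Rightarrow> real) \<Rightarrow> 'z set \<Rightarrow> 'z \<Rightarrow> bool" where
  "inf_stationary d F K z \<longleftrightarrow> z \<in> K \<and> 0 \<le> steepest_descent_rate d F K z"

text \<open>
  \<open>A\<close> is the domain of the penalised problem with objective \<open>\<Phi>\<close>, \<open>\<Omega>\<close> the feasible set of the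
  original problem with objective \<open>I\<close>, and \<open>S\<close> the set on which exactness is claimed.
\<close>

definition completely_exact ::
  "('z \<Rightarrow> 'z \<Rightarrow> real) \<Rightarrow> 'z set \<Rightarrow> 'z set \<Rightarrow> ('z \<Rightarrow> real) \<Rightarrow> ('z \<Rightarrow> real) \<Rightarrow> 'z set \<Rightarrow> bool" where
  "completely_exact d A \<Omega> I \<Phi> S \<longleftrightarrow>
     optimal_value I \<Omega> = optimal_value \<Phi> A \<and>
     {z. globally_optimal I \<Omega> z} = {z. globally_optimal \<Phi> A z} \<and>
     (\<forall>z\<in>S. locally_optimal d \<Phi> A z \<longleftrightarrow> z \<in> \<Omega> \<and> locally_optimal d I \<Omega> z) \<and>
     (\<forall>z\<in>S. inf_stationary d \<Phi> A z \<longleftrightarrow> z \<in> \<Omega> \<and> inf_stationary d I \<Omega> z)"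

definition feasible :: "real \<Rightarrow> real^'d \<Rightarrow> ('d::finite, 'm::finite) traj set \<Rightarrow> ('d, 'm) traj set" where
  "feasible T xT A = {z \<in> A. end_error T xT z = 0}"

definition near_feasible ::
  "real \<Rightarrow> real^'d \<Rightarrow> ('d::finite, 'm::finite) traj set \<Rightarrow> real \<Rightarrow> ('d, 'm) traj set" where
  "near_feasible T xT A \<delta> = {z \<in> A. end_error T xT z < \<delta>}"

definition sublevel ::
  "real \<Rightarrow> (real^'d \<Rightarrow> real^'m \<Rightarrow> real \<Rightarrow> real) \<Rightarrow> real^'d \<Rightarrow> ('d::finite, 'm::finite) traj set \<Rightarrow>
   real \<Rightarrow> real \<Rightarrow> ('d, 'm) traj set" where
  "sublevel T \<theta> xT A lam c = {z \<in> A. penalty T \<theta> xT lam z < c}"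

end

(*
On a sublevel set of the penalty function outside the feasible set, the negative tangent angle
property gives reachable end points that come closer to xT at a rate bounded below, and property
(S) lifts them to admissible processes at a proportional distance. Hence the terminal error
decreases there at a rate a > 0. The cost is Lipschitz on bounded sets, so for large lambda the
penalty function decreases along the same steps. The set of admissible processes is complete, and
Caristi's argument turns these steps into a feasible process whose cost does not exceed the value
of the penalty function and whose distance from the initial process is at most the terminal error
divided by a. All four parts of exactness follow from this comparison.
*)
theory Submission
  imports Defs
begin

section \<open>Exact penalisation on pseudometric spaces\<close>

text \<open>The distance bound in Caristi's argument is what transfers local statements. If
  \<open>z\<close> is feasible, the error of a nearby \<open>y\<close> is at most
  \<open>L * d y z\<close>, so the feasible \<open>w\<close> obtained from \<open>y\<close>
  satisfies \<open>d w z \<le> (L / a + 1) * d y z\<close>, and comparing \<open>z\<close> with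
  \<open>w\<close> compares it with \<open>y\<close>. In the other direction, arbitrarily short
  descent steps refute local optimality and stationarity at infeasible points. The assumptions
  concern the parameter \<open>lam0\<close> and nearly feasible processes, whereas exactness is
  claimed on the sublevel set of every large \<open>lam\<close>. A lower bound \<open>m\<close> of
  the penalty function for \<open>lam0\<close> bridges the gap: a value below \<open>c\<close> at
  \<open>lam\<close> means that \<open>lam - lam0\<close> times the error is less than
  \<open>c - m\<close>, so the error is small. A second lower bound on \<open>lam\<close> lets the
  gain \<open>lam * a\<close> per unit of distance outweigh the Lipschitz constant of the cost.
  Completeness is obtained by letting controls and velocities converge separately, in norm and
  almost everywhere, so that the differential equation survives by continuity of \<open>f\<close>.
  Only seminorms are available, so different processes may have distance zero.\<close>

lemma inf_stationary_iff:
  "inf_stationary d F K z \<longleftrightarrow>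
     z \<in> K \<and> (\<forall>e>0. \<exists>r>0. \<forall>y\<in>K. 0 < d y z \<and> d y z < r \<longrightarrow> - e * d y z \<le> F y - F z)"
proof -
  let ?G = "inf (filtercomap (\<lambda>y. d y z) (at_right 0)) (principal K)"
  \<comment> \<open>The filter tests positive and small distances only; points of \<open>K\<close>
    at distance zero from \<open>z\<close> are not tested.\<close>
  have ev: "eventually P ?G \<longleftrightarrow> (\<exists>r>0. \<forall>y\<in>K. 0 < d y z \<and> d y z < r \<longrightarrow> P y)" for P
  proof
    assume "eventually P ?G"
    then obtain Q where Q: "eventually Q (at_right (0::real))" "\<And>y. Q (d y z) \<Longrightarrow> y \<in> K \<longrightarrow> P y"
      unfolding eventually_inf_principal eventually_filtercomap by blast
    then obtain b where "b > 0" "\<And>y. y > 0 \<Longrightarrow> y < b \<Longrightarrow> Q y"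
      by (auto simp: eventually_at_right_field)
    with Q(2) show "\<exists>r>0. \<forall>y\<in>K. 0 < d y z \<and> d y z < r \<longrightarrow> P y" by blast
  next
    assume "\<exists>r>0. \<forall>y\<in>K. 0 < d y z \<and> d y z < r \<longrightarrow> P y"
    then obtain r where r: "r > 0" "\<forall>y\<in>K. 0 < d y z \<and> d y z < r \<longrightarrow> P y" by blast
    have "eventually (\<lambda>x. 0 < x \<and> x < r) (at_right (0::real))"
      using r(1) by (auto simp: eventually_at_right_field intro!: exI[of _ r])
    then show "eventually P ?G"
      unfolding eventually_inf_principal eventually_filtercomap using r(2) by blast
  qed
  have "0 \<le> steepest_descent_rate d F K z \<longleftrightarrow>
      (\<forall>e>0. eventually (\<lambda>y. ereal (- e) < ereal ((F y - F z) / d y z)) ?G)"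
  proof -
    have "0 \<le> steepest_descent_rate d F K z \<longleftrightarrow>
        (\<forall>y<0. eventually (\<lambda>x. y < ereal ((F x - F z) / d x z)) ?G)"
      unfolding steepest_descent_rate_def by (rule le_Liminf_iff)
    also have "\<dots> \<longleftrightarrow> (\<forall>e>0. eventually (\<lambda>y. ereal (- e) < ereal ((F y - F z) / d y z)) ?G)"
    proof (intro iffI allI impI)
      fix e :: real assume "\<forall>y<0. eventually (\<lambda>x. y < ereal ((F x - F z) / d x z)) ?G" "e > 0"
      then show "eventually (\<lambda>y. ereal (- e) < ereal ((F y - F z) / d y z)) ?G"
        by (auto dest: spec[of _ "ereal (- e)"])
    next
      fix y :: ereal
      assume *: "\<forall>e>0. eventually (\<lambda>y. ereal (- e) < ereal ((F y - F z) / d y z)) ?G" and y: "y < 0"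
      show "eventually (\<lambda>x. y < ereal ((F x - F z) / d x z)) ?G"
      proof (cases y)
        case (real r)
        then show ?thesis using *[rule_format, of "- r"] y by simp
      qed (use y in auto)
    qed
    finally show ?thesis .
  qed
  also have "\<dots> \<longleftrightarrow> (\<forall>e>0. \<exists>r>0. \<forall>y\<in>K. 0 < d y z \<and> d y z < r \<longrightarrow> - e * d y z < F y - F z)"
    unfolding ev by (intro all_cong1 imp_cong refl ex_cong1 conj_cong ball_cong)
      (simp only: less_ereal.simps, subst pos_less_divide_eq, auto)
  \<comment> \<open>Testing with \<open>e/2\<close> turns the weak inequality into the strict one,
    because the distance is positive.\<close>
  also have "\<dots> \<longleftrightarrow> (\<forall>e>0. \<exists>r>0. \<forall>y\<in>K. 0 < d y z \<and> d y z < r \<longrightarrow> - e * d y z \<le> F y - F z)"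
  proof (intro iffI allI impI)
    fix e :: real
    assume *: "\<forall>e>0. \<exists>r>0. \<forall>y\<in>K. 0 < d y z \<and> d y z < r \<longrightarrow> - e * d y z \<le> F y - F z" and e: "e > 0"
    obtain r where r: "r > 0" "\<forall>y\<in>K. 0 < d y z \<and> d y z < r \<longrightarrow> - (e/2) * d y z \<le> F y - F z"
      using *[rule_format, of "e/2"] e by auto
    have "- e * d y z < - (e/2) * d y z" if "0 < d y z" for y using that e by (simp add: field_simps)
    then show "\<exists>r>0. \<forall>y\<in>K. 0 < d y z \<and> d y z < r \<longrightarrow> - e * d y z < F y - F z"
      using r by (meson less_le_trans)
  qed (meson less_imp_le)
  finally show ?thesis unfolding inf_stationary_def by simp
qed

text \<open>Apart from nonnegativity, the metric axioms are required on \<open>A\<close> only, since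
  the seminorms are meaningful only for members of the function spaces. Completeness is stated for
  sequences of finite length, the only ones that Caristi's argument produces. In
  \<open>descent\<close>, \<open>a\<close> is the rate for the infeasibility and \<open>b\<close>
  the rate for the penalty function; steps shorter than any \<open>e\<close> serve to refute local
  properties.\<close>

locale descent_to_feasibility =
  fixes d :: "'z \<Rightarrow> 'z \<Rightarrow> real" and A :: "'z set" and I \<phi> :: "'z \<Rightarrow> real" and lam c a b L :: real
  assumes d_nonneg: "0 \<le> d y z"
    and d_refl: "z \<in> A \<Longrightarrow> d z z = 0"
    and d_sym: "y \<in> A \<Longrightarrow> z \<in> A \<Longrightarrow> d y z = d z y"
    and d_triangle: "x \<in> A \<Longrightarrow> y \<in> A \<Longrightarrow> z \<in> A \<Longrightarrow> d x z \<le> d x y + d y z"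
    and complete: "(\<And>n. Y n \<in> A) \<Longrightarrow> summable (\<lambda>n. d (Y n) (Y (Suc n))) \<Longrightarrow>
      \<exists>w\<in>A. (\<lambda>n. d (Y n) w) \<longlonglongrightarrow> 0"
    and infeasibility_nonneg: "0 \<le> \<phi> z"
    and infeasibility_lipschitz: "y \<in> A \<Longrightarrow> z \<in> A \<Longrightarrow> \<bar>\<phi> y - \<phi> z\<bar> \<le> L * d y z"
    and objective_continuous: "z \<in> A \<Longrightarrow> 0 < e \<Longrightarrow> \<exists>r>0. \<forall>y\<in>A. d y z < r \<longrightarrow> \<bar>I y - I z\<bar> < e"
    and rates_pos: "0 < a" "0 < b" "0 \<le> L"
    and descent: "z \<in> A \<Longrightarrow> I z + lam * \<phi> z < c \<Longrightarrow> 0 < \<phi> z \<Longrightarrow> 0 < e \<Longrightarrow>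
      \<exists>y\<in>A. 0 < d y z \<and> d y z < e \<and> \<phi> y \<le> \<phi> z - a * d y z \<and>
        I y + lam * \<phi> y \<le> I z + lam * \<phi> z - b * d y z"
begin

definition \<Phi> :: "'z \<Rightarrow> real" where "\<Phi> z = I z + lam * \<phi> z"

abbreviation \<Omega> :: "'z set" where "\<Omega> \<equiv> {z \<in> A. \<phi> z = 0}"

lemma limit_I:
  assumes "\<And>n. Y n \<in> A" "w \<in> A" "(\<lambda>n. d (Y n) w) \<longlonglongrightarrow> 0"
  shows "(\<lambda>n. I (Y n)) \<longlonglongrightarrow> I w"
proof (rule LIMSEQ_I)
  fix e :: real assume "e > 0"
  then obtain r where r: "r > 0" "\<forall>y\<in>A. d y w < r \<longrightarrow> \<bar>I y - I w\<bar> < e"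
    using objective_continuous assms(2) by blast
  have "eventually (\<lambda>n. d (Y n) w < r) sequentially"
    using assms(3) r(1) by (rule order_tendstoD)
  then show "\<exists>N. \<forall>n\<ge>N. norm (I (Y n) - I w) < e"
    using r(2) assms(1) unfolding eventually_sequentially by auto
qed

lemma limit_\<phi>:
  assumes "\<And>n. Y n \<in> A" "w \<in> A" "(\<lambda>n. d (Y n) w) \<longlonglongrightarrow> 0"
  shows "(\<lambda>n. \<phi> (Y n)) \<longlonglongrightarrow> \<phi> w"
proof -
  have "(\<lambda>n. \<phi> (Y n) - \<phi> w) \<longlonglongrightarrow> 0"
  proof (rule Lim_null_comparison)
    show "(\<lambda>n. L * d (Y n) w) \<longlonglongrightarrow> 0" using tendsto_mult_left[OF assms(3), of L] by simp
    show "eventually (\<lambda>n. norm (\<phi> (Y n) - \<phi> w) \<le> L * d (Y n) w) sequentially"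
      using infeasibility_lipschitz assms by simp
  qed
  then show ?thesis by (rule LIM_zero_cancel)
qed

lemma limit_\<Phi>:
  assumes "\<And>n. Y n \<in> A" "w \<in> A" "(\<lambda>n. d (Y n) w) \<longlonglongrightarrow> 0"
  shows "(\<lambda>n. \<Phi> (Y n)) \<longlonglongrightarrow> \<Phi> w"
  unfolding \<Phi>_def by (intro tendsto_intros limit_I limit_\<phi> assms)

lemma d_limit:
  assumes "\<And>n. Y n \<in> A" "w \<in> A" "v \<in> A" "(\<lambda>n. d (Y n) w) \<longlonglongrightarrow> 0"
  shows "(\<lambda>n. d (Y n) v) \<longlonglongrightarrow> d w v"
proof -
  have "(\<lambda>n. d (Y n) v - d w v) \<longlonglongrightarrow> 0"
  proof (rule Lim_null_comparison[OF _ assms(4)], rule always_eventually, rule allI)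
    fix n
    show "norm (d (Y n) v - d w v) \<le> d (Y n) w"
      using d_triangle[of "Y n" w v] d_triangle[of w "Y n" v] d_sym[of w "Y n"] assms(1)[of n] assms(2,3)
      by (simp add: abs_le_iff)
  qed
  then show ?thesis by (rule LIM_zero_cancel)
qed

text \<open>
  Caristi's argument for the infeasibility measure, restricted to steps that do not increase the
  penalty function.
\<close>

lemma nearby_feasible_point:
  assumes y: "y \<in> A" "\<Phi> y < c"
  obtains w where "w \<in> \<Omega>" "\<Phi> w \<le> \<Phi> y" "a * d w y \<le> \<phi> y"
proof -
  \<comment> \<open>Caristi's order: the infeasibility drops by at least \<open>a\<close> per unit
    of distance, and the penalty function does not grow. The triangle inequality makes it
    transitive.\<close>
  define below where "below v = {u \<in> A. \<phi> u + a * d u v \<le> \<phi> v \<and> \<Phi> u \<le> \<Phi> v}" for v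
  have below_refl: "v \<in> below v" if "v \<in> A" for v using that by (simp add: below_def d_refl)
  have below_trans: "u \<in> below v" if "u \<in> below v'" "v' \<in> below v" "v \<in> A" for u v' v
  proof -
    have "a * d u v \<le> a * (d u v' + d v' v)" using that rates_pos d_triangle by (auto simp: below_def)
    then show ?thesis using that by (auto simp: below_def distrib_left)
  qed
  have bdd: "bdd_below (\<phi> ` below v)" for v
    using infeasibility_nonneg by (auto intro!: bdd_belowI[of _ 0])
  \<comment> \<open>A greedy choice that realises at least half of the possible decrease of
    \<open>\<phi>\<close>. If \<open>v\<close> already attains the infimum, \<open>v\<close> itself
    is chosen.\<close>
  have "\<exists>u. u \<in> below v \<and> \<phi> u \<le> (\<phi> v + Inf (\<phi> ` below v)) / 2" if v: "v \<in> A" for v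
  proof (cases "\<phi> v = Inf (\<phi> ` below v)")
    case True
    then show ?thesis using below_refl[OF that] by (intro exI[of _ v]) auto
  next
    case False
    moreover have "Inf (\<phi> ` below v) \<le> \<phi> v" using below_refl[OF that] bdd by (intro cInf_lower) auto
    ultimately have "Inf (\<phi> ` below v) < (\<phi> v + Inf (\<phi> ` below v)) / 2" by simp
    then obtain u where "u \<in> below v" "\<phi> u < (\<phi> v + Inf (\<phi> ` below v)) / 2"
      using cInf_lessD[of "\<phi> ` below v"] below_refl[OF v] by (metis empty_iff imageE image_is_empty)
    then show ?thesis by (intro exI[of _ u]) auto
  qed
  then obtain s where s: "s v \<in> below v" "\<phi> (s v) \<le> (\<phi> v + Inf (\<phi> ` below v)) / 2" if "v \<in> A" for v
    by metis
  define Y where "Y n = (s ^^ n) y" for n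
  have Y0: "Y 0 = y" and YS: "Y (Suc n) = s (Y n)" for n by (simp_all add: Y_def)
  have YA: "Y n \<in> A" for n
    by (induction n) (use y s(1) in \<open>auto simp: Y0 YS below_def\<close>)
  have Ystep: "Y (Suc n) \<in> below (Y n)" for n using s(1)[OF YA] by (simp add: YS)
  have Ymono: "Y (n + k) \<in> below (Y n)" for n k
    by (induction k) (use below_refl YA below_trans Ystep in \<open>auto, blast\<close>)
  \<comment> \<open>The decrements of \<open>\<phi>\<close> telescope, which bounds the length of
    the sequence by \<open>\<phi> y / a\<close>.\<close>
  have sumb: "a * (\<Sum>i<n. d (Y (Suc i)) (Y i)) \<le> \<phi> y - \<phi> (Y n)" for n
  proof (induction n)
    case (Suc n)
    then show ?case using Ystep[of n] by (simp add: below_def distrib_left)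
  qed (simp add: Y0)
  have "summable (\<lambda>n. d (Y n) (Y (Suc n)))"
  proof (rule summableI_nonneg_bounded)
    fix n
    have "a * (\<Sum>i<n. d (Y i) (Y (Suc i))) \<le> \<phi> y"
      using sumb[of n] infeasibility_nonneg[of "Y n"] d_sym[OF YA YA] by simp
    then show "(\<Sum>i<n. d (Y i) (Y (Suc i))) \<le> \<phi> y / a" using rates_pos by (simp add: field_simps)
  qed (rule d_nonneg)
  then obtain w where w: "w \<in> A" and lim: "(\<lambda>n. d (Y n) w) \<longlonglongrightarrow> 0" using complete YA by blast
  \<comment> \<open>The conditions that define \<open>below (Y n)\<close> are closed, and the
    sequence satisfies them from index \<open>n\<close> on.\<close>
  have w_below: "w \<in> below (Y n)" for n
  proof -
    have "(\<lambda>k. d (Y (k + n)) w) \<longlonglongrightarrow> 0" using lim by (rule LIMSEQ_ignore_initial_segment)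
    then have l: "(\<lambda>k. d (Y (n + k)) w) \<longlonglongrightarrow> 0" by (simp add: add.commute)
    have "\<Phi> w \<le> \<Phi> (Y n)"
      by (rule LIMSEQ_le_const2[OF limit_\<Phi>[OF YA w l]]) (use Ymono in \<open>auto simp: below_def\<close>)
    moreover have "\<phi> w + a * d w (Y n) \<le> \<phi> (Y n)"
      by (rule LIMSEQ_le_const2[OF tendsto_add[OF limit_\<phi>[OF YA w l] tendsto_mult_left[OF d_limit[OF YA w YA l]]]])
        (use Ymono in \<open>auto simp: below_def\<close>)
    ultimately show ?thesis using w by (simp add: below_def)
  qed
  have w0: "w \<in> below y" using w_below[of 0] by (simp add: Y0)
  have "\<phi> w = 0"
  proof (rule ccontr)
    assume "\<phi> w \<noteq> 0"
    then have "0 < \<phi> w" using infeasibility_nonneg[of w] by simp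
    moreover have "I w + lam * \<phi> w < c" using w0 y(2) by (simp add: below_def \<Phi>_def)
    ultimately obtain v where v: "v \<in> A" "0 < d v w" "\<phi> v \<le> \<phi> w - a * d v w"
        "I v + lam * \<phi> v \<le> I w + lam * \<phi> w - b * d v w"
      using descent[OF w _ _ zero_less_one] by blast
    have "0 \<le> b * d v w" using v(2) rates_pos by simp
    then have "v \<in> below w" using v by (simp add: below_def \<Phi>_def)
    then have "v \<in> below (Y n)" for n using w_below below_trans YA by blast
    then have "Inf (\<phi> ` below (Y n)) \<le> \<phi> v" for n using bdd by (intro cInf_lower) auto
    \<comment> \<open>The greedy choice, solved for the infimum. The left side tends to
      \<open>\<phi> w\<close>, so \<open>\<phi> w \<le> \<phi> v\<close>, although the descent step
      to \<open>v\<close> has strictly lowered \<open>\<phi>\<close>.\<close>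
    moreover have "2 * \<phi> (Y (Suc n)) - \<phi> (Y n) \<le> Inf (\<phi> ` below (Y n))" for n
      using s(2)[OF YA[of n]] by (simp add: YS field_simps)
    ultimately have "2 * \<phi> (Y (Suc n)) - \<phi> (Y n) \<le> \<phi> v" for n by (meson order_trans)
    moreover have "(\<lambda>n. 2 * \<phi> (Y (Suc n)) - \<phi> (Y n)) \<longlonglongrightarrow> 2 * \<phi> w - \<phi> w"
      by (intro tendsto_intros LIMSEQ_Suc limit_\<phi> YA w lim)
    ultimately have "\<phi> w \<le> \<phi> v" using LIMSEQ_le_const2[of "\<lambda>n. 2 * \<phi> (Y (Suc n)) - \<phi> (Y n)"] by auto
    moreover have "0 < a * d v w" using v(2) rates_pos by simp
    ultimately show False using v(3) by simp
  qed
  then show ?thesis using that[of w] w0 by (simp add: below_def)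
qed

text \<open>Descent steps of arbitrarily small positive length have a difference quotient of at most
  \<open>- b\<close>, which violates the test with tolerance \<open>b/2\<close>.\<close>

lemma not_inf_stationary:
  assumes "z \<in> A" "\<Phi> z < c" "\<phi> z \<noteq> 0"
  shows "\<not> inf_stationary d \<Phi> A z"
proof
  assume "inf_stationary d \<Phi> A z"
  then obtain r where r: "r > 0" "\<forall>y\<in>A. 0 < d y z \<and> d y z < r \<longrightarrow> - (b/2) * d y z \<le> \<Phi> y - \<Phi> z"
    unfolding inf_stationary_iff using rates_pos by (meson half_gt_zero)
  obtain y where y: "y \<in> A" "0 < d y z" "d y z < r" "\<Phi> y \<le> \<Phi> z - b * d y z"
    using descent[of z r] assms infeasibility_nonneg[of z] r(1) unfolding \<Phi>_def by fastforce
  then have "- (b/2) * d y z \<le> - b * d y z" using r(2) by fastforce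
  moreover have "0 < b * d y z" using y(2) rates_pos by simp
  ultimately show False by (simp add: field_simps)
qed

lemma not_locally_optimal:
  assumes "z \<in> A" "\<Phi> z < c" "\<phi> z \<noteq> 0"
  shows "\<not> locally_optimal d \<Phi> A z"
proof
  assume "locally_optimal d \<Phi> A z"
  then obtain r where r: "r > 0" "\<forall>y\<in>A. d y z < r \<longrightarrow> \<Phi> z \<le> \<Phi> y"
    unfolding locally_optimal_def by blast
  obtain y where y: "y \<in> A" "0 < d y z" "d y z < r" "\<Phi> y \<le> \<Phi> z - b * d y z"
    using descent[of z r] assms infeasibility_nonneg[of z] r(1) unfolding \<Phi>_def by fastforce
  moreover have "0 < b * d y z" using y(2) rates_pos by simp
  ultimately show False using r(2) by fastforce
qed

section \<open>Transfer of optimality and stationarity between the penalised and the original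
  problem\<close>

lemma \<Phi>_eq_I: "z \<in> \<Omega> \<Longrightarrow> \<Phi> z = I z" by (simp add: \<Phi>_def)

text \<open>The penalty function is continuous at \<open>z\<close>, through
  \<open>objective_continuous\<close> and the Lipschitz bound of \<open>\<phi>\<close>. Hence
  \<open>nearby_feasible_point\<close> applies to all points of \<open>A\<close> close to
  \<open>z\<close>.\<close>

lemma close_points_below_c:
  assumes "z \<in> A" "\<Phi> z < c"
  obtains r where "r > 0" "\<And>y. y \<in> A \<Longrightarrow> d y z < r \<Longrightarrow> \<Phi> y < c"
proof -
  define e where "e = (c - \<Phi> z) / 2"
  have "e > 0" using assms by (simp add: e_def)
  then obtain r where r: "r > 0" "\<forall>y\<in>A. d y z < r \<longrightarrow> \<bar>I y - I z\<bar> < e"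
    using objective_continuous assms(1) by blast
  \<comment> \<open>The absolute value covers either sign of \<open>lam\<close>; the summand 1 keeps
    the divisor positive.\<close>
  define \<rho> where "\<rho> = min r (e / (\<bar>lam\<bar> * L + 1))"
  have pos: "0 < \<bar>lam\<bar> * L + 1" using rates_pos by (simp add: add_nonneg_pos)
  have "\<Phi> y < c" if "y \<in> A" "d y z < \<rho>" for y
  proof -
    have "\<bar>lam * \<phi> y - lam * \<phi> z\<bar> \<le> \<bar>lam\<bar> * (L * d y z)"
      using infeasibility_lipschitz[OF that(1) assms(1)]
      by (simp add: right_diff_distrib[symmetric] abs_mult mult_left_mono)
    also have "\<dots> \<le> (\<bar>lam\<bar> * L + 1) * d y z" using d_nonneg[of y z] by (simp add: algebra_simps)
    also have "\<dots> < e" using that(2) pos by (simp add: \<rho>_def field_simps)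
    finally have "\<bar>lam * \<phi> y - lam * \<phi> z\<bar> < e" .
    moreover have "\<bar>I y - I z\<bar> < e" using r(2) that by (simp add: \<rho>_def)
    ultimately show ?thesis unfolding \<Phi>_def e_def abs_less_iff by argo
  qed
  then show ?thesis using that[of \<rho>] r(1) \<open>e > 0\<close> pos by (simp add: \<rho>_def)
qed

text \<open>Since \<open>\<phi> z = 0\<close>, the Lipschitz bound gives
  \<open>\<phi> y \<le> L * d y z\<close>, and moving from \<open>y\<close> to \<open>w\<close>
  costs at most \<open>\<phi> y / a\<close>.\<close>

lemma distance_of_nearby_feasible_point:
  assumes "z \<in> \<Omega>" "y \<in> A" "w \<in> A" "a * d w y \<le> \<phi> y"
  shows "d w z \<le> (L / a + 1) * d y z"
proof -
  have "a * d w y \<le> L * d y z" using assms infeasibility_lipschitz[of y z] by simp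
  then have "d w y \<le> L / a * d y z" using rates_pos by (simp add: field_simps)
  then show ?thesis using d_triangle[of w y z] assms by (simp add: algebra_simps)
qed

text \<open>Forward, infeasible points of the sublevel set are excluded by
  \<open>not_locally_optimal\<close>. Backward, a point \<open>y\<close> near \<open>z\<close> is
  compared through a feasible \<open>w\<close>:
  \<open>I z \<le> I w = \<Phi> w \<le> \<Phi> y\<close>, provided that the radius has been divided
  by \<open>L / a + 1\<close>.\<close>

lemma locally_optimal_iff:
  assumes "z \<in> A" "\<Phi> z < c"
  shows "locally_optimal d \<Phi> A z \<longleftrightarrow> z \<in> \<Omega> \<and> locally_optimal d I \<Omega> z"
proof (intro iffI conjI)
  assume l: "locally_optimal d \<Phi> A z"
  then show \<Omega>: "z \<in> \<Omega>" using not_locally_optimal assms by blast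
  from l obtain r where r: "r > 0" "\<forall>y\<in>A. d y z < r \<longrightarrow> \<Phi> z \<le> \<Phi> y"
    unfolding locally_optimal_def by blast
  have "\<forall>y\<in>\<Omega>. d y z < r \<longrightarrow> I z \<le> I y" using r(2) \<Omega> \<Phi>_eq_I by fastforce
  then show "locally_optimal d I \<Omega> z" using r(1) \<Omega> unfolding locally_optimal_def by blast
next
  assume *: "z \<in> \<Omega> \<and> locally_optimal d I \<Omega> z"
  then obtain r where r: "r > 0" "\<forall>y\<in>\<Omega>. d y z < r \<longrightarrow> I z \<le> I y"
    unfolding locally_optimal_def by blast
  obtain r' where r': "r' > 0" "\<And>y. y \<in> A \<Longrightarrow> d y z < r' \<Longrightarrow> \<Phi> y < c"
    using close_points_below_c assms by blast
  have pos: "0 < L / a + 1" using rates_pos by (simp add: add_nonneg_pos)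
  have "\<Phi> z \<le> \<Phi> y" if y: "y \<in> A" "d y z < min r' (r / (L / a + 1))" for y
  proof -
    obtain w where w: "w \<in> \<Omega>" "\<Phi> w \<le> \<Phi> y" "a * d w y \<le> \<phi> y"
      using nearby_feasible_point y r'(2) by (metis min_less_iff_conj)
    have "d w z \<le> (L / a + 1) * d y z" using distance_of_nearby_feasible_point * w y by blast
    also have "\<dots> < r" using y(2) pos by (simp add: field_simps)
    finally show ?thesis using r(2) w * \<Phi>_eq_I by fastforce
  qed
  then show "locally_optimal d \<Phi> A z" unfolding locally_optimal_def
    using assms(1) r(1) r'(1) pos by (metis divide_pos_pos min_less_iff_conj)
qed

lemma inf_stationary_exactness:
  assumes "z \<in> A" "\<Phi> z < c"
  shows "inf_stationary d \<Phi> A z \<longleftrightarrow> z \<in> \<Omega> \<and> inf_stationary d I \<Omega> z"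
proof (intro iffI conjI)
  assume l: "inf_stationary d \<Phi> A z"
  then show \<Omega>: "z \<in> \<Omega>" using not_inf_stationary assms by blast
  show "inf_stationary d I \<Omega> z"
    unfolding inf_stationary_iff
  proof (intro conjI allI impI \<Omega>)
    fix e :: real assume "e > 0"
    then obtain r where r: "r > 0" "\<forall>y\<in>A. 0 < d y z \<and> d y z < r \<longrightarrow> - e * d y z \<le> \<Phi> y - \<Phi> z"
      using l unfolding inf_stationary_iff by blast
    have "\<forall>y\<in>\<Omega>. 0 < d y z \<and> d y z < r \<longrightarrow> - e * d y z \<le> I y - I z" using r(2) \<Omega> \<Phi>_eq_I by fastforce
    with r(1) show "\<exists>r>0. \<forall>y\<in>\<Omega>. 0 < d y z \<and> d y z < r \<longrightarrow> - e * d y z \<le> I y - I z" by blast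
  qed
next
  assume *: "z \<in> \<Omega> \<and> inf_stationary d I \<Omega> z"
  show "inf_stationary d \<Phi> A z"
    unfolding inf_stationary_iff
  proof (intro conjI allI impI assms(1))
    fix e :: real assume e: "e > 0"
    have pos: "0 < L / a + 1" using rates_pos by (simp add: add_nonneg_pos)
    \<comment> \<open>Passing from \<open>y\<close> to \<open>w\<close> may stretch the distance to
      \<open>z\<close> by the factor \<open>L / a + 1\<close>, so the tolerance is reduced by
      it.\<close>
    define e' where "e' = e / (L / a + 1)"
    have e': "e' > 0" and e'_eq: "e' * (L / a + 1) = e" using e pos by (auto simp: e'_def)
    then obtain r where r: "r > 0" "\<forall>y\<in>\<Omega>. 0 < d y z \<and> d y z < r \<longrightarrow> - e' * d y z \<le> I y - I z"
      using * unfolding inf_stationary_iff by blast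
    obtain r' where r': "r' > 0" "\<And>y. y \<in> A \<Longrightarrow> d y z < r' \<Longrightarrow> \<Phi> y < c"
      using close_points_below_c assms by blast
    have "- e * d y z \<le> \<Phi> y - \<Phi> z" if y: "y \<in> A" "d y z < min r' (r / (L / a + 1))" for y
    proof -
      obtain w where w: "w \<in> \<Omega>" "\<Phi> w \<le> \<Phi> y" "a * d w y \<le> \<phi> y"
        using nearby_feasible_point y r'(2) by (metis min_less_iff_conj)
      have dwz: "d w z \<le> (L / a + 1) * d y z" using distance_of_nearby_feasible_point * w y by blast
      also have "\<dots> < r" using y(2) pos by (simp add: field_simps)
      finally have "d w z < r" .
      \<comment> \<open>Stationarity says nothing about a \<open>w\<close> at distance zero from
        \<open>z\<close>; there continuity of the objective forces equal values.\<close>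
      have "- e' * d w z \<le> I w - I z"
      proof (cases "d w z = 0")
        case True
        have "I w = I z"
        proof (rule ccontr)
          assume "I w \<noteq> I z"
          then show False using objective_continuous[of z "\<bar>I w - I z\<bar>"] True w(1) assms(1) by force
        qed
        then show ?thesis using True by simp
      next
        case False
        then show ?thesis using r(2) w(1) \<open>d w z < r\<close> d_nonneg[of w z] by force
      qed
      moreover have "I w - I z \<le> \<Phi> y - \<Phi> z" using w * \<Phi>_eq_I by fastforce
      moreover have "e' * d w z \<le> e' * ((L / a + 1) * d y z)" using dwz e' by simp
      moreover have "e' * ((L / a + 1) * d y z) = e * d y z" by (simp add: e'_eq mult.assoc[symmetric])
      ultimately show ?thesis by simp
    qed
    then show "\<exists>r>0. \<forall>y\<in>A. 0 < d y z \<and> d y z < r \<longrightarrow> - e * d y z \<le> \<Phi> y - \<Phi> z"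
      using r(1) r'(1) pos by (metis divide_pos_pos min_less_iff_conj)
  qed
qed

lemma completely_exact:
  assumes opt: "globally_optimal I \<Omega> z0" and c: "I z0 < c"
  shows "completely_exact d A \<Omega> I \<Phi> {z \<in> A. \<Phi> z < c}"
proof -
  have z0: "z0 \<in> \<Omega>" "\<And>y. y \<in> \<Omega> \<Longrightarrow> I z0 \<le> I y" using opt by (auto simp: globally_optimal_def)
  \<comment> \<open>Values of at least \<open>c\<close> exceed \<open>I z0\<close> anyway, so the
    feasible comparison point is needed only on the sublevel set.\<close>
  have min: "I z0 \<le> \<Phi> y" if y: "y \<in> A" for y
  proof (cases "\<Phi> y < c")
    case True
    then obtain w where "w \<in> \<Omega>" "\<Phi> w \<le> \<Phi> y" using nearby_feasible_point y by blast
    then show ?thesis using z0(2)[of w] \<Phi>_eq_I[of w] by simp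
  qed (use c in simp)
  have \<Phi>z0: "\<Phi> z0 = I z0" using z0(1) \<Phi>_eq_I by blast
  have opt\<Phi>: "globally_optimal \<Phi> A z0" using z0 min \<Phi>z0 by (auto simp: globally_optimal_def)
  have val: "optimal_value F K = ereal (F z)" if "globally_optimal F K z" for F K and z :: 'z
    using that unfolding optimal_value_def globally_optimal_def by (intro antisym INF_lower INF_greatest) auto
  have "globally_optimal I \<Omega> z \<longleftrightarrow> globally_optimal \<Phi> A z" for z
  proof
    assume "globally_optimal I \<Omega> z"
    then have "z \<in> \<Omega>" "I z \<le> I z0" using z0 by (auto simp: globally_optimal_def)
    then have "\<forall>y\<in>A. \<Phi> z \<le> \<Phi> y" using min \<Phi>_eq_I by fastforce
    then show "globally_optimal \<Phi> A z" using \<open>z \<in> \<Omega>\<close> by (auto simp: globally_optimal_def)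
  next
    assume g: "globally_optimal \<Phi> A z"
    then have z: "z \<in> A" "\<Phi> z \<le> I z0" using z0 \<Phi>z0 by (auto simp: globally_optimal_def)
    \<comment> \<open>A global minimiser of \<open>\<Phi>\<close> has a value below
      \<open>c\<close>, and in that sublevel set local optimality forces feasibility.\<close>
    moreover have "locally_optimal d \<Phi> A z"
      using g unfolding globally_optimal_def locally_optimal_def by (auto intro: exI[of _ 1])
    ultimately have "z \<in> \<Omega>" using not_locally_optimal[of z] c by force
    then have "\<forall>y\<in>\<Omega>. I z \<le> I y" using z z0 \<Phi>_eq_I by fastforce
    then show "globally_optimal I \<Omega> z" using \<open>z \<in> \<Omega>\<close> by (simp add: globally_optimal_def)
  qed
  then show ?thesis unfolding completely_exact_def
    using val[OF opt] val[OF opt\<Phi>] \<Phi>z0 locally_optimal_iff inf_stationary_exactness by auto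
qed

end

section \<open>Lebesgue spaces on a compact interval\<close>

text \<open>If an argument is zero, the claim reduces to \<open>x powr r \<le> x\<close> on the unit
  interval; otherwise it is convexity of the power on positive numbers. It is the pointwise core of
  Minkowski's inequality.\<close>

lemma powr_convex_combination:
  fixes s t \<alpha> \<beta> r :: real
  assumes "0 \<le> s" "0 \<le> t" "0 \<le> \<alpha>" "0 \<le> \<beta>" "\<alpha> + \<beta> = 1" "1 \<le> r"
  shows "(\<alpha> * s + \<beta> * t) powr r \<le> \<alpha> * s powr r + \<beta> * t powr r"
proof -
  have le: "x powr r \<le> x" if "0 \<le> x" "x \<le> 1" for x :: real
    using that assms(6) powr_mono'[of 1 r x] by (cases "x = 0") auto
  have scale: "(\<gamma> * x) powr r \<le> \<gamma> * x powr r" if "0 \<le> \<gamma>" "\<gamma> \<le> 1" "0 \<le> x" for \<gamma> x :: real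
    using le[OF that(1,2)] that by (simp add: powr_mult mult_right_mono)
  consider "s = 0" | "t = 0" | "0 < s" "0 < t" using assms by force
  then show ?thesis
  proof cases
    case 1
    then show ?thesis using scale[of \<beta> t] assms by simp
  next
    case 2
    then show ?thesis using scale[of \<alpha> s] assms by simp
  next
    case 3
    have "\<alpha> = 1 - \<beta>" using assms by simp
    have "((1 - \<beta>) * s + \<beta> * t) powr r \<le> (1 - \<beta>) * s powr r + \<beta> * t powr r"
      using convex_onD[OF powr_convex[OF assms(6)], of \<beta> s t] 3 assms by simp
    then show ?thesis unfolding \<open>\<alpha> = 1 - \<beta>\<close> .
  qed
qed

lemma one_le_enn2real:
  assumes "1 \<le> q" "q \<noteq> (\<infinity>::ennreal)"
  shows "1 \<le> enn2real q"
  using assms by (cases q) (auto simp: ennreal_1[symmetric] simp del: ennreal_1)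

text \<open>Lebesgue measure is complete, so a change on a null set preserves measurability;
  extension by zero moves the question to the whole line.\<close>

lemma AE_lebesgue_on_measurable:
  fixes f g :: "real \<Rightarrow> 'a::euclidean_space"
  assumes f: "f \<in> borel_measurable (lebesgue_on S)" and S: "S \<in> sets lebesgue"
    and eq: "AE t in lebesgue_on S. f t = g t"
  shows "g \<in> borel_measurable (lebesgue_on S)"
proof -
  have "(\<lambda>t. if t \<in> S then f t else 0) \<in> borel_measurable lebesgue"
    using f S by (simp add: borel_measurable_if)
  moreover have "AE t in lebesgue. (if t \<in> S then f t else 0) = (if t \<in> S then g t else 0)"
    using eq S by (simp add: AE_restrict_space_iff)
  ultimately have "(\<lambda>t. if t \<in> S then g t else 0) \<in> borel_measurable lebesgue"
    by (rule borel_measurable_AE)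
  then show ?thesis using S by (simp add: borel_measurable_if)
qed

locale time_interval =
  fixes T :: real
  assumes T_pos: "0 < T"
begin

abbreviation M :: "real measure" where "M \<equiv> lebesgue_on {0..T}"

lemma emeasure_M: "emeasure M {0..T} = ennreal T"
  using T_pos by (simp add: emeasure_restrict_space)

sublocale finite_measure M
  using emeasure_M by (intro finite_measureI) simp

text \<open>The interval has positive measure. This excludes minus infinity as an essential
  supremum.\<close>

lemma not_AE_False: "\<not> (AE t in M. False)"
  using T_pos emeasure_M unfolding trivial_limit_def[symmetric] ae_filter_eq_bot_iff by simp

lemma measure_M: "measure M {0..T} = T"
  using T_pos emeasure_M by (simp add: measure_def)

text \<open>Real integrals and real parts of suprema have default values where the true quantity is
  infinite, so a bound on \<open>Lq_norm\<close> alone does not yield membership. The almost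
  everywhere bound and the nonnegative integral capture membership and bound together.\<close>

lemma Lq_ball_iff:
  assumes q: "1 \<le> q" and B: "0 \<le> B"
  shows "u \<in> Lq_space q T \<and> Lq_norm q T u \<le> B \<longleftrightarrow> u \<in> borel_measurable M \<and>
     (if q = \<infinity> then AE t in M. norm (u t) \<le> B
      else (\<integral>\<^sup>+t. ennreal (norm (u t) powr enn2real q) \<partial>M) \<le> ennreal (B powr enn2real q))"
    (is "?L \<longleftrightarrow> ?meas \<and> ?R")
proof (cases "?meas")
  case meas [measurable]: True
  show ?thesis
  proof (cases "q = \<infinity>")
    case True
    let ?n = "\<lambda>t. ereal (norm (u t))"
    have "?L" if "AE t in M. norm (u t) \<le> B"
    proof -
      have "esssup M ?n \<le> ereal B" using that by (intro esssup_I) auto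
      then have "real_of_ereal (esssup M ?n) \<le> B" using B by (cases "esssup M ?n") auto
      then show ?thesis using that True by (auto simp: Lq_space_def Lq_norm_def)
    qed
    moreover have "AE t in M. norm (u t) \<le> B" if ?L
    proof -
      from that True obtain C where C: "AE t in M. norm (u t) \<le> C" by (auto simp: Lq_space_def)
      then have top: "esssup M ?n \<le> ereal C" by (intro esssup_I) auto
      have "esssup M ?n \<noteq> - \<infinity>"
      proof
        assume "esssup M ?n = - \<infinity>"
        then have "AE t in M. False" using esssup_AE[of ?n M] by simp
        then show False using not_AE_False by simp
      qed
      then have "esssup M ?n = ereal (Lq_norm q T u)"
        using top True by (cases "esssup M ?n") (auto simp: Lq_norm_def)
      then have "AE t in M. norm (u t) \<le> Lq_norm q T u" using esssup_AE[of ?n M] by simp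
      then show ?thesis by (rule eventually_mono) (use that in auto)
    qed
    ultimately show ?thesis unfolding if_P[OF True] using meas by blast
  next
    case False
    let ?r = "enn2real q"
    have r: "1 \<le> ?r" using q False by (rule one_le_enn2real)
    let ?h = "\<lambda>t. norm (u t) powr ?r"
    have i: "integrable M ?h \<longleftrightarrow> (\<integral>\<^sup>+t. ennreal (?h t) \<partial>M) < \<infinity>"
      by (subst integrable_iff_bounded) auto
    have nn: "0 \<le> integral\<^sup>L M ?h" by simp
    have "integral\<^sup>L M ?h powr (1 / ?r) \<le> B \<longleftrightarrow> integral\<^sup>L M ?h \<le> B powr ?r"
    proof
      assume "integral\<^sup>L M ?h powr (1 / ?r) \<le> B"
      then have "(integral\<^sup>L M ?h powr (1 / ?r)) powr ?r \<le> B powr ?r"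
        using r by (intro powr_mono2) auto
      then show "integral\<^sup>L M ?h \<le> B powr ?r" using r nn by (simp add: powr_powr)
    next
      assume "integral\<^sup>L M ?h \<le> B powr ?r"
      then have "integral\<^sup>L M ?h powr (1 / ?r) \<le> (B powr ?r) powr (1 / ?r)"
        using r nn by (intro powr_mono2) auto
      then show "integral\<^sup>L M ?h powr (1 / ?r) \<le> B" using r B by (simp add: powr_powr)
    qed
    moreover have "(\<integral>\<^sup>+t. ennreal (?h t) \<partial>M) \<le> ennreal (B powr ?r) \<longleftrightarrow>
        integrable M ?h \<and> integral\<^sup>L M ?h \<le> B powr ?r"
    proof (cases "integrable M ?h")
      case True
      then have "(\<integral>\<^sup>+t. ennreal (?h t) \<partial>M) = ennreal (integral\<^sup>L M ?h)"
        by (intro nn_integral_eq_integral) auto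
      then show ?thesis using True by simp
    next
      case False
      then have "(\<integral>\<^sup>+t. ennreal (?h t) \<partial>M) = \<infinity>" unfolding i by (simp add: less_top[symmetric])
      then show ?thesis using False by (simp add: top.extremum_unique)
    qed
    moreover have "?L \<longleftrightarrow> integrable M ?h \<and> integral\<^sup>L M ?h powr (1 / ?r) \<le> B"
      using False meas by (simp add: Lq_space_def Lq_norm_def)
    ultimately show ?thesis unfolding if_not_P[OF False] using meas by blast
  qed
qed (auto simp: Lq_space_def)

lemma Lq_norm_nonneg: "0 \<le> Lq_norm q T u"
proof (cases "q = \<infinity>")
  case True
  let ?n = "\<lambda>t. ereal (norm (u t))"
  have "0 \<le> esssup M ?n"
  proof (rule ccontr)
    assume "\<not> 0 \<le> esssup M ?n"
    then have "AE t in M. False"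
      using esssup_AE[of ?n M] by (auto elim!: eventually_mono) (meson ereal_less_eq(5) norm_ge_zero order_trans)
    then show False using not_AE_False by simp
  qed
  then show ?thesis using True by (simp add: Lq_norm_def real_of_ereal_pos)
qed (simp add: Lq_norm_def)

section \<open>Order, linear structure and completeness of the Lebesgue seminorms\<close>

lemma Lq_measurable: "u \<in> Lq_space q T \<Longrightarrow> u \<in> borel_measurable M"
  by (simp add: Lq_space_def)

lemma Lq_mono:
  assumes q: "1 \<le> q" and v: "v \<in> Lq_space q T" and u: "u \<in> borel_measurable M"
    and le: "AE t in M. norm (u t) \<le> norm (v t)"
  shows "u \<in> Lq_space q T" "Lq_norm q T u \<le> Lq_norm q T v"
proof -
  have "u \<in> Lq_space q T \<and> Lq_norm q T u \<le> Lq_norm q T v"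
  proof (subst Lq_ball_iff[OF q Lq_norm_nonneg], intro conjI u)
    have *: "if q = \<infinity> then AE t in M. norm (v t) \<le> Lq_norm q T v
      else (\<integral>\<^sup>+t. ennreal (norm (v t) powr enn2real q) \<partial>M) \<le> ennreal (Lq_norm q T v powr enn2real q)"
      using Lq_ball_iff[OF q Lq_norm_nonneg[of q v], of v] v by blast
    show "if q = \<infinity> then AE t in M. norm (u t) \<le> Lq_norm q T v
      else (\<integral>\<^sup>+t. ennreal (norm (u t) powr enn2real q) \<partial>M) \<le> ennreal (Lq_norm q T v powr enn2real q)"
    proof (cases "q = \<infinity>")
      case True
      then show ?thesis using * le by (auto elim: eventually_elim2)
    next
      case False
      have "(\<integral>\<^sup>+t. ennreal (norm (u t) powr enn2real q) \<partial>M)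
          \<le> (\<integral>\<^sup>+t. ennreal (norm (v t) powr enn2real q) \<partial>M)"
        by (rule nn_integral_mono_AE)
          (use le one_le_enn2real[OF q False] in \<open>auto elim!: eventually_mono intro!: ennreal_leI powr_mono2\<close>)
      then show ?thesis using * False by simp
    qed
  qed
  then show "u \<in> Lq_space q T" "Lq_norm q T u \<le> Lq_norm q T v" by auto
qed

text \<open>Functions that agree almost everywhere are not identified. This lemma allows the
  derivative of a state to be exchanged for the right-hand side of the differential
  equation.\<close>

lemma Lq_cong:
  assumes q: "1 \<le> q" and v: "v \<in> Lq_space q T" and eq: "AE t in M. v t = u t"
  shows "u \<in> Lq_space q T" "Lq_norm q T u = Lq_norm q T v"
proof -
  have u: "u \<in> borel_measurable M"
    using AE_lebesgue_on_measurable[OF _ _ eq] Lq_measurable[OF v] by simp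
  show 1: "u \<in> Lq_space q T"
    by (rule Lq_mono[OF q v u]) (use eq in \<open>auto elim!: eventually_mono\<close>)
  show "Lq_norm q T u = Lq_norm q T v"
    by (intro antisym Lq_mono(2)[OF q v u] Lq_mono(2)[OF q 1] Lq_measurable[OF v])
      (use eq in \<open>auto elim!: eventually_mono\<close>)
qed

lemma Lq_uminus:
  assumes q: "1 \<le> q" and v: "v \<in> Lq_space q T"
  shows "(\<lambda>t. - v t) \<in> Lq_space q T" "Lq_norm q T (\<lambda>t. - v t) = Lq_norm q T v"
proof -
  have m: "(\<lambda>t. - v t) \<in> borel_measurable M" using Lq_measurable[OF v] by simp
  show 1: "(\<lambda>t. - v t) \<in> Lq_space q T" by (rule Lq_mono[OF q v m]) simp
  show "Lq_norm q T (\<lambda>t. - v t) = Lq_norm q T v"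
    by (intro antisym Lq_mono(2)[OF q v m] Lq_mono(2)[OF q 1] Lq_measurable[OF v]) simp_all
qed

lemma Lq_norm_minus_commute:
  assumes "1 \<le> q" "(\<lambda>t. u t - v t) \<in> Lq_space q T"
  shows "Lq_norm q T (\<lambda>t. v t - u t) = Lq_norm q T (\<lambda>t. u t - v t)"
  using Lq_uminus(2)[OF assms] by simp

lemma Lq_finite_bound:
  assumes q: "1 \<le> q" "q \<noteq> \<infinity>" and u: "u \<in> Lq_space q T"
  shows "integrable M (\<lambda>t. norm (u t) powr enn2real q)"
    "(LINT t|M. norm (u t) powr enn2real q) = Lq_norm q T u powr enn2real q"
  using u q one_le_enn2real[OF q] by (auto simp: Lq_space_def Lq_norm_def powr_powr)

text \<open>Normalisation by a number \<open>a\<close> that may exceed the norm; this avoids a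
  division by zero when the norm vanishes.\<close>

lemma Lq_scaled_bound:
  assumes q: "1 \<le> q" "q \<noteq> \<infinity>" and u: "u \<in> Lq_space q T" and a: "Lq_norm q T u \<le> a" "0 < a"
  shows "integrable M (\<lambda>t. (norm (u t) / a) powr enn2real q)"
    "(LINT t|M. (norm (u t) / a) powr enn2real q) \<le> 1"
proof -
  have *: "(norm (u t) / a) powr enn2real q = norm (u t) powr enn2real q / a powr enn2real q" for t
    using a by (simp add: powr_divide)
  show "integrable M (\<lambda>t. (norm (u t) / a) powr enn2real q)"
    unfolding * using Lq_finite_bound(1)[OF q u] by simp
  have "Lq_norm q T u powr enn2real q \<le> a powr enn2real q"
    using a Lq_norm_nonneg[of q u] by (intro powr_mono2) auto
  then show "(LINT t|M. (norm (u t) / a) powr enn2real q) \<le> 1"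
    unfolding * using Lq_finite_bound(2)[OF q u] a by (simp add: divide_le_eq_1)
qed

lemma Lq_infinity_bound:
  assumes u: "u \<in> Lq_space \<infinity> T"
  shows "AE t in M. norm (u t) \<le> Lq_norm \<infinity> T u"
  using Lq_ball_iff[of \<infinity> "Lq_norm \<infinity> T u" u] Lq_norm_nonneg[of \<infinity> u] u by simp

text \<open>For finite exponents, Minkowski's inequality follows from convexity of the power:
  \<open>norm (u t) + norm (v t)\<close> is \<open>a + b\<close> times a convex combination of the
  normalised values, whose powers have integral at most 1.\<close>

lemma Lq_add:
  assumes q: "1 \<le> q" and u: "u \<in> Lq_space q T" and v: "v \<in> Lq_space q T"
  shows "(\<lambda>t. u t + v t) \<in> Lq_space q T"
    "Lq_norm q T (\<lambda>t. u t + v t) \<le> Lq_norm q T u + Lq_norm q T v"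
proof -
  note [measurable] = Lq_measurable[OF u] Lq_measurable[OF v]
  let ?a = "Lq_norm q T u" and ?b = "Lq_norm q T v"
  have nn: "0 \<le> ?a" "0 \<le> ?b" by (rule Lq_norm_nonneg)+
  have main: "(\<lambda>t. u t + v t) \<in> Lq_space q T \<and> Lq_norm q T (\<lambda>t. u t + v t) \<le> ?a + ?b + e"
    if e: "0 < e" for e
  proof (subst Lq_ball_iff[OF q])
    show "0 \<le> ?a + ?b + e" using nn e by simp
    have "AE t in M. norm (u t + v t) \<le> ?a + ?b + e" if "q = \<infinity>"
    proof -
      have "AE t in M. norm (u t) \<le> ?a" "AE t in M. norm (v t) \<le> ?b"
        using Lq_infinity_bound u v that by blast+
      then show ?thesis
      proof eventually_elim
        case (elim t)
        then show ?case using norm_triangle_ineq[of "u t" "v t"] e by linarith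
      qed
    qed
    moreover have "(\<integral>\<^sup>+t. ennreal (norm (u t + v t) powr enn2real q) \<partial>M)
        \<le> ennreal ((?a + ?b + e) powr enn2real q)" if qf: "q \<noteq> \<infinity>"
    proof -
      define r where "r = enn2real q"
      have r: "1 \<le> r" unfolding r_def using q qf by (rule one_le_enn2real)
      \<comment> \<open>The slack \<open>e/2\<close> makes both normalising constants positive even
        if a norm vanishes; \<open>field_le_epsilon\<close> removes it at the end.\<close>
      define a b where "a = ?a + e/2" and "b = ?b + e/2"
      have ab: "0 < a" "0 < b" "?a \<le> a" "?b \<le> b" "?a + ?b + e = a + b"
        using nn e by (auto simp: a_def b_def)
      note A = Lq_scaled_bound[OF q qf u ab(3,1), folded r_def]
      note B = Lq_scaled_bound[OF q qf v ab(4,2), folded r_def]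
      let ?h = "\<lambda>t. (a + b) powr r * (a / (a + b) * (norm (u t) / a) powr r + b / (a + b) * (norm (v t) / b) powr r)"
      have pw: "norm (u t + v t) powr r \<le> ?h t" for t
      proof -
        have "norm (u t + v t) powr r \<le> (norm (u t) + norm (v t)) powr r"
          using r by (intro powr_mono2 norm_triangle_ineq) auto
        also have "norm (u t) + norm (v t)
            = (a + b) * (a / (a + b) * (norm (u t) / a) + b / (a + b) * (norm (v t) / b))"
          using ab by (simp add: distrib_left)
        also have "\<dots> powr r
            = (a + b) powr r * (a / (a + b) * (norm (u t) / a) + b / (a + b) * (norm (v t) / b)) powr r"
          using ab by (intro powr_mult)
        also have "\<dots> \<le> ?h t"
          using ab r by (intro mult_left_mono powr_convex_combination) (auto simp: add_divide_distrib[symmetric])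
        finally show ?thesis .
      qed
      have "(\<integral>\<^sup>+t. ennreal (norm (u t + v t) powr r) \<partial>M) \<le> (\<integral>\<^sup>+t. ennreal (?h t) \<partial>M)"
        by (intro nn_integral_mono ennreal_leI pw)
      also have "\<dots> = ennreal (LINT t|M. ?h t)"
        using ab A B by (intro nn_integral_eq_integral) auto
      also have "(LINT t|M. ?h t) = (a + b) powr r * (a / (a + b) * (LINT t|M. (norm (u t) / a) powr r)
          + b / (a + b) * (LINT t|M. (norm (v t) / b) powr r))"
        using A(1) B(1) by simp
      also have "\<dots> \<le> (a + b) powr r * (a / (a + b) * 1 + b / (a + b) * 1)"
        using A B ab by (intro mult_left_mono add_mono) auto
      also have "\<dots> = (a + b) powr r" using ab by (simp add: add_divide_distrib[symmetric])
      finally show ?thesis using ab(5) by (simp add: r_def ennreal_leI)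
    qed
    ultimately show "(\<lambda>t. u t + v t) \<in> borel_measurable M \<and>
      (if q = \<infinity> then AE t in M. norm (u t + v t) \<le> ?a + ?b + e
       else (\<integral>\<^sup>+t. ennreal (norm (u t + v t) powr enn2real q) \<partial>M) \<le> ennreal ((?a + ?b + e) powr enn2real q))"
      by auto
  qed
  show "(\<lambda>t. u t + v t) \<in> Lq_space q T" using main[OF zero_less_one] by (rule conjunct1)
  show "Lq_norm q T (\<lambda>t. u t + v t) \<le> ?a + ?b" by (rule field_le_epsilon) (use main in blast)
qed

lemma Lq_diff:
  assumes q: "1 \<le> q" and u: "u \<in> Lq_space q T" and v: "v \<in> Lq_space q T"
  shows "(\<lambda>t. u t - v t) \<in> Lq_space q T"
  using Lq_add(1)[OF q u Lq_uminus(1)[OF q v]] by simp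

lemma Lq_triangle:
  assumes q: "1 \<le> q" and "u \<in> Lq_space q T" "v \<in> Lq_space q T" "w \<in> Lq_space q T"
  shows "Lq_norm q T (\<lambda>t. u t - w t) \<le> Lq_norm q T (\<lambda>t. u t - v t) + Lq_norm q T (\<lambda>t. v t - w t)"
  using Lq_add(2)[OF q Lq_diff[OF q assms(2,3)] Lq_diff[OF q assms(3,4)]] by simp

lemma Lq_norm_zero:
  assumes q: "1 \<le> q"
  shows "Lq_norm q T (\<lambda>t. 0 :: 'a::euclidean_space) = 0"
proof -
  have "Lq_norm q T (\<lambda>t. 0 :: 'a) \<le> 0"
    using Lq_ball_iff[OF q, of 0 "\<lambda>t. 0 :: 'a"] by (cases "q = \<infinity>") auto
  then show ?thesis using Lq_norm_nonneg[of q "\<lambda>t. 0 :: 'a"] by simp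
qed

text \<open>On an interval of finite measure every space embeds into the integrable functions. The
  crude constant \<open>T + 1\<close> serves all exponents; for finite ones it comes from
  \<open>s \<le> 1 + s powr r\<close>, integrated with \<open>s = norm (u t) / a\<close>.\<close>

lemma Lq_integral_bound:
  assumes q: "1 \<le> q" and u: "u \<in> Lq_space q T"
  shows "integrable M u" "(LINT t|M. norm (u t)) \<le> (T + 1) * Lq_norm q T u"
proof -
  note [measurable] = Lq_measurable[OF u]
  have *: "integrable M u \<and> (LINT t|M. norm (u t)) \<le> (T + 1) * a" if a: "Lq_norm q T u < a" for a
  proof (cases "q = \<infinity>")
    case True
    have b: "AE t in M. norm (u t) \<le> a" 
    proof (rule eventually_mono)
      show "AE t in M. norm (u t) \<le> Lq_norm \<infinity> T u" using u True by (intro Lq_infinity_bound) simp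
    qed (use a True in simp)
    then have i: "integrable M u" by (intro integrable_const_bound) auto
    have a0: "0 < a" using a Lq_norm_nonneg[of q u] by simp
    have "(LINT t|M. norm (u t)) \<le> (LINT t|M. a)" using i b by (intro integral_mono_AE) auto
    also have "\<dots> \<le> (T + 1) * a" using T_pos a0 measure_M by (simp add: algebra_simps)
    finally show ?thesis using i by simp
  next
    case qf: False
    define r where "r = enn2real q"
    have r: "1 \<le> r" unfolding r_def using q qf by (rule one_le_enn2real)
    have a0: "0 < a" using a Lq_norm_nonneg[of q u] by simp
    note A = Lq_scaled_bound[OF q qf u less_imp_le[OF a] a0, folded r_def]
    have pw: "norm (u t) \<le> a * (1 + (norm (u t) / a) powr r)" for t
    proof -
      have "s \<le> 1 + s powr r" if "0 \<le> s" for s :: real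
        using r powr_mono[of 1 r s] that by (cases "s \<le> 1") (auto simp: add_increasing2)
      from this[of "norm (u t) / a"] show ?thesis using a0 by (simp add: field_simps)
    qed
    have i: "integrable M (\<lambda>t. a * (1 + (norm (u t) / a) powr r))" using A(1) by auto
    have iu: "integrable M u" by (rule Bochner_Integration.integrable_bound[OF i])
      (use pw a0 in \<open>auto intro!: AE_I2 order_trans[OF pw]\<close>)
    have "(LINT t|M. norm (u t)) \<le> (LINT t|M. a * (1 + (norm (u t) / a) powr r))"
      using iu i pw by (intro integral_mono) auto
    also have "\<dots> = a * (T + (LINT t|M. (norm (u t) / a) powr r))"
      using A(1) measure_M by simp
    also have "\<dots> \<le> a * (T + 1)" using A(2) a0 by simp
    finally show ?thesis using iu by (simp add: mult.commute)
  qed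
  show "integrable M u" using *[of "Lq_norm q T u + 1"] by simp
  show "(LINT t|M. norm (u t)) \<le> (T + 1) * Lq_norm q T u"
  proof (rule field_le_epsilon)
    fix e :: real assume "0 < e"
    moreover have "(T + 1) * (Lq_norm q T u + e / (T + 1)) = (T + 1) * Lq_norm q T u + e"
      using T_pos by (simp add: distrib_left)
    ultimately show "(LINT t|M. norm (u t)) \<le> (T + 1) * Lq_norm q T u + e"
      using *[of "Lq_norm q T u + e / (T + 1)"] T_pos by simp
  qed
qed

text \<open>For a finite exponent \<open>r\<close> the factor \<open>T powr (1 / r)\<close> would
  do; it is replaced by \<open>T + 1\<close>, because \<open>T \<le> (T + 1) powr r\<close>.\<close>

lemma Lq_bounded:
  assumes q: "1 \<le> q" and B: "0 \<le> B" and u: "u \<in> borel_measurable M" and le: "AE t in M. norm (u t) \<le> B"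
  shows "u \<in> Lq_space q T" "Lq_norm q T u \<le> (T + 1) * B"
proof -
  have B': "B \<le> (T + 1) * B" using T_pos B by (simp add: algebra_simps)
  have "u \<in> Lq_space q T \<and> Lq_norm q T u \<le> (T + 1) * B"
  proof (subst Lq_ball_iff[OF q], intro mult_nonneg_nonneg B)
    have "AE t in M. norm (u t) \<le> (T + 1) * B" using le by (rule eventually_mono) (use B' in simp)
    moreover have "(\<integral>\<^sup>+t. ennreal (norm (u t) powr enn2real q) \<partial>M)
        \<le> ennreal (((T + 1) * B) powr enn2real q)" if qf: "q \<noteq> \<infinity>"
    proof -
      have r: "1 \<le> enn2real q" using q qf by (rule one_le_enn2real)
      have "(\<integral>\<^sup>+t. ennreal (norm (u t) powr enn2real q) \<partial>M) \<le> (\<integral>\<^sup>+t. ennreal (B powr enn2real q) \<partial>M)"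
        using le r by (intro nn_integral_mono_AE) (auto elim!: eventually_mono intro!: ennreal_leI powr_mono2)
      also have "\<dots> = ennreal (B powr enn2real q * T)"
        using emeasure_M T_pos by (simp add: ennreal_mult)
      also have "\<dots> \<le> ennreal (((T + 1) * B) powr enn2real q)"
      proof (rule ennreal_leI)
        have "T \<le> (T + 1) powr enn2real q" using powr_mono[of 1 "enn2real q" "T + 1"] r T_pos by simp
        then have "B powr enn2real q * T \<le> B powr enn2real q * (T + 1) powr enn2real q"
          by (intro mult_left_mono) auto
        also have "\<dots> = ((T + 1) * B) powr enn2real q" using T_pos B by (simp add: powr_mult)
        finally show "B powr enn2real q * T \<le> ((T + 1) * B) powr enn2real q" .
      qed
      finally show ?thesis .
    qed
    ultimately show "u \<in> borel_measurable M \<and> (if q = \<infinity> then AE t in M. norm (u t) \<le> (T + 1) * B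
      else (\<integral>\<^sup>+t. ennreal (norm (u t) powr enn2real q) \<partial>M) \<le> ennreal (((T + 1) * B) powr enn2real q))"
      using u by auto
  qed (use T_pos in simp)
  then show "u \<in> Lq_space q T" "Lq_norm q T u \<le> (T + 1) * B" by auto
qed

text \<open>For a finite exponent Fatou's lemma applies to the powers; for the infinite one, the
  countably many exceptional sets merge into one null set. This lower semicontinuity upgrades
  pointwise to norm convergence in \<open>Lq_complete\<close>.\<close>

lemma Lq_Fatou:
  assumes q: "1 \<le> q" and B: "0 \<le> B" and w: "\<And>m. w m \<in> Lq_space q T" "\<And>m. Lq_norm q T (w m) \<le> B"
    and lim: "AE t in M. (\<lambda>m. w m t) \<longlonglongrightarrow> u t" and u: "u \<in> borel_measurable M"
  shows "u \<in> Lq_space q T" "Lq_norm q T u \<le> B"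
proof -
  have ball: "if q = \<infinity> then AE t in M. norm (w m t) \<le> B
      else (\<integral>\<^sup>+t. ennreal (norm (w m t) powr enn2real q) \<partial>M) \<le> ennreal (B powr enn2real q)" for m
    using Lq_ball_iff[OF q B, of "w m"] w by blast
  note [measurable] = Lq_measurable[OF w(1)]
  have "u \<in> Lq_space q T \<and> Lq_norm q T u \<le> B"
  proof (subst Lq_ball_iff[OF q B], intro conjI u)
    show "if q = \<infinity> then AE t in M. norm (u t) \<le> B
      else (\<integral>\<^sup>+t. ennreal (norm (u t) powr enn2real q) \<partial>M) \<le> ennreal (B powr enn2real q)"
    proof (cases "q = \<infinity>")
      case True
      then have "AE t in M. \<forall>m. norm (w m t) \<le> B" using ball by (simp add: AE_all_countable)
      then have "AE t in M. norm (u t) \<le> B" using lim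
      proof eventually_elim
        case (elim t)
        then show ?case by (intro LIMSEQ_le_const2[OF tendsto_norm]) auto
      qed
      then show ?thesis using True by simp
    next
      case False
      have r: "1 \<le> enn2real q" using q False by (rule one_le_enn2real)
      have "(\<integral>\<^sup>+t. ennreal (norm (u t) powr enn2real q) \<partial>M)
          = (\<integral>\<^sup>+t. liminf (\<lambda>m. ennreal (norm (w m t) powr enn2real q)) \<partial>M)"
      proof (rule nn_integral_cong_AE, use lim in eventually_elim)
        case (elim t)
        then have "(\<lambda>m. ennreal (norm (w m t) powr enn2real q)) \<longlonglongrightarrow> ennreal (norm (u t) powr enn2real q)"
          using r by (intro tendsto_ennrealI tendsto_powr' tendsto_norm tendsto_const) auto
        then show ?case by (rule lim_imp_Liminf[OF trivial_limit_sequentially, symmetric])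
      qed
      also have "\<dots> \<le> liminf (\<lambda>m. \<integral>\<^sup>+t. ennreal (norm (w m t) powr enn2real q) \<partial>M)"
        by (intro nn_integral_liminf) measurable
      also have "\<dots> \<le> liminf (\<lambda>m. ennreal (B powr enn2real q))"
        using ball False by (intro Liminf_mono always_eventually) auto
      also have "\<dots> = ennreal (B powr enn2real q)" by (simp add: Liminf_const)
      finally show ?thesis using False by simp
    qed
  qed
  then show "u \<in> Lq_space q T" "Lq_norm q T u \<le> B" by auto
qed

text \<open>
  A series that converges in the norm converges absolutely almost everywhere, because the norm
  dominates that of \<open>L\<^sup>1\<close>; by Fatou's lemma the pointwise limit is also the limit in norm.
\<close>

lemma Lq_complete:
  fixes u :: "nat \<Rightarrow> real \<Rightarrow> 'a::euclidean_space"
  assumes q: "1 \<le> q" and u: "\<And>n. u n \<in> Lq_space q T"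
    and sm: "summable (\<lambda>n. Lq_norm q T (\<lambda>t. u n t - u (Suc n) t))"
  obtains v where "v \<in> Lq_space q T" "AE t in M. (\<lambda>n. u n t) \<longlonglongrightarrow> v t"
    "(\<lambda>n. Lq_norm q T (\<lambda>t. u n t - v t)) \<longlonglongrightarrow> 0"
proof -
  note [measurable] = Lq_measurable[OF u]
  let ?c = "\<lambda>n. Lq_norm q T (\<lambda>t. u n t - u (Suc n) t)"
  \<comment> \<open>\<open>lim\<close> takes a default value where the sequence diverges;
    \<open>v\<close> is measurable all the same, and divergence will be confined to a null
    set.\<close>
  define v where "v t = lim (\<lambda>n. u n t)" for t
  have v [measurable]: "v \<in> borel_measurable M" unfolding v_def by measurable
  have d: "(\<lambda>t. u n t - u m t) \<in> Lq_space q T" for n m by (intro Lq_diff q u)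
  have "(\<integral>\<^sup>+t. (\<Sum>n. ennreal (norm (u n t - u (Suc n) t))) \<partial>M)
      = (\<Sum>n. \<integral>\<^sup>+t. ennreal (norm (u n t - u (Suc n) t)) \<partial>M)"
    by (intro nn_integral_suminf) measurable
  also have "\<dots> = (\<Sum>n. ennreal (LINT t|M. norm (u n t - u (Suc n) t)))"
    using Lq_integral_bound(1)[OF q d] by (intro suminf_cong nn_integral_eq_integral) auto
  also have "\<dots> \<le> (\<Sum>n. ennreal ((T + 1) * ?c n))"
    using Lq_integral_bound(2)[OF q d] by (intro suminf_le ennreal_leI) auto
  also have "\<dots> = ennreal (\<Sum>n. (T + 1) * ?c n)"
    using sm T_pos
    by (intro suminf_ennreal2 mult_nonneg_nonneg Lq_norm_nonneg summable_mult) auto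
  also have "\<dots> < \<infinity>" by simp
  finally have "AE t in M. (\<Sum>n. ennreal (norm (u n t - u (Suc n) t))) \<noteq> \<infinity>"
    by (intro nn_integral_PInf_AE) auto
  then have lim: "AE t in M. (\<lambda>n. u n t) \<longlonglongrightarrow> v t"
  proof eventually_elim
    case (elim t)
    then have "summable (\<lambda>n. norm (u n t - u (Suc n) t))" by (intro summable_suminf_not_top) auto
    then have "summable (\<lambda>n. norm (u (Suc n) t - u n t))" by (simp add: norm_minus_commute)
    then have "summable (\<lambda>n. u (Suc n) t - u n t)" by (rule summable_norm_cancel)
    then have "convergent (\<lambda>n. \<Sum>i<n. u (Suc i) t - u i t)" by (simp add: summable_iff_convergent)
    then have "convergent (\<lambda>n. u n t - u 0 t)" by (simp add: sum_lessThan_telescope[of "\<lambda>i. u i t"])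
    then have "convergent (\<lambda>n. (u n t - u 0 t) + u 0 t)" by (intro convergent_add convergent_const)
    then show ?case unfolding v_def by (simp add: convergent_LIMSEQ_iff)
  qed
  define tail where "tail n = (\<Sum>k. ?c (k + n))" for n
  \<comment> \<open>The bound is uniform in \<open>m\<close>, so \<open>m\<close> can tend to
    infinity in \<open>Lq_Fatou\<close> while \<open>n\<close> is fixed.\<close>
  have tail_le: "Lq_norm q T (\<lambda>t. u n t - u (m + n) t) \<le> tail n" for n m
  proof -
    have "Lq_norm q T (\<lambda>t. u n t - u (m + n) t) \<le> (\<Sum>k<m. ?c (k + n))"
    proof (induction m)
      case 0
      then show ?case by (simp add: Lq_norm_zero[OF q])
    next
      case (Suc m)
      then show ?case using Lq_triangle[OF q u[of n] u[of "m + n"] u[of "Suc (m + n)"]] by simp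
    qed
    also have "\<dots> \<le> tail n" unfolding tail_def
      using summable_ignore_initial_segment[OF sm, of n] Lq_norm_nonneg by (intro sum_le_suminf) auto
    finally show ?thesis .
  qed
  have tail_lim: "tail \<longlonglongrightarrow> 0"
    unfolding tail_def using suminf_exist_split2[OF sm] by simp
  have tail_nn: "0 \<le> tail n" for n
    unfolding tail_def using summable_ignore_initial_segment[OF sm, of n] Lq_norm_nonneg by (intro suminf_nonneg)
  have F: "(\<lambda>t. u n t - v t) \<in> Lq_space q T" "Lq_norm q T (\<lambda>t. u n t - v t) \<le> tail n" for n
  proof -
    have "AE t in M. (\<lambda>m. u n t - u (m + n) t) \<longlonglongrightarrow> u n t - v t"
      using lim by (rule eventually_mono) (intro tendsto_intros LIMSEQ_ignore_initial_segment)
    note * = Lq_Fatou[OF q tail_nn d tail_le this]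
    show "(\<lambda>t. u n t - v t) \<in> Lq_space q T" "Lq_norm q T (\<lambda>t. u n t - v t) \<le> tail n"
      by (rule *; measurable)+
  qed
  have "v \<in> Lq_space q T" using Lq_diff[OF q u F(1), of 0 0] by simp
  moreover have "(\<lambda>n. Lq_norm q T (\<lambda>t. u n t - v t)) \<longlonglongrightarrow> 0"
    by (rule tendsto_sandwich[OF _ _ tendsto_const tail_lim]) (simp_all add: F(2) Lq_norm_nonneg)
  ultimately show ?thesis using that lim by blast
qed

end

section \<open>Absolutely continuous functions and their derivatives\<close>

text \<open>Truncate \<open>h\<close> at a level \<open>n\<close> such that the excess has integral
  below \<open>e/2\<close>; the truncated part contributes at most \<open>n\<close> times the
  measure of \<open>E\<close>.\<close>

lemma integral_small_on_small_sets:
  fixes h :: "real \<Rightarrow> real"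
  assumes h: "integrable (lebesgue_on S) h" and nn: "\<And>t. 0 \<le> h t" and S: "S \<in> sets lebesgue" and e: "0 < e"
  obtains \<delta> where "0 < \<delta>"
    "\<And>E. E \<in> lmeasurable \<Longrightarrow> E \<subseteq> S \<Longrightarrow> measure lebesgue E < \<delta> \<Longrightarrow> integral E h < e"
proof -
  define M where "M = lebesgue_on S"
  have hM [measurable]: "h \<in> borel_measurable M" and hi: "integrable M h" using h by (auto simp: M_def)
  have mn [measurable]: "(\<lambda>t. min (h t) (real n)) \<in> borel_measurable M" for n by measurable
  have mi: "integrable M (\<lambda>t. min (h t) (real n))" for n
    by (rule Bochner_Integration.integrable_bound[OF hi mn]) (use nn in auto)
  have "(\<lambda>n. LINT t|M. min (h t) (real n)) \<longlonglongrightarrow> LINT t|M. h t"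
  proof (rule integral_dominated_convergence[OF hM mn hi])
    show "AE t in M. (\<lambda>n. min (h t) (real n)) \<longlonglongrightarrow> h t"
    proof (rule AE_I2)
      fix t
      obtain N where "h t \<le> real N" using real_arch_simple by blast
      then have "eventually (\<lambda>n. min (h t) (real n) = h t) sequentially"
        unfolding eventually_sequentially by (intro exI[of _ N]) auto
      then show "(\<lambda>n. min (h t) (real n)) \<longlonglongrightarrow> h t" by (rule tendsto_eventually)
    qed
    show "AE t in M. norm (min (h t) (real n)) \<le> h t" for n using nn by (intro AE_I2) auto
  qed
  then have "eventually (\<lambda>n. (LINT t|M. h t) - e/2 < (LINT t|M. min (h t) (real n))) sequentially"
    using e by (intro order_tendstoD(1)) auto
  then obtain n where n: "(LINT t|M. h t) - e/2 < (LINT t|M. min (h t) (real n))"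
    by (auto simp: eventually_sequentially)
  show thesis
  proof
    show "0 < e / (2 * (real n + 1))" using e by simp
    fix E :: "real set" assume E: "E \<in> lmeasurable" "E \<subseteq> S" "measure lebesgue E < e / (2 * (real n + 1))"
    have EM: "E \<in> sets M" using E S by (auto simp: M_def sets_restrict_space)
    have mE: "emeasure M E = emeasure lebesgue E"
      using E S unfolding M_def by (subst emeasure_restrict_space) auto
    have fin: "emeasure M E < \<infinity>" unfolding mE using E(1) by (simp add: fmeasurable_def del: emeasure_completion)
    have meas: "measure M E = measure lebesgue E" using mE by (simp add: measure_def)
    have ie: "integrable M (\<lambda>t. indicator E t * h t)"
      by (rule integrable_mult_indicator[OF EM hi, unfolded real_scaleR_def])
    have iE: "integrable M (\<lambda>t. real n * indicator E t)"
      using EM fin by (intro integrable_mult_right integrable_real_indicator) auto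
    have res: "lebesgue_on E = restrict_space M E"
      using E(2) by (simp add: M_def restrict_restrict_space S E(1) Int_absorb1 fmeasurableD)
    have half_cancel: "k * (e / (2 * k)) = e / 2" if "0 < k" for k :: real using that by simp
    have "integral E h = integral\<^sup>L (lebesgue_on E) h"
    proof (rule lebesgue_integral_eq_integral[symmetric])
      show "integrable (lebesgue_on E) h"
        unfolding res using EM ie by (subst integrable_restrict_space) auto
    qed (use E in \<open>auto simp: fmeasurableD\<close>)
    also have "\<dots> = (LINT t|M. indicator E t * h t)"
      unfolding res using EM by (subst integral_restrict_space) auto
    also have "\<dots> \<le> (LINT t|M. h t - min (h t) (real n) + real n * indicator E t)"
    proof (rule integral_mono[OF ie])
      show "integrable M (\<lambda>t. h t - min (h t) (real n) + real n * indicator E t)"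
        using hi mi iE by auto
      show "indicator E t * h t \<le> h t - min (h t) (real n) + real n * indicator E t" for t
        using nn[of t] by (auto simp: indicator_def)
    qed
    also have "\<dots> = (LINT t|M. h t) - (LINT t|M. min (h t) (real n)) + real n * measure M E"
      using hi mi iE EM fin by simp
    also have "real n * measure M E \<le> e / 2"
    proof -
      have "real n * measure M E \<le> (real n + 1) * (e / (2 * (real n + 1)))"
        using E(3) meas by (intro mult_mono) auto
      also have "\<dots> = e / 2"
        by (rule half_cancel) simp
      finally show ?thesis .
    qed
    finally show "integral E h < e" using n by simp
  qed
qed


text \<open>The increments over a division add up to at most the integral of
  \<open>norm (v t)\<close> over its union, which is small when the union has small measure.\<close>

lemma absolutely_continuous_integral:
  fixes v :: "real \<Rightarrow> 'a::euclidean_space"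
  assumes v: "integrable (lebesgue_on {0..T}) v"
  shows "absolutely_continuous_on {0..T} (\<lambda>t. c + integral {0..t} v)"
  unfolding absolutely_continuous_on_def
proof (intro allI impI)
  fix e :: real assume "0 < e"
  have n: "integrable (lebesgue_on {0..T}) (\<lambda>t. norm (v t))" using v by (rule integrable_norm)
  obtain \<delta> where \<delta>: "0 < \<delta>"
    "\<And>E. E \<in> lmeasurable \<Longrightarrow> E \<subseteq> {0..T} \<Longrightarrow> measure lebesgue E < \<delta> \<Longrightarrow> integral E (\<lambda>t. norm (v t)) < e"
    by (rule integral_small_on_small_sets[OF n norm_ge_zero _ \<open>0 < e\<close>]) auto
  have vi: "v integrable_on {0..T}" and ni: "(\<lambda>t. norm (v t)) integrable_on {0..T}"
    by (simp_all add: integrable_on_lebesgue_on[OF v] integrable_on_lebesgue_on[OF n])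
  show "\<exists>\<delta>>0. \<forall>D. D division_of \<Union>D \<and> \<Union>D \<subseteq> {0..T} \<and> (\<Sum>K\<in>D. measure lborel K) < \<delta> \<longrightarrow>
      (\<Sum>K\<in>D. norm (c + integral {0..Sup K} v - (c + integral {0..Inf K} v))) < e"
  proof (intro exI[of _ \<delta>] conjI allI impI \<delta>(1))
    fix D :: "real set set"
    assume D: "D division_of \<Union>D \<and> \<Union>D \<subseteq> {0..T} \<and> (\<Sum>K\<in>D. measure lborel K) < \<delta>"
    have K: "norm (c + integral {0..Sup K} v - (c + integral {0..Inf K} v)) \<le> integral K (\<lambda>t. norm (v t))
        \<and> (\<lambda>t. norm (v t)) integrable_on K" if KD: "K \<in> D" for K
    proof -
      have Dd: "D division_of \<Union>D" using D by blast
      obtain a b where "K = {a..b}" using division_ofD(4)[OF Dd KD] by auto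
      moreover have "K \<noteq> {}" using division_ofD(3)[OF Dd KD] .
      moreover have "K \<subseteq> {0..T}" using D that by blast
      ultimately have ab: "K = {a..b}" "a \<le> b" "{a..b} \<subseteq> {0..T}" by auto
      then have "0 \<le> a" "b \<le> T" by auto
      have sub: "v integrable_on {a..b}" "(\<lambda>t. norm (v t)) integrable_on {a..b}" "v integrable_on {0..b}"
        using integrable_on_subinterval[OF vi] integrable_on_subinterval[OF ni] ab \<open>0 \<le> a\<close> \<open>b \<le> T\<close> by auto
      have "integral {0..a} v + integral {a..b} v = integral {0..b} v"
        using \<open>0 \<le> a\<close> ab(2) sub(3) by (rule Henstock_Kurzweil_Integration.integral_combine)
      then have "c + integral {0..Sup K} v - (c + integral {0..Inf K} v) = integral {a..b} v"
        using ab by (simp add: algebra_simps)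
      moreover have "norm (integral {a..b} v) \<le> integral {a..b} (\<lambda>t. norm (v t))"
        using sub by (intro integral_norm_bound_integral) auto
      ultimately show ?thesis using ab(1) sub(2) by simp
    qed
    have "(\<Sum>K\<in>D. norm (c + integral {0..Sup K} v - (c + integral {0..Inf K} v)))
        \<le> (\<Sum>K\<in>D. integral K (\<lambda>t. norm (v t)))"
      using K by (intro sum_mono) blast
    also have "\<dots> = integral (\<Union>D) (\<lambda>t. norm (v t))"
    proof (rule integral_combine_division_topdown[symmetric])
      show "(\<lambda>t. norm (v t)) integrable_on \<Union>D"
        by (rule integrable_combine_division[of D]) (use D K in blast)+
    qed (use D in blast)
    also have "\<dots> < e"
    proof (rule \<delta>(2))
      have fin: "finite D" using D by (auto dest: division_of_finite)
      have lm: "K \<in> lmeasurable" if "K \<in> D" for K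
        using division_ofD(4)[of D "\<Union>D" K] D that by auto
      show "\<Union>D \<in> lmeasurable" using fin lm by (intro fmeasurable.finite_Union) auto
      have "measure lebesgue (\<Union>D) \<le> (\<Sum>K\<in>D. measure lebesgue K)"
        using fin lm by (intro measure_Union_le) (auto simp: fmeasurableD)
      also have "\<dots> = (\<Sum>K\<in>D. measure lborel K)"
      proof (rule sum.cong[OF refl])
        fix K assume "K \<in> D"
        then obtain a b where "K = cbox a b" using division_ofD(4)[of D "\<Union>D" K] D by auto
        then show "measure lebesgue K = measure lborel K" by (simp add: measure_completion)
      qed
      finally show "measure lebesgue (\<Union>D) < \<delta>" using D by simp
    qed (use D in auto)
    finally show "(\<Sum>K\<in>D. norm (c + integral {0..Sup K} v - (c + integral {0..Inf K} v))) < e" .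
  qed
qed

text \<open>
  The gauge forces tags in the exceptional null set to contribute little by absolute continuity,
  and all other tags by differentiability.
\<close>

lemma fundamental_theorem_of_calculus_absolutely_continuous:
  fixes x v :: "real \<Rightarrow> 'a::euclidean_space"
  assumes ab: "a \<le> b" and ac: "absolutely_continuous_on S x" and S: "{a..b} \<subseteq> S"
    and N: "negligible N"
    and der: "\<And>t. t \<in> {a..b} - N \<Longrightarrow> (x has_vector_derivative v t) (at t)"
  shows "(v has_integral (x b - x a)) {a..b}"
proof (rule has_integral_spike[OF N])
  \<comment> \<open>Annulling \<open>v\<close> on \<open>N\<close> does not affect the integral and
    leaves only the increment of \<open>x\<close> in the terms whose tag lies in
    \<open>N\<close>.\<close>
  define w where "w t = (if t \<in> N then 0 else v t)" for t
  show "v t = w t" if "t \<in> {a..b} - N" for t using that by (simp add: w_def)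
  show "(w has_integral (x b - x a)) {a..b}"
    unfolding has_integral_real
  proof (intro allI impI)
    fix e :: real assume e: "0 < e"
    define e1 where "e1 = e / (2 * (b - a + 1))"
    have e1: "0 < e1" using e ab by (simp add: e1_def)
    obtain \<delta> where \<delta>: "0 < \<delta>"
      "\<And>D. D division_of \<Union>D \<Longrightarrow> \<Union>D \<subseteq> S \<Longrightarrow> (\<Sum>K\<in>D. measure lborel K) < \<delta> \<Longrightarrow>
        (\<Sum>K\<in>D. norm (x (Sup K) - x (Inf K))) < e / 2"
      using ac e unfolding absolutely_continuous_on_def by (meson half_gt_zero)
    have "N \<in> sets lebesgue" "measure lebesgue N = 0"
      using N by (auto simp: negligible_imp_sets negligible_imp_measure0)
    \<comment> \<open>The gauge will confine all intervals tagged in \<open>N\<close> to this open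
      set, whose measure is below \<open>\<delta>\<close>, so absolute continuity bounds the sum of
      their increments.\<close>
    obtain G where G: "open G" "N \<subseteq> G" "G - N \<in> lmeasurable" "emeasure lebesgue (G - N) < ennreal \<delta>"
      using sets_lebesgue_outer_open[OF \<open>N \<in> sets lebesgue\<close> \<delta>(1)] by blast
    have "N \<in> lmeasurable" using N by (rule negligible_imp_measurable)
    then have Glm: "G \<in> lmeasurable"
      using fmeasurable.Un[OF G(3)] G(2) by (metis Diff_partition sup_commute)
    have "measure lebesgue G \<le> measure lebesgue (G - N) + measure lebesgue N"
      using measure_Un_le[of "G - N" lebesgue N] G(2,3) \<open>N \<in> sets lebesgue\<close>
      by (simp add: fmeasurableD Diff_partition Un_absorb2)
    also have "\<dots> < \<delta>"
      using G(3,4) \<open>measure lebesgue N = 0\<close> by (simp add: emeasure_eq_measure2 ennreal_less_iff del: emeasure_completion)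
    finally have Gm: "measure lebesgue G < \<delta>" .
    have "\<exists>r>0. \<forall>s. \<bar>s - t\<bar> < r \<longrightarrow> norm (x s - x t - (s - t) *\<^sub>R v t) \<le> e1 * \<bar>s - t\<bar>"
      if "t \<in> {a..b} - N" for t
      using der[OF that] e1 unfolding has_vector_derivative_def has_derivative_at_alt by (auto simp: real_norm_def)
    then obtain \<rho> where "\<forall>t. t \<in> {a..b} - N \<longrightarrow> \<rho> t > 0 \<and>
        (\<forall>s. \<bar>s - t\<bar> < \<rho> t \<longrightarrow> norm (x s - x t - (s - t) *\<^sub>R v t) \<le> e1 * \<bar>s - t\<bar>)"
      by metis
    then have \<rho>: "\<And>t. t \<in> {a..b} - N \<Longrightarrow> \<rho> t > 0"
      "\<And>t s. t \<in> {a..b} - N \<Longrightarrow> \<bar>s - t\<bar> < \<rho> t \<Longrightarrow>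
        norm (x s - x t - (s - t) *\<^sub>R v t) \<le> e1 * \<bar>s - t\<bar>"
      by blast+
    define \<gamma> where "\<gamma> t = (if t \<in> N then G else if t \<in> {a..b} then ball t (\<rho> t) else UNIV)" for t
    have gauge: "gauge \<gamma>" using G \<rho>(1) by (auto simp: gauge_def \<gamma>_def)
    have small: "norm ((\<Sum>(t, K)\<in>D. measure lborel K *\<^sub>R w t) - (x b - x a)) < e"
      if D: "D tagged_division_of {a..b}" and fine: "\<gamma> fine D" for D
    proof -
      note tD = tagged_division_ofD[OF D]
      define g where "g K = x (Sup K) - x (Inf K)" for K
      have K: "\<exists>c d. K = {c..d} \<and> c \<le> t \<and> t \<le> d \<and> a \<le> c \<and> d \<le> b" if tK: "(t, K) \<in> D" for t K
      proof -
        obtain c d where "K = {c..d}" using tD(4)[OF tK] by auto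
        then show ?thesis using tD(2,3)[OF tK] by (intro exI[of _ c] exI[of _ d]) auto
      qed
      define D1 where "D1 = {p \<in> D. fst p \<in> N}"
      define D2 where "D2 = {p \<in> D. fst p \<notin> N}"
      have split: "D = D1 \<union> D2" "D1 \<inter> D2 = {}" "finite D1" "finite D2"
        using tD(1) by (auto simp: D1_def D2_def)
      have "(\<Sum>(t, K)\<in>D. measure lborel K *\<^sub>R w t) - (x b - x a)
          = (\<Sum>(t, K)\<in>D. measure lborel K *\<^sub>R w t - g K)"
        using additive_tagged_division_1[OF ab D, of x]
        by (simp add: g_def case_prod_unfold sum_subtractf)
      also have "\<dots> = (\<Sum>(t, K)\<in>D1. measure lborel K *\<^sub>R w t - g K) + (\<Sum>(t, K)\<in>D2. measure lborel K *\<^sub>R w t - g K)"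
        by (subst split(1), rule sum.union_disjoint[OF split(3,4,2)])
      finally have eq: "(\<Sum>(t, K)\<in>D. measure lborel K *\<^sub>R w t) - (x b - x a) = \<dots>" .
      have "norm (\<Sum>(t, K)\<in>D1. measure lborel K *\<^sub>R w t - g K) \<le> (\<Sum>(t, K)\<in>D1. norm (g K))"
        by (rule sum_norm_le) (auto simp: D1_def w_def)
      also have "\<dots> < e / 2"
      proof -
        have "D tagged_partial_division_of {a..b}" using D by (simp add: tagged_division_of_def)
        then have p: "D1 tagged_partial_division_of {a..b}"
          by (rule tagged_partial_division_subset) (simp add: D1_def)
        have K1: "\<exists>c d. K = {c..d} \<and> c \<le> d \<and> a \<le> c \<and> d \<le> b" if "K \<in> snd ` D1" for K
        proof -
          obtain t where "(t, K) \<in> D" using \<open>K \<in> snd ` D1\<close> by (auto simp: D1_def)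
          from K[OF this] show ?thesis by force
        qed
        then have ne: "K \<noteq> {}" if "K \<in> snd ` D1" for K using that by fastforce
        note dv = partial_division_of_tagged_division[OF p]
        \<comment> \<open>\<open>Sup\<close> and \<open>Inf\<close> of the empty set have no known
          value. With 0 assigned to it, the summand vanishes on every degenerate box, as the change
          from tagged intervals to intervals requires.\<close>
        have "(\<Sum>(t, K)\<in>D1. norm (g K)) = (\<Sum>(t, K)\<in>D1. (if K = {} then 0 else norm (g K)))"
          by (rule sum.cong[OF refl]) (use ne in \<open>force split: prod.splits\<close>)
        also have "\<dots> = (\<Sum>K\<in>snd ` D1. (if K = {} then 0 else norm (g K)))"
        proof (rule sum.over_tagged_division_lemma[OF tagged_partial_division_of_Union_self[OF p]])
          fix u v :: real assume "box u v = {}"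
          then show "(if cbox u v = {} then 0 else norm (g (cbox u v))) = 0" by (auto simp: g_def)
        qed
        also have "\<dots> = (\<Sum>K\<in>snd ` D1. norm (x (Sup K) - x (Inf K)))"
          using ne by (intro sum.cong[OF refl]) (simp add: g_def)
        also have "\<dots> < e / 2"
        proof (rule \<delta>(2)[OF dv])
          have "K \<subseteq> {a..b}" if "K \<in> snd ` D1" for K using K1[OF that] by auto
          then show "\<Union>(snd ` D1) \<subseteq> S" using S by blast
          have "(\<Sum>K\<in>snd ` D1. measure lborel K) = (\<Sum>K\<in>snd ` D1. measure lebesgue K)"
          proof (rule sum.cong[OF refl])
            fix K assume "K \<in> snd ` D1"
            from K1[OF this] show "measure lborel K = measure lebesgue K" by auto
          qed
          also have "\<dots> = measure lebesgue (\<Union>(snd ` D1))"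
            using content_division[OF dv] by simp
          also have "\<dots> \<le> measure lebesgue G"
          proof (rule measure_mono_fmeasurable[OF _ _ Glm])
            show "\<Union>(snd ` D1) \<subseteq> G"
            proof (rule Union_least, clarify)
              fix t K s assume "(t, K) \<in> D1" "s \<in> snd (t, K)"
              then show "s \<in> G" using fineD[OF fine, of t K] by (auto simp: D1_def \<gamma>_def)
            qed
            show "\<Union>(snd ` D1) \<in> sets lebesgue"
            proof (rule sets.finite_Union)
              show "snd ` D1 \<subseteq> sets lebesgue"
              proof
                fix K assume "K \<in> snd ` D1"
                from K1[OF this] show "K \<in> sets lebesgue" by auto
              qed
            qed (use split(3) in simp)
          qed
          finally show "(\<Sum>K\<in>snd ` D1. measure lborel K) < \<delta>" using Gm by simp
        qed
        finally show ?thesis .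
      qed
      finally have 1: "norm (\<Sum>(t, K)\<in>D1. measure lborel K *\<^sub>R w t - g K) < e / 2" .
      \<comment> \<open>Both ends of an interval are compared with its tag, which lies between them,
        so the two errors add up to \<open>e1\<close> times the length.\<close>
      have "norm (\<Sum>(t, K)\<in>D2. measure lborel K *\<^sub>R w t - g K) \<le> (\<Sum>(t, K)\<in>D2. e1 * measure lborel K)"
      proof (rule sum_norm_le, clarify)
        fix t K assume "(t, K) \<in> D2"
        then have tK: "(t, K) \<in> D" "t \<notin> N" by (auto simp: D2_def)
        then obtain c d where cd: "K = {c..d}" "c \<le> t" "t \<le> d" "a \<le> c" "d \<le> b" using K by blast
        then have t: "t \<in> {a..b} - N" using tK by auto
        have "K \<subseteq> ball t (\<rho> t)" using fineD[OF fine tK(1)] t by (auto simp: \<gamma>_def)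
        moreover have "c \<in> K" "d \<in> K" using cd by auto
        ultimately have "c \<in> ball t (\<rho> t)" "d \<in> ball t (\<rho> t)" by blast+
        then have "\<bar>c - t\<bar> < \<rho> t" "\<bar>d - t\<bar> < \<rho> t" by (auto simp: dist_real_def)
        then have "norm (x c - x t - (c - t) *\<^sub>R v t) \<le> e1 * \<bar>c - t\<bar>"
          "norm (x d - x t - (d - t) *\<^sub>R v t) \<le> e1 * \<bar>d - t\<bar>"
          using \<rho>(2)[OF t] by blast+
        then have "norm ((x c - x t - (c - t) *\<^sub>R v t) - (x d - x t - (d - t) *\<^sub>R v t)) \<le> e1 * \<bar>c - t\<bar> + e1 * \<bar>d - t\<bar>"
          by (rule order_trans[OF norm_triangle_ineq4 add_mono])
        also have "(x c - x t - (c - t) *\<^sub>R v t) - (x d - x t - (d - t) *\<^sub>R v t) = measure lborel K *\<^sub>R w t - g K"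
          using cd tK by (simp add: g_def w_def algebra_simps)
        also have "e1 * \<bar>c - t\<bar> + e1 * \<bar>d - t\<bar> = e1 * measure lborel K"
          using cd by (simp add: algebra_simps)
        finally show "norm (measure lborel K *\<^sub>R w t - g K) \<le> e1 * measure lborel K" .
      qed
      also have "\<dots> \<le> (\<Sum>(t, K)\<in>D. e1 * measure lborel K)"
        using e1 tD(1) by (intro sum_mono2) (auto simp: D2_def)
      also have "\<dots> = e1 * (b - a)"
        using additive_content_tagged_division[of D a b] D ab
        by (simp add: sum_distrib_left[symmetric] case_prod_unfold)
      also have "\<dots> \<le> e / 2" using e ab by (simp add: e1_def field_simps)
      finally have 2: "norm (\<Sum>(t, K)\<in>D2. measure lborel K *\<^sub>R w t - g K) \<le> e / 2" .
      show ?thesis unfolding eq using norm_triangle_ineq 1 2 by (smt (verit) field_sum_of_halves)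
    qed
    show "\<exists>\<gamma>. gauge \<gamma> \<and> (\<forall>D. D tagged_division_of {a..b} \<and> \<gamma> fine D \<longrightarrow>
        norm ((\<Sum>(t, K)\<in>D. measure lborel K *\<^sub>R w t) - (x b - x a)) < e)"
    proof (intro exI[of _ \<gamma>] conjI allI impI gauge)
      fix D assume "D tagged_division_of {a..b} \<and> \<gamma> fine D"
      then show "norm ((\<Sum>(t, K)\<in>D. measure lborel K *\<^sub>R w t) - (x b - x a)) < e"
        by (elim conjE) (rule small)
    qed
  qed
qed


text \<open>Lebesgue differentiation is applied to averages over intervals that start at a point.
  The reflected function supplies the intervals that end there, and both together give the two-sided
  derivative.\<close>

lemma has_vector_derivative_integral_outside_negligible:
  fixes v :: "real \<Rightarrow> 'a::euclidean_space"
  assumes v: "integrable (lebesgue_on {0..T}) v"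
  obtains N where "negligible N"
    "\<And>t. t \<in> {0..T} - N \<Longrightarrow> ((\<lambda>t. c + integral {0..t} v) has_vector_derivative v t) (at t)"
proof -
  have vi: "v integrable_on {0..T}" by (simp add: integrable_on_lebesgue_on[OF v])
  define g where "g t = (if t \<in> {0..T} then v t else 0)" for t
  have "g integrable_on UNIV" unfolding g_def using vi by (simp only: integrable_restrict_UNIV)
  then have gi: "g integrable_on cbox a b" for a b by (rule integrable_on_subcbox) simp
  have gi': "(\<lambda>t. g (- t)) integrable_on cbox a b" for a b
    using gi[of "- b" "- a"] integrable_reflect[of g "- a" "- b"] by simp
  obtain N1 where N1: "negligible N1" "\<And>x e. \<lbrakk>x \<notin> N1; 0 < e\<rbrakk> \<Longrightarrow>
      \<exists>d>0. \<forall>h. 0 < h \<and> h < d \<longrightarrow> norm (integral (cbox x (x + h *\<^sub>R One)) g /\<^sub>R h ^ DIM(real) - g x) < e"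
    by (rule integrable_ccontinuous_explicit[OF gi]) blast
  obtain N2 where N2: "negligible N2" "\<And>x e. \<lbrakk>x \<notin> N2; 0 < e\<rbrakk> \<Longrightarrow>
      \<exists>d>0. \<forall>h. 0 < h \<and> h < d \<longrightarrow>
        norm (integral (cbox x (x + h *\<^sub>R One)) (\<lambda>t. g (- t)) /\<^sub>R h ^ DIM(real) - g (- x)) < e"
    by (rule integrable_ccontinuous_explicit[OF gi']) blast
  have scale: "norm (I - h *\<^sub>R w) \<le> e * h" if h: "0 < h" and lt: "norm (I /\<^sub>R h - w) < e"
    for I w :: 'a and h e :: real
  proof -
    have "I - h *\<^sub>R w = h *\<^sub>R (I /\<^sub>R h - w)" using h by (simp add: scaleR_diff_right)
    then have "norm (I - h *\<^sub>R w) = h * norm (I /\<^sub>R h - w)" using h by simp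
    then show ?thesis using h lt by (simp add: mult.commute)
  qed
  define F where "F t = c + integral {0..t} v" for t
  have F: "F y - F x = integral {x..y} g" if xy: "0 \<le> x" "x \<le> y" "y \<le> T" for x y
  proof -
    have "v integrable_on {0..y}" by (rule integrable_on_subinterval[OF vi]) (use xy in auto)
    then have "integral {0..x} v + integral {x..y} v = integral {0..y} v"
      using xy by (intro Henstock_Kurzweil_Integration.integral_combine) auto
    moreover have "integral {x..y} v = integral {x..y} g"
      by (rule integral_cong) (use xy in \<open>auto simp: g_def\<close>)
    ultimately show ?thesis by (simp add: F_def algebra_simps)
  qed
  show thesis
  proof
    have "negligible (uminus ` N2)"
      by (rule negligible_locally_Lipschitz_image[OF order_refl N2(1)])
        (rule exI[of _ UNIV], rule exI[of _ 1], simp add: abs_minus_commute)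
    \<comment> \<open>The endpoints are discarded because the derivative is two-sided, while the
      increments of the primitive are controlled only within the interval.\<close>
    then show "negligible (N1 \<union> uminus ` N2 \<union> {0, T})"
      using N1(1) by (intro negligible_Un) auto
    fix t assume t: "t \<in> {0..T} - (N1 \<union> uminus ` N2 \<union> {0, T})"
    then have tT: "0 < t" "t < T" by auto
    have "- t \<notin> N2"
    proof
      assume "- t \<in> N2"
      then have "- (- t) \<in> uminus ` N2" by (rule imageI)
      then show False using t by simp
    qed
    have gt: "g t = v t" using tT by (simp add: g_def)
    have "(F has_vector_derivative v t) (at t)"
      unfolding has_vector_derivative_def has_derivative_at_alt
    proof (intro conjI allI impI bounded_linear_scaleR_left)
      fix e :: real assume e: "0 < e"
      obtain d1 where d1: "d1 > 0"
        "\<And>h. 0 < h \<Longrightarrow> h < d1 \<Longrightarrow> norm (integral {t..t + h} g /\<^sub>R h - v t) < e"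
        using N1(2)[of t e] t e gt by auto
      obtain d2 where d2: "d2 > 0"
        "\<And>h. 0 < h \<Longrightarrow> h < d2 \<Longrightarrow> norm (integral {- t..- t + h} (\<lambda>t. g (- t)) /\<^sub>R h - v t) < e"
        using N2(2)[of "- t" e] \<open>- t \<notin> N2\<close> e gt by auto
      show "\<exists>d>0. \<forall>y. norm (y - t) < d \<longrightarrow> norm (F y - F t - (y - t) *\<^sub>R v t) \<le> e * norm (y - t)"
      proof (intro exI[of _ "min (min d1 d2) (min t (T - t))"] conjI allI impI)
        fix y assume y: "norm (y - t) < min (min d1 d2) (min t (T - t))"
        consider "y = t" | "t < y" | "y < t" by linarith
        then show "norm (F y - F t - (y - t) *\<^sub>R v t) \<le> e * norm (y - t)"
        proof cases
          case 2
          then have "F y - F t = integral {t..t + (y - t)} g" using F[of t y] tT y by auto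
          then show ?thesis using scale[OF _ d1(2)[of "y - t"]] 2 y by auto
        next
          case 3
          have "F t - F y = integral {y..t} g" using F[of y t] tT y 3 by auto
          also have "\<dots> = integral {- t..- y} (\<lambda>t. g (- t))" using integral_reflect_real[of t y g] by simp
          also have "- y = - t + (t - y)" by simp
          finally have "norm ((F t - F y) - (t - y) *\<^sub>R v t) \<le> e * (t - y)"
            using scale[OF _ d2(2)[of "t - y"]] 3 y by auto
          moreover have "F y - F t - (y - t) *\<^sub>R v t = - ((F t - F y) - (t - y) *\<^sub>R v t)"
            by (simp add: algebra_simps)
          ultimately show ?thesis using 3 by (simp only: norm_minus_cancel) simp
        qed simp
      qed (use d1(1) d2(1) tT in simp)
    qed
    then show "((\<lambda>t. c + integral {0..t} v) has_vector_derivative v t) (at t)"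
      unfolding F_def .
  qed
qed

section \<open>Admissible processes\<close>

context time_interval
begin

lemma AE_M_iff: "(AE t in M. P t) \<longleftrightarrow> (\<exists>N. negligible N \<and> (\<forall>t\<in>{0..T} - N. P t))"
proof -
  have "(AE t in M. P t) \<longleftrightarrow> (AE t in lebesgue. t \<in> {0..T} \<longrightarrow> P t)"
    by (simp add: AE_restrict_space_iff)
  also have "\<dots> \<longleftrightarrow> (\<exists>N. negligible N \<and> {t. \<not> (t \<in> {0..T} \<longrightarrow> P t)} \<subseteq> N)"
    by (rule eventually_ae_filter_negligible)
  also have "\<dots> \<longleftrightarrow> (\<exists>N. negligible N \<and> (\<forall>t\<in>{0..T} - N. P t))" by blast
  finally show ?thesis .
qed

lemma AE_M_I: "(\<And>t. t \<in> {0..T} \<Longrightarrow> P t) \<Longrightarrow> AE t in M. P t"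
  by (rule AE_I2) simp

lemma measurable_along_process:
  fixes g :: "real^'d \<Rightarrow> real^'m \<Rightarrow> real \<Rightarrow> 'k::topological_space"
  assumes g: "jointly_continuous T g" and x: "continuous_on {0..T} x" and u: "u \<in> borel_measurable M"
  shows "(\<lambda>t. g (x t) (u t) t) \<in> borel_measurable M"
proof -
  let ?S = "UNIV \<times> UNIV \<times> {0..T} :: ((real^'d) \<times> (real^'m) \<times> real) set"
  have "(\<lambda>(x, u, t). g x u t) \<in> borel_measurable (restrict_space borel ?S)"
    using g unfolding jointly_continuous_def by (rule borel_measurable_continuous_on_restrict)
  moreover have "(\<lambda>t. (x t, u t, t)) \<in> measurable M (restrict_space borel ?S)"
  proof (rule measurable_restrict_space2)
    show "(\<lambda>t. (x t, u t, t)) \<in> borel_measurable M"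
      by (intro borel_measurable_Pair u continuous_imp_measurable_on_sets_lebesgue x continuous_on_id) auto
  qed auto
  ultimately have "(\<lambda>t. (\<lambda>(x, u, t). g x u t) (x t, u t, t)) \<in> borel_measurable M"
    by (rule measurable_compose[rotated])
  then show ?thesis by simp
qed

lemma Lq_integrable_on:
  assumes "1 \<le> q" "w \<in> Lq_space q T"
  shows "w integrable_on {0..T}" "(\<lambda>t. norm (w t)) integrable_on {0..T}"
  by (simp_all add: integrable_on_lebesgue_on Lq_integral_bound(1)[OF assms])

lemma Lq_norm_primitive:
  assumes q: "1 \<le> q" and w: "w \<in> Lq_space q T" and t: "t \<in> {0..T}"
  shows "norm (integral {0..t} w) \<le> (T + 1) * Lq_norm q T w"
proof -
  note i = Lq_integrable_on[OF q w]
  have sub: "w integrable_on {0..t}" "(\<lambda>t. norm (w t)) integrable_on {0..t}"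
    by (rule integrable_on_subinterval[OF i(1)] integrable_on_subinterval[OF i(2)]; use t in auto)+
  have "norm (integral {0..t} w) \<le> integral {0..t} (\<lambda>t. norm (w t))"
    using sub by (intro integral_norm_bound_integral) auto
  also have "\<dots> \<le> integral {0..T} (\<lambda>t. norm (w t))"
    using sub(2) i(2) t by (intro integral_subset_le) auto
  also have "\<dots> = (LINT t|M. norm (w t))"
    using Lq_integral_bound(1)[OF q w] by (intro lebesgue_integral_eq_integral[symmetric]) auto
  finally show ?thesis using Lq_integral_bound(2)[OF q w] by simp
qed

end

section \<open>State equation, distance and completeness of the admissible set\<close>

locale control_system = time_interval T for T :: real +
  fixes p q :: ennreal and x0 :: "real^'d" and f :: "real^'d \<Rightarrow> real^'m \<Rightarrow> real \<Rightarrow> real^'d"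
    and U :: "(real \<Rightarrow> real^'m) set"
  assumes p: "1 \<le> p" and q: "1 \<le> q" and U_closed: "Lq_closed q T U" and f_cont: "jointly_continuous T f"
begin

abbreviation A :: "('d, 'm) traj set" where "A \<equiv> admissible p q T f x0 U"

text \<open>For admissible \<open>z\<close> this agrees almost everywhere with the derivative of the
  state and replaces it in all norms. It depends continuously on the values of state and control, so
  it can be followed through pointwise limits.\<close>

definition vel :: "('d, 'm) traj \<Rightarrow> real \<Rightarrow> real^'d" where
  "vel z t = f (fst z t) (snd z t) t"

lemma admissible_derivative:
  assumes "z \<in> A"
  shows "AE t in M. (fst z has_vector_derivative vel z t) (at t)"
  using assms by (auto simp: admissible_def vel_def)

lemma admissible_control: "z \<in> A \<Longrightarrow> snd z \<in> U" "z \<in> A \<Longrightarrow> snd z \<in> Lq_space q T"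
  by (auto simp: admissible_def X_space_def)

lemma vel_Lq:
  assumes z: "z \<in> A"
  shows "vel z \<in> Lq_space p T"
proof (rule Lq_cong(1)[OF p])
  show "(\<lambda>t. vector_derivative (fst z) (at t)) \<in> Lq_space p T"
    using z by (auto simp: admissible_def X_space_def W_space_def)
  show "AE t in M. vector_derivative (fst z) (at t) = vel z t"
    using admissible_derivative[OF z] by eventually_elim (rule vector_derivative_at)
qed

text \<open>Absolute continuity turns the differential equation, valid almost everywhere, into an
  integral equation, so that estimates of states reduce to estimates of velocities.\<close>

lemma state_eq:
  assumes z: "z \<in> A" and t: "t \<in> {0..T}"
  shows "fst z t = x0 + integral {0..t} (vel z)"
proof -
  obtain N where N: "negligible N" "\<forall>s\<in>{0..T} - N. (fst z has_vector_derivative vel z s) (at s)"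
    using admissible_derivative[OF z] unfolding AE_M_iff by blast
  have "(vel z has_integral (fst z t - fst z 0)) {0..t}"
  proof (rule fundamental_theorem_of_calculus_absolutely_continuous[OF _ _ _ N(1)])
    show "absolutely_continuous_on {0..T} (fst z)"
      using z by (auto simp: admissible_def X_space_def W_space_def)
  qed (use t N(2) in auto)
  then have "integral {0..t} (vel z) = fst z t - fst z 0" by (rule integral_unique)
  moreover have "fst z 0 = x0" using z by (auto simp: admissible_def)
  ultimately show ?thesis by simp
qed

lemma state_continuous:
  assumes z: "z \<in> A"
  shows "continuous_on {0..T} (fst z)"
proof -
  have "continuous_on {0..T} (\<lambda>t. x0 + integral {0..t} (vel z))"
    by (intro continuous_intros indefinite_integral_continuous_1 Lq_integrable_on(1)[OF p vel_Lq[OF z]])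
  then show ?thesis by (rule continuous_on_eq) (simp add: state_eq[OF z])
qed

text \<open>The common initial value cancels, so the velocities alone control the uniform distance
  of two states.\<close>

lemma state_diff_bound:
  assumes z: "z \<in> A" and w: "w \<in> A" and t: "t \<in> {0..T}"
  shows "norm (fst z t - fst w t) \<le> (T + 1) * Lq_norm p T (\<lambda>t. vel z t - vel w t)"
proof -
  have i: "y \<in> A \<Longrightarrow> vel y integrable_on {0..t}" for y
    by (rule integrable_on_subinterval[OF Lq_integrable_on(1)[OF p vel_Lq]]) (use t in auto)
  have "fst z t - fst w t = integral {0..t} (\<lambda>t. vel z t - vel w t)"
    using i[OF z] i[OF w] state_eq[OF z t] state_eq[OF w t] by (simp add: Henstock_Kurzweil_Integration.integral_diff)
  then show ?thesis
    using Lq_norm_primitive[OF p Lq_diff[OF p vel_Lq[OF z] vel_Lq[OF w]] t] by simp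
qed

lemma state_Lq:
  assumes z: "z \<in> A"
  shows "fst z \<in> Lq_space p T"
proof -
  have "bounded (fst z ` {0..T})"
    using state_continuous[OF z] by (intro compact_imp_bounded compact_continuous_image) auto
  then obtain B where B: "\<forall>t\<in>{0..T}. norm (fst z t) \<le> B" by (auto simp: bounded_iff)
  show ?thesis
  proof (rule Lq_bounded(1)[OF p, of "max B 0"])
    show "fst z \<in> borel_measurable M"
      using state_continuous[OF z] by (rule continuous_imp_measurable_on_sets_lebesgue) simp
    show "AE t in M. norm (fst z t) \<le> max B 0" using B by (intro AE_M_I) (simp add: le_max_iff_disj)
  qed simp
qed

lemma W_norm_diff:
  assumes z: "z \<in> A" and w: "w \<in> A"
  shows "W_norm p T (\<lambda>t. fst z t - fst w t)
    = Lq_norm p T (\<lambda>t. fst z t - fst w t) + Lq_norm p T (\<lambda>t. vel z t - vel w t)"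
proof -
  have "AE t in M. vel z t - vel w t = vector_derivative (\<lambda>t. fst z t - fst w t) (at t)"
    using admissible_derivative[OF z] admissible_derivative[OF w]
  proof eventually_elim
    case (elim t)
    then show ?case using vector_derivative_at[OF has_vector_derivative_diff] by metis
  qed
  from Lq_cong(2)[OF p Lq_diff[OF p vel_Lq[OF z] vel_Lq[OF w]] this] show ?thesis
    unfolding W_norm_def by simp
qed

lemma X_dist_eq:
  assumes "z \<in> A" "w \<in> A"
  shows "X_dist p q T z w = Lq_norm p T (\<lambda>t. fst z t - fst w t)
    + Lq_norm p T (\<lambda>t. vel z t - vel w t) + Lq_norm q T (\<lambda>t. snd z t - snd w t)"
  using W_norm_diff[OF assms] by (simp add: X_dist_def X_norm_def case_prod_unfold)

lemma X_norm_eq: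
  assumes z: "z \<in> A"
  shows "X_norm p q T z = Lq_norm p T (fst z) + Lq_norm p T (vel z) + Lq_norm q T (snd z)"
proof -
  have "AE t in M. vel z t = vector_derivative (fst z) (at t)"
    using admissible_derivative[OF z] by eventually_elim (simp add: vector_derivative_at)
  from Lq_cong(2)[OF p vel_Lq[OF z] this] show ?thesis
    by (simp add: X_norm_def W_norm_def case_prod_unfold)
qed

lemma X_dist_nonneg: "0 \<le> X_dist p q T z w"
  by (simp add: X_dist_def X_norm_def W_norm_def case_prod_unfold Lq_norm_nonneg)

lemma X_dist_refl: "X_dist p q T z z = 0"
  by (simp add: X_dist_def X_norm_def W_norm_def case_prod_unfold Lq_norm_zero p q)

lemma X_dist_commute:
  assumes "z \<in> A" "w \<in> A"
  shows "X_dist p q T z w = X_dist p q T w z"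
  using Lq_norm_minus_commute[OF p Lq_diff[OF p state_Lq state_Lq], OF assms]
    Lq_norm_minus_commute[OF p Lq_diff[OF p vel_Lq vel_Lq], OF assms]
    Lq_norm_minus_commute[OF q Lq_diff[OF q admissible_control(2) admissible_control(2)], OF assms]
  by (simp add: X_dist_eq assms)

lemma X_dist_triangle:
  assumes "x \<in> A" "y \<in> A" "z \<in> A"
  shows "X_dist p q T x z \<le> X_dist p q T x y + X_dist p q T y z"
  using Lq_triangle[OF p state_Lq state_Lq state_Lq, OF assms]
    Lq_triangle[OF p vel_Lq vel_Lq vel_Lq, OF assms]
    Lq_triangle[OF q admissible_control(2) admissible_control(2) admissible_control(2), OF assms]
  by (simp add: X_dist_eq assms)

lemma X_dist_components:
  assumes "z \<in> A" "w \<in> A"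
  shows "Lq_norm p T (\<lambda>t. vel z t - vel w t) \<le> X_dist p q T z w"
    "Lq_norm q T (\<lambda>t. snd z t - snd w t) \<le> X_dist p q T z w"
  by (simp_all add: X_dist_eq assms add_increasing add_increasing2 Lq_norm_nonneg)

lemma state_diff_le_X_dist:
  assumes "z \<in> A" "w \<in> A" "t \<in> {0..T}"
  shows "norm (fst z t - fst w t) \<le> (T + 1) * X_dist p q T z w"
proof -
  have "(T + 1) * Lq_norm p T (\<lambda>t. vel z t - vel w t) \<le> (T + 1) * X_dist p q T z w"
    using X_dist_components(1)[OF assms(1,2)] T_pos by (intro mult_left_mono) auto
  then show ?thesis using state_diff_bound[OF assms] by simp
qed

lemma state_le_X_norm:
  assumes z: "z \<in> A" and t: "t \<in> {0..T}"
  shows "norm (fst z t) \<le> norm x0 + (T + 1) * X_norm p q T z"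
proof -
  have "norm (fst z t) \<le> norm x0 + norm (integral {0..t} (vel z))"
    unfolding state_eq[OF z t] by (rule norm_triangle_ineq)
  also have "norm (integral {0..t} (vel z)) \<le> (T + 1) * Lq_norm p T (vel z)"
    by (rule Lq_norm_primitive[OF p vel_Lq[OF z] t])
  also have "\<dots> \<le> (T + 1) * X_norm p q T z"
    using T_pos by (intro mult_left_mono) (simp_all add: X_norm_eq[OF z] add_increasing add_increasing2 Lq_norm_nonneg)
  finally show ?thesis by simp
qed

text \<open>Controls and velocities have separate limits, in norm and almost everywhere. The limit
  state is the primitive of the limit velocity, and continuity of \<open>f\<close> identifies that
  velocity with the right-hand side at the limit state and control.\<close>

lemma admissible_complete:
  assumes Y: "\<And>n. Y n \<in> A" and sm: "summable (\<lambda>n. X_dist p q T (Y n) (Y (Suc n)))"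
  shows "\<exists>w\<in>A. (\<lambda>n. X_dist p q T (Y n) w) \<longlonglongrightarrow> 0"
proof -
  have "summable (\<lambda>n. Lq_norm q T (\<lambda>t. snd (Y n) t - snd (Y (Suc n)) t))"
    by (rule summable_comparison_test'[OF sm, of 0]) (simp add: Lq_norm_nonneg X_dist_components(2)[OF Y Y])
  then obtain u where u: "u \<in> Lq_space q T" "AE t in M. (\<lambda>n. snd (Y n) t) \<longlonglongrightarrow> u t"
    "(\<lambda>n. Lq_norm q T (\<lambda>t. snd (Y n) t - u t)) \<longlonglongrightarrow> 0"
    by (rule Lq_complete[OF q admissible_control(2)[OF Y]])
  have "summable (\<lambda>n. Lq_norm p T (\<lambda>t. vel (Y n) t - vel (Y (Suc n)) t))"
    by (rule summable_comparison_test'[OF sm, of 0]) (simp add: Lq_norm_nonneg X_dist_components(1)[OF Y Y])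
  then obtain v where v: "v \<in> Lq_space p T" "AE t in M. (\<lambda>n. vel (Y n) t) \<longlonglongrightarrow> v t"
    "(\<lambda>n. Lq_norm p T (\<lambda>t. vel (Y n) t - v t)) \<longlonglongrightarrow> 0"
    by (rule Lq_complete[OF p vel_Lq[OF Y]])
  define x where "x t = x0 + integral {0..t} v" for t
  have iv: "integrable M v" using Lq_integral_bound(1)[OF p v(1)] .
  have xd: "norm (fst (Y n) t - x t) \<le> (T + 1) * Lq_norm p T (\<lambda>t. vel (Y n) t - v t)" if t: "t \<in> {0..T}" for n t
  proof -
    have i: "vel (Y n) integrable_on {0..t}" "v integrable_on {0..t}"
      by (rule integrable_on_subinterval[OF Lq_integrable_on(1)[OF p vel_Lq[OF Y]]]
          integrable_on_subinterval[OF Lq_integrable_on(1)[OF p v(1)]]; use t in auto)+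
    have "fst (Y n) t - x t = integral {0..t} (\<lambda>t. vel (Y n) t - v t)"
      using i state_eq[OF Y t] by (simp add: x_def Henstock_Kurzweil_Integration.integral_diff)
    then show ?thesis using Lq_norm_primitive[OF p Lq_diff[OF p vel_Lq[OF Y] v(1)] t] by simp
  qed
  have xl0: "(\<lambda>n. fst (Y n) t - x t) \<longlonglongrightarrow> 0" if t: "t \<in> {0..T}" for t
  proof (rule Lim_null_comparison)
    show "eventually (\<lambda>n. norm (fst (Y n) t - x t) \<le> (T + 1) * Lq_norm p T (\<lambda>t. vel (Y n) t - v t)) sequentially"
      using xd[OF t] by (intro always_eventually) simp
    show "(\<lambda>n. (T + 1) * Lq_norm p T (\<lambda>t. vel (Y n) t - v t)) \<longlonglongrightarrow> 0"
      using tendsto_mult_left[OF v(3), of "T + 1"] by simp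
  qed
  have xl: "(\<lambda>n. fst (Y n) t) \<longlonglongrightarrow> x t" if "t \<in> {0..T}" for t
    by (rule LIM_zero_cancel[OF xl0[OF that]])
  have fl: "AE t in M. v t = f (x t) (u t) t"
  proof -
    have "AE t in M. t \<in> {0..T}" by (rule AE_M_I)
    with u(2) v(2) show ?thesis
    proof eventually_elim
      case (elim t)
      let ?S = "UNIV \<times> UNIV \<times> {0..T} :: ((real^'d) \<times> (real^'m) \<times> real) set"
      have "(\<lambda>n. (\<lambda>(x, u, t). f x u t) (fst (Y n) t, snd (Y n) t, t)) \<longlonglongrightarrow> (\<lambda>(x, u, t). f x u t) (x t, u t, t)"
      proof (rule continuous_on_tendsto_compose[OF f_cont[unfolded jointly_continuous_def]])
        show "(\<lambda>n. (fst (Y n) t, snd (Y n) t, t)) \<longlonglongrightarrow> (x t, u t, t)"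
          using elim xl by (intro tendsto_intros) auto
      qed (use elim in auto)
      then have "(\<lambda>n. vel (Y n) t) \<longlonglongrightarrow> f (x t) (u t) t" by (simp add: vel_def)
      then show ?case using elim(2) LIMSEQ_unique by blast
    qed
  qed
  obtain N where N: "negligible N" "\<And>t. t \<in> {0..T} - N \<Longrightarrow> (x has_vector_derivative v t) (at t)"
    using has_vector_derivative_integral_outside_negligible[OF iv, of x0] unfolding x_def[symmetric] by blast
  have dv: "AE t in M. (x has_vector_derivative v t) (at t)"
    unfolding AE_M_iff using N by blast
  have "u \<in> U"
  proof -
    have "\<exists>w\<in>U. Lq_norm q T (\<lambda>t. w t - u t) < e" if "0 < e" for e
    proof -
      have "eventually (\<lambda>n. Lq_norm q T (\<lambda>t. snd (Y n) t - u t) < e) sequentially"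
        using u(3) that by (rule order_tendstoD)
      then show ?thesis using admissible_control(1)[OF Y] by (auto simp: eventually_sequentially)
    qed
    then show ?thesis using U_closed u(1) unfolding Lq_closed_def by blast
  qed
  have "(x, u) \<in> A"
    unfolding admissible_def X_space_def W_space_def
  proof (clarsimp, intro conjI)
    show "absolutely_continuous_on {0..T} x" unfolding x_def by (rule absolutely_continuous_integral[OF iv])
    have "AE t in M. v t = vector_derivative x (at t)"
      using dv by eventually_elim (simp add: vector_derivative_at)
    then show "(\<lambda>t. vector_derivative x (at t)) \<in> Lq_space p T" by (rule Lq_cong(1)[OF p v(1)])
    show "x 0 = x0" by (simp add: x_def)
    show "AE t in M. (x has_vector_derivative f (x t) (u t) t) (at t)"
      using dv fl by eventually_elim simp
  qed (use u(1) \<open>u \<in> U\<close> in auto)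
  moreover have "(\<lambda>n. X_dist p q T (Y n) (x, u)) \<longlonglongrightarrow> 0"
  proof -
    have vn: "Lq_norm p T (\<lambda>t. vel (Y n) t - vel (x, u) t) = Lq_norm p T (\<lambda>t. vel (Y n) t - v t)" for n
      by (rule Lq_cong(2)[OF p Lq_diff[OF p vel_Lq[OF Y] v(1)]])
        (use fl in \<open>auto simp: vel_def elim!: eventually_mono\<close>)
    \<comment> \<open>One factor \<open>T + 1\<close> comes from the uniform estimate
      \<open>xd\<close>, the other from \<open>Lq_bounded\<close>.\<close>
    have xn: "Lq_norm p T (\<lambda>t. fst (Y n) t - x t) \<le> (T + 1) * ((T + 1) * Lq_norm p T (\<lambda>t. vel (Y n) t - v t))" for n
    proof (rule Lq_bounded(2)[OF p])
      show "(\<lambda>t. fst (Y n) t - x t) \<in> borel_measurable M"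
        using Lq_measurable[OF Lq_diff[OF p state_Lq[OF Y] state_Lq[OF \<open>(x, u) \<in> A\<close>]]] by simp
    qed (use xd T_pos in \<open>auto intro!: AE_M_I mult_nonneg_nonneg Lq_norm_nonneg\<close>)
    let ?b = "\<lambda>n. (T + 1) * ((T + 1) * Lq_norm p T (\<lambda>t. vel (Y n) t - v t))
      + Lq_norm p T (\<lambda>t. vel (Y n) t - v t) + Lq_norm q T (\<lambda>t. snd (Y n) t - u t)"
    have "?b \<longlonglongrightarrow> (T + 1) * ((T + 1) * 0) + 0 + 0"
      by (intro tendsto_intros v(3) u(3))
    then have b0: "?b \<longlonglongrightarrow> 0" by simp
    show ?thesis
    proof (rule Lim_null_comparison[OF always_eventually b0], rule allI)
      fix n
      show "norm (X_dist p q T (Y n) (x, u)) \<le> ?b n"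
        using xn[of n] X_dist_nonneg[of "Y n" "(x, u)"] by (simp add: X_dist_eq[OF Y \<open>(x, u) \<in> A\<close>] vn)
    qed
  qed
  ultimately show ?thesis by blast
qed

end

section \<open>Lipschitz continuity of the cost on bounded sets\<close>

text \<open>\<open>gradient\<close> is a definite description, so existence and uniqueness of the
  representing vector are both needed; the vector is the adjoint of the derivative at 1.\<close>

lemma has_derivative_gradient:
  fixes F :: "'a::euclidean_space \<Rightarrow> real"
  assumes "F differentiable (at x)"
  shows "(F has_derivative (\<lambda>h. h \<bullet> gradient F x)) (at x)"
proof -
  obtain F' where F': "(F has_derivative F') (at x)" using assms by (auto simp: differentiable_def)
  have "linear F'" using F' by (rule has_derivative_linear)
  then have "F' = (\<lambda>h. h \<bullet> adjoint F' 1)" by (simp add: adjoint_works)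
  with F' have G: "GDERIV F x :> adjoint F' 1" by (simp add: gderiv_def)
  have "D = adjoint F' 1" if "GDERIV F x :> D" for D
  proof -
    have "(\<lambda>h. h \<bullet> D) = (\<lambda>h. h \<bullet> adjoint F' 1)"
      using that G unfolding gderiv_def by (rule has_derivative_unique)
    then have "\<forall>h. h \<bullet> D = h \<bullet> adjoint F' 1" by meson
    then show ?thesis by (metis vector_eq_ldot)
  qed
  with G have "gradient F x = adjoint F' 1" unfolding gradient_def by (rule the_equality)
  with G show ?thesis by (simp add: gderiv_def)
qed

lemma gradient_mean_value_bound:
  fixes F :: "'a::euclidean_space \<Rightarrow> real"
  assumes "\<And>s. F differentiable (at s)" and "\<And>s. s \<in> closed_segment x y \<Longrightarrow> norm (gradient F s) \<le> B"
  shows "\<bar>F x - F y\<bar> \<le> B * norm (x - y)"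
proof -
  have "norm (F x - F y) \<le> B * norm (x - y)"
  proof (rule differentiable_bound[OF convex_closed_segment])
    fix s assume s: "s \<in> closed_segment x y"
    show "(F has_derivative (\<lambda>h. h \<bullet> gradient F s)) (at s within closed_segment x y)"
      using has_derivative_gradient[OF assms(1)] by (rule has_derivative_at_withinI)
    show "onorm (\<lambda>h. h \<bullet> gradient F s) \<le> B"
    proof (rule onorm_le)
      fix h
      have "norm (h \<bullet> gradient F s) \<le> norm h * norm (gradient F s)"
        using Cauchy_Schwarz_ineq2[of h "gradient F s"] by simp
      also have "\<dots> \<le> norm h * B" using assms(2)[OF s] by (rule mult_left_mono) simp
      finally show "norm (h \<bullet> gradient F s) \<le> B * norm h" by (simp add: mult.commute)
    qed
  qed auto
  then show ?thesis by simp
qed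

lemma norm_closed_segment_le:
  assumes "s \<in> closed_segment x y" "norm x \<le> R" "norm y \<le> R"
  shows "norm s \<le> R"
  using closed_segment_subset[of x "cball 0 R" y] assms by auto

text \<open>The product is at most the \<open>r\<close>-th power of the larger of \<open>s\<close>
  and \<open>m\<close>. The conditional repeats the convention of \<open>growth_condition\<close>
  for order 0.\<close>

lemma Young_power:
  fixes s m r :: real
  assumes "0 \<le> s" "0 \<le> m" "1 \<le> r"
  shows "s * (if r - 1 = 0 then 1 else m powr (r - 1)) \<le> s powr r + m powr r"
proof (cases "r = 1")
  case True
  then show ?thesis using assms by simp
next
  case False
  have pw: "a * a powr (r - 1) = a powr r" if "0 \<le> a" for a :: real
    using that powr_mult_base[of a "r - 1"] by simp
  show ?thesis
  proof (cases "s \<le> m")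
    case True
    then have "s * m powr (r - 1) \<le> m powr r"
      using pw[OF assms(2)] mult_right_mono[OF True, of "m powr (r - 1)"] by simp
    then show ?thesis using False by (simp add: add_increasing)
  next
    case le: False
    then have "m powr (r - 1) \<le> s powr (r - 1)" using assms by (intro powr_mono2) auto
    then have "s * m powr (r - 1) \<le> s powr r" using pw[OF assms(1)] mult_left_mono[OF _ assms(1)] by metis
    then show ?thesis using False by (simp add: add_increasing2)
  qed
qed

lemma Young_conjugate:
  fixes s w r :: real
  assumes "0 \<le> s" "0 \<le> w" "1 < r"
  shows "s * w \<le> s powr r + w powr (r / (r - 1))"
proof -
  \<comment> \<open>The substitution that makes \<open>w\<close> the power of order
    \<open>r - 1\<close> of \<open>m\<close>.\<close>
  define m where "m = w powr (1 / (r - 1))"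
  have "m powr (r - 1) = w" "m powr r = w powr (r / (r - 1))" "0 \<le> m"
    using assms by (simp_all add: m_def powr_powr)
  then show ?thesis using Young_power[of s m r] assms by simp
qed

section \<open>Product bounds of Hoelder type\<close>

context time_interval
begin

text \<open>
  Hoelder's inequality up to a constant factor: apply the pointwise inequality to \<open>h\<close> divided by a
  number slightly above its norm.
\<close>

lemma Lq_product_bound:
  fixes h :: "real \<Rightarrow> 'a::euclidean_space" and g G :: "real \<Rightarrow> real"
  assumes q: "1 \<le> q" "q \<noteq> \<infinity>" and h: "h \<in> Lq_space q T" and g: "g \<in> borel_measurable M"
    and nn: "AE t in M. 0 \<le> g t" and G: "integrable M G" "(LINT t|M. G t) \<le> K" and k: "0 \<le> k" "0 \<le> K"
    and young: "AE t in M. \<forall>s\<ge>0. s * g t \<le> k * s powr enn2real q + G t"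
  shows "integrable M (\<lambda>t. norm (h t) * g t)" "(LINT t|M. norm (h t) * g t) \<le> (k + K) * Lq_norm q T h"
proof -
  note [measurable] = g Lq_measurable[OF h]
  have main: "integrable M (\<lambda>t. norm (h t) * g t) \<and> (LINT t|M. norm (h t) * g t) \<le> (k + K) * a"
    if a: "Lq_norm q T h < a" for a
  proof -
    have a0: "0 < a" using a Lq_norm_nonneg[of q h] by simp
    note B = Lq_scaled_bound[OF q h less_imp_le[OF a] a0]
    let ?b = "\<lambda>t. a * (k * (norm (h t) / a) powr enn2real q + G t)"
    have bi: "integrable M ?b" using B(1) G(1) by auto
    have le: "AE t in M. norm (h t) * g t \<le> ?b t"
      using young
    proof eventually_elim
      case (elim t)
      then have "norm (h t) / a * g t \<le> k * (norm (h t) / a) powr enn2real q + G t"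
        by (rule allE[of _ "norm (h t) / a"]) (use a0 in simp)
      then have "a * (norm (h t) / a * g t) \<le> ?b t" using a0 by (intro mult_left_mono) auto
      then show ?case using a0 by simp
    qed
    have i: "integrable M (\<lambda>t. norm (h t) * g t)"
    proof (rule Bochner_Integration.integrable_bound[OF bi])
      show "AE t in M. norm (norm (h t) * g t) \<le> norm (?b t)"
        using le nn
      proof eventually_elim
        case (elim t)
        then have "norm (norm (h t) * g t) = norm (h t) * g t" by simp
        then show ?case using order_trans[OF elim(1) abs_ge_self] by (simp only: real_norm_def)
      qed
    qed measurable
    have "(LINT t|M. norm (h t) * g t) \<le> (LINT t|M. ?b t)" using i bi le by (rule integral_mono_AE)
    also have "\<dots> = a * (k * (LINT t|M. (norm (h t) / a) powr enn2real q) + (LINT t|M. G t))"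
      using B(1) G(1) by simp
    also have "\<dots> \<le> a * (k * 1 + K)"
      using a0 k B(2) G(2) by (intro mult_left_mono add_mono) auto
    finally show ?thesis using i by (simp add: mult.commute)
  qed
  show "integrable M (\<lambda>t. norm (h t) * g t)" using main[of "Lq_norm q T h + 1"] by simp
  show "(LINT t|M. norm (h t) * g t) \<le> (k + K) * Lq_norm q T h"
  proof (rule field_le_epsilon)
    fix e :: real assume e: "0 < e"
    have kK: "0 < k + K + 1" using k by simp
    have "(LINT t|M. norm (h t) * g t) \<le> (k + K) * (Lq_norm q T h + e / (k + K + 1))"
      using main[of "Lq_norm q T h + e / (k + K + 1)"] e kK by simp
    also have "\<dots> \<le> (k + K) * Lq_norm q T h + e"
      using k e kK by (simp add: distrib_left pos_divide_le_eq) (simp add: mult_right_mono algebra_simps)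
    finally show "(LINT t|M. norm (h t) * g t) \<le> (k + K) * Lq_norm q T h + e" .
  qed
qed

text \<open>In \<open>Lq_product_bound\<close>, \<open>G\<close> is taken to be the conjugate power
  of \<open>\<omega>\<close>. For \<open>q = 1\<close> the conjugate exponent is infinite; then the
  essential bound of \<open>\<omega>\<close> is the factor \<open>k\<close>, and \<open>G\<close> is
  zero.\<close>

lemma conjugate_product_bound:
  fixes \<omega> :: "real \<Rightarrow> real"
  assumes q: "1 \<le> q" "q \<noteq> \<infinity>" and w: "\<omega> \<in> Lq_space (conj_exponent q) T" and nn: "AE t in M. 0 \<le> \<omega> t"
  obtains K where "0 \<le> K"
    "\<And>h :: real \<Rightarrow> 'a::euclidean_space. h \<in> Lq_space q T \<Longrightarrow>
      integrable M (\<lambda>t. norm (h t) * \<omega> t) \<and> (LINT t|M. norm (h t) * \<omega> t) \<le> K * Lq_norm q T h"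
proof (cases "q = 1")
  case True
  then have w': "\<omega> \<in> Lq_space \<infinity> T" using w by (simp add: conj_exponent_def)
  let ?W = "Lq_norm \<infinity> T \<omega>"
  have W: "0 \<le> ?W" by (rule Lq_norm_nonneg)
  have "AE t in M. \<forall>s\<ge>0. s * \<omega> t \<le> ?W * s powr enn2real q + 0"
    using Lq_infinity_bound[OF w']
  proof eventually_elim
    case (elim t)
    then have "\<omega> t \<le> ?W" by simp
    then show ?case using True by (auto simp: mult.commute intro: mult_left_mono)
  qed
  from Lq_product_bound[OF q _ Lq_measurable[OF w'] nn _ _ W order_refl this] W show ?thesis
    by (intro that[of "?W + 0"]) auto
next
  case False
  define r where "r = enn2real q"
  have r: "1 < r"
    using one_le_enn2real[OF q] False q(2) by (cases q) (auto simp: r_def less_le)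
  define c where "c = r / (r - 1)"
  have qr: "conj_exponent q = ennreal c" using False q(2) by (simp add: conj_exponent_def r_def c_def)
  have c: "1 \<le> c" using r by (simp add: c_def)
  have w': "\<omega> \<in> Lq_space (ennreal c) T" using w by (simp add: qr)
  have i: "integrable M (\<lambda>t. \<bar>\<omega> t\<bar> powr c)"
    using w' c by (simp add: Lq_space_def)
  have "AE t in M. \<forall>s\<ge>0. s * \<omega> t \<le> 1 * s powr enn2real q + \<bar>\<omega> t\<bar> powr c"
    using nn by eventually_elim (use Young_conjugate[OF _ _ r] in \<open>auto simp: r_def c_def\<close>)
  from Lq_product_bound[OF q _ Lq_measurable[OF w'] nn i order_refl _ _ this]
  show ?thesis by (intro that[of "1 + (LINT t|M. \<bar>\<omega> t\<bar> powr c)"]) auto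
qed

text \<open>The weight measures the power growth of \<open>grad_u\<close> along the segment between
  the two controls. By \<open>Young_power\<close> its product with \<open>s\<close> is at most the
  power of \<open>s\<close> plus the powers of both controls, whence the factor
  \<open>1 + 2 * R powr enn2real q\<close>.\<close>

lemma power_product_bound:
  fixes u v :: "real \<Rightarrow> 'b::euclidean_space" and h :: "real \<Rightarrow> 'a::euclidean_space"
  assumes q: "1 \<le> q" "q \<noteq> \<infinity>" and u: "u \<in> Lq_space q T" "Lq_norm q T u \<le> R"
    and v: "v \<in> Lq_space q T" "Lq_norm q T v \<le> R" and h: "h \<in> Lq_space q T"
  defines "g \<equiv> \<lambda>t. if enn2real q - 1 = 0 then 1 else max (norm (u t)) (norm (v t)) powr (enn2real q - 1)"
  shows "integrable M (\<lambda>t. norm (h t) * g t)"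
    "(LINT t|M. norm (h t) * g t) \<le> (1 + 2 * R powr enn2real q) * Lq_norm q T h"
proof -
  note [measurable] = Lq_measurable[OF u(1)] Lq_measurable[OF v(1)]
  let ?r = "enn2real q"
  have r: "1 \<le> ?r" using q by (rule one_le_enn2real)
  let ?G = "\<lambda>t. norm (u t) powr ?r + norm (v t) powr ?r"
  have i: "integrable M ?G" using Lq_finite_bound(1)[OF q u(1)] Lq_finite_bound(1)[OF q v(1)] by simp
  have "(LINT t|M. ?G t) = Lq_norm q T u powr ?r + Lq_norm q T v powr ?r"
    using Lq_finite_bound[OF q u(1)] Lq_finite_bound[OF q v(1)] by simp
  also have "\<dots> \<le> R powr ?r + R powr ?r"
    using u(2) v(2) r Lq_norm_nonneg by (intro add_mono powr_mono2) auto
  finally have G: "(LINT t|M. ?G t) \<le> 2 * R powr ?r" by simp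
  have young: "AE t in M. \<forall>s\<ge>0. s * g t \<le> 1 * s powr ?r + ?G t"
  proof (rule AE_M_I, intro allI impI)
    fix t s :: real assume s: "0 \<le> s"
    have "max (norm (u t)) (norm (v t)) powr ?r \<le> ?G t" by (auto simp: max_def)
    then show "s * g t \<le> 1 * s powr ?r + ?G t"
      using Young_power[OF s _ r, of "max (norm (u t)) (norm (v t))"] by (auto simp: g_def le_max_iff_disj)
  qed
  have gm: "g \<in> borel_measurable M" unfolding g_def by measurable
  have gn: "AE t in M. 0 \<le> g t" by (rule AE_M_I) (simp add: g_def)
  note * = Lq_product_bound[OF q h gm gn i G _ _ young]
  show "integrable M (\<lambda>t. norm (h t) * g t)" by (rule *) auto
  show "(LINT t|M. norm (h t) * g t) \<le> (1 + 2 * R powr enn2real q) * Lq_norm q T h" by (rule *) auto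
qed

end

text \<open>Stands in for the growth conditions when \<open>q = \<infinity>\<close>: the states and,
  at almost every time, the controls then stay in fixed balls.\<close>

lemma jointly_continuous_bounded:
  fixes g :: "real^'d \<Rightarrow> real^'m \<Rightarrow> real \<Rightarrow> 'k::real_normed_vector"
  assumes "jointly_continuous T g"
  obtains C where "0 \<le> C"
    "\<And>x u t. norm x \<le> R \<Longrightarrow> norm u \<le> R' \<Longrightarrow> t \<in> {0..T} \<Longrightarrow> norm (g x u t) \<le> C"
proof -
  let ?K = "cball (0 :: real^'d) R \<times> cball (0 :: real^'m) R' \<times> {0..T}"
  have "compact ((\<lambda>(x, u, t). g x u t) ` ?K)"
    using assms unfolding jointly_continuous_def
    by (intro compact_continuous_image compact_Times continuous_on_subset[of _ _ ?K]) auto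
  then obtain B where B: "\<forall>y \<in> (\<lambda>(x, u, t). g x u t) ` ?K. norm y \<le> B"
    using compact_imp_bounded bounded_iff by blast
  show ?thesis
  proof (rule that[of "max B 0"])
    fix x :: "real^'d" and u :: "real^'m" and t assume "norm x \<le> R" "norm u \<le> R'" "t \<in> {0..T}"
    then have "(\<lambda>(x, u, t). g x u t) (x, u, t) \<in> (\<lambda>(x, u, t). g x u t) ` ?K" by (intro imageI) auto
    then show "norm (g x u t) \<le> max B 0" using bspec[OF B] by (fastforce simp: le_max_iff_disj)
  qed simp
qed

section \<open>Integrability of the integrand and Lipschitz estimates for the cost\<close>

locale optimal_control = control_system T p q x0 f U for T :: real and p q x0
    and f :: "real^'d \<Rightarrow> real^'m \<Rightarrow> real \<Rightarrow> real^'d" and U +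
  fixes \<theta> :: "real^'d \<Rightarrow> real^'m \<Rightarrow> real \<Rightarrow> real"
  assumes \<theta>_cont: "jointly_continuous T \<theta>"
    and \<theta>_diff_x: "\<forall>x u. \<forall>t\<in>{0..T}. (\<lambda>y. \<theta> y u t) differentiable (at x)"
    and \<theta>_diff_u: "\<forall>x u. \<forall>t\<in>{0..T}. (\<lambda>v. \<theta> x v t) differentiable (at u)"
    and grad_x_cont: "jointly_continuous T (grad_x \<theta>)"
    and grad_u_cont: "jointly_continuous T (grad_u \<theta>)"
    and growth: "q = \<infinity> \<or>
      growth_condition T \<theta> (enn2real q) 1 \<and>
      growth_condition T (grad_x \<theta>) (enn2real q) 1 \<and>
      growth_condition T (grad_u \<theta>) (enn2real q - 1) (conj_exponent q)"
begin

text \<open>The state is moved first, under the control \<open>u\<close>, and the control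
  afterwards, at the state \<open>y\<close>. So \<open>grad_x\<close> is met at a single control,
  whereas \<open>grad_u\<close> must be bounded along a segment of controls.\<close>

lemma integrand_diff_bound:
  assumes t: "t \<in> {0..T}"
    and bx: "\<And>s. s \<in> closed_segment x y \<Longrightarrow> norm (grad_x \<theta> s u t) \<le> B1"
    and bu: "\<And>s. s \<in> closed_segment u v \<Longrightarrow> norm (grad_u \<theta> y s t) \<le> B2"
  shows "\<bar>\<theta> x u t - \<theta> y v t\<bar> \<le> B1 * norm (x - y) + B2 * norm (u - v)"
proof -
  have "\<bar>\<theta> x u t - \<theta> y u t\<bar> \<le> B1 * norm (x - y)"
    by (rule gradient_mean_value_bound[of "\<lambda>y. \<theta> y u t"])
      (use \<theta>_diff_x t bx in \<open>auto simp: grad_x_def\<close>)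
  moreover have "\<bar>\<theta> y u t - \<theta> y v t\<bar> \<le> B2 * norm (u - v)"
    by (rule gradient_mean_value_bound[of "\<lambda>v. \<theta> y v t"])
      (use \<theta>_diff_u t bu in \<open>auto simp: grad_u_def\<close>)
  ultimately show ?thesis by linarith
qed

lemma state_norm_bound:
  assumes "z \<in> A" "X_norm p q T z \<le> R" "t \<in> {0..T}"
  shows "norm (fst z t) \<le> norm x0 + (T + 1) * R"
proof -
  have "(T + 1) * X_norm p q T z \<le> (T + 1) * R" using assms(2) T_pos by (intro mult_left_mono) auto
  then show ?thesis using state_le_X_norm[OF assms(1,3)] by simp
qed

lemma control_norm_bound:
  assumes "z \<in> A" "X_norm p q T z \<le> R"
  shows "Lq_norm q T (snd z) \<le> R"
  using assms(2) Lq_norm_nonneg[of p "fst z"] Lq_norm_nonneg[of p "vel z"] by (simp add: X_norm_eq[OF assms(1)])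

lemma state_norm_bounded:
  assumes "z \<in> A"
  obtains B where "0 < B" "\<And>t. t \<in> {0..T} \<Longrightarrow> norm (fst z t) \<le> B"
proof (rule that[of "max 1 (norm x0 + (T + 1) * X_norm p q T z)"])
  show "norm (fst z t) \<le> max 1 (norm x0 + (T + 1) * X_norm p q T z)" if "t \<in> {0..T}" for t
    using state_norm_bound[OF assms order_refl that] by simp
qed simp

text \<open>The integral in \<open>cost\<close> would be 0 by default for an integrand that is not
  integrable; this is excluded here, so that costs can be subtracted under the integral.\<close>

lemma integrand_integrable:
  assumes z: "z \<in> A"
  shows "integrable M (\<lambda>t. \<theta> (fst z t) (snd z t) t)"
proof -
  have m: "(\<lambda>t. \<theta> (fst z t) (snd z t) t) \<in> borel_measurable M"
    by (rule measurable_along_process[OF \<theta>_cont state_continuous[OF z] Lq_measurable[OF admissible_control(2)[OF z]]])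
  have tT: "AE t in M. t \<in> {0..T}" by (rule AE_M_I)
  obtain B where B: "0 < B" "\<And>t. t \<in> {0..T} \<Longrightarrow> norm (fst z t) \<le> B" using state_norm_bounded[OF z] by blast
  show ?thesis
  proof (cases "q = \<infinity>")
    case True
    have u: "AE t in M. norm (snd z t) \<le> Lq_norm \<infinity> T (snd z)"
      using admissible_control(2)[OF z] True by (intro Lq_infinity_bound) simp
    obtain C where C: "0 \<le> C"
      "\<And>x u t. norm x \<le> B \<Longrightarrow> norm u \<le> Lq_norm \<infinity> T (snd z) \<Longrightarrow> t \<in> {0..T} \<Longrightarrow> norm (\<theta> x u t) \<le> C"
      by (rule jointly_continuous_bounded[OF \<theta>_cont]) blast
    show ?thesis
    proof (rule integrable_const_bound[OF _ m])
      show "AE t in M. norm (\<theta> (fst z t) (snd z t) t) \<le> C" using u tT by eventually_elim (use C B in auto)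
    qed
  next
    case False
    let ?r = "enn2real q"
    have r: "1 \<le> ?r" using q False by (rule one_le_enn2real)
    from growth False have "growth_condition T \<theta> ?r 1" by blast
    then obtain C \<omega> where \<omega>: "\<omega> \<in> Lq_space 1 T"
      "AE t in M. \<forall>x u. norm x \<le> B \<longrightarrow> norm (\<theta> x u t) \<le> C * (if ?r = 0 then 1 else norm u powr ?r) + \<omega> t"
      unfolding growth_condition_def using B(1) by blast
    have i: "integrable M (\<lambda>t. C * norm (snd z t) powr ?r + \<omega> t)"
      using Lq_finite_bound(1)[OF q False admissible_control(2)[OF z]] Lq_integral_bound(1)[OF order_refl \<omega>(1)] by simp
    show ?thesis
    proof (rule Bochner_Integration.integrable_bound[OF i m])
      show "AE t in M. norm (\<theta> (fst z t) (snd z t) t) \<le> norm (C * norm (snd z t) powr ?r + \<omega> t)"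
        using \<omega>(2) tT
      proof eventually_elim
        case (elim t)
        then have "norm (\<theta> (fst z t) (snd z t) t) \<le> C * norm (snd z t) powr ?r + \<omega> t"
          using elim(1)[rule_format, OF B(2), of t "snd z t"] r by simp
        then show ?case by simp
      qed
    qed
  qed
qed

text \<open>The majorants may depend on the two processes, but \<open>K\<close> is fixed before
  them. \<open>b1\<close> must be integrable by itself because it meets uniformly bounded state
  differences; \<open>b2\<close> only against the control difference. This matches the two orders of
  growth.\<close>

lemma gradient_majorants:
  assumes R: "0 < R"
  obtains K where "0 \<le> K"
    "\<And>z w. z \<in> A \<Longrightarrow> w \<in> A \<Longrightarrow> X_norm p q T z \<le> R \<Longrightarrow> X_norm p q T w \<le> R \<Longrightarrow>
      \<exists>b1 b2. integrable M b1 \<and> (LINT t|M. b1 t) \<le> K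
        \<and> integrable M (\<lambda>t. norm (snd z t - snd w t) * b2 t)
        \<and> (LINT t|M. norm (snd z t - snd w t) * b2 t) \<le> K * Lq_norm q T (\<lambda>t. snd z t - snd w t)
        \<and> (AE t in M. \<forall>x y s. norm x \<le> norm x0 + (T + 1) * R \<longrightarrow> norm y \<le> norm x0 + (T + 1) * R \<longrightarrow>
            norm s \<le> max (norm (snd z t)) (norm (snd w t)) \<longrightarrow>
            norm (grad_x \<theta> x (snd z t) t) \<le> b1 t \<and> norm (grad_u \<theta> y s t) \<le> b2 t)"
proof -
  \<comment> \<open>By \<open>state_norm_bound\<close>, this radius covers all values of the states
    of processes with norm at most \<open>R\<close>.\<close>
  define S where "S = norm x0 + (T + 1) * R"
  have S: "0 < S" using R T_pos by (simp add: S_def add_nonneg_pos)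
  have tT: "AE t in M. t \<in> {0..T}" by (rule AE_M_I)
  show ?thesis
  proof (cases "q = \<infinity>")
    case True
    obtain C1 where C1: "0 \<le> C1"
      "\<And>x u t. norm x \<le> S \<Longrightarrow> norm u \<le> R \<Longrightarrow> t \<in> {0..T} \<Longrightarrow> norm (grad_x \<theta> x u t) \<le> C1"
      by (rule jointly_continuous_bounded[OF grad_x_cont]) blast
    obtain C2 where C2: "0 \<le> C2"
      "\<And>x u t. norm x \<le> S \<Longrightarrow> norm u \<le> R \<Longrightarrow> t \<in> {0..T} \<Longrightarrow> norm (grad_u \<theta> x u t) \<le> C2"
      by (rule jointly_continuous_bounded[OF grad_u_cont]) blast
    let ?K = "max (C1 * T) (C2 * (T + 1))"
    show ?thesis
    proof (rule that[of ?K])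
      show "0 \<le> ?K" using C1 T_pos by (simp add: le_max_iff_disj)
      fix z w assume zw: "z \<in> A" "w \<in> A" "X_norm p q T z \<le> R" "X_norm p q T w \<le> R"
      have d: "(\<lambda>t. snd z t - snd w t) \<in> Lq_space q T"
        by (intro Lq_diff q admissible_control(2) zw)
      note D = Lq_integral_bound[OF q d]
      have b: "AE t in M. norm (snd y t) \<le> R" if y: "y \<in> A" "X_norm p q T y \<le> R" for y
      proof -
        have "AE t in M. norm (snd y t) \<le> Lq_norm \<infinity> T (snd y)"
          using admissible_control(2)[OF y(1)] True by (intro Lq_infinity_bound) simp
        then show ?thesis by (rule eventually_mono) (use control_norm_bound[OF y] True in simp)
      qed
      have "AE t in M. \<forall>x y s. norm x \<le> S \<longrightarrow> norm y \<le> S \<longrightarrow>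
            norm s \<le> max (norm (snd z t)) (norm (snd w t)) \<longrightarrow>
            norm (grad_x \<theta> x (snd z t) t) \<le> C1 \<and> norm (grad_u \<theta> y s t) \<le> C2"
        using b[OF zw(1,3)] b[OF zw(2,4)] tT by eventually_elim (use C1 C2 in auto)
      moreover have "(LINT t|M. C1) \<le> ?K" by (simp add: measure_M mult.commute)
      moreover have "(LINT t|M. norm (snd z t - snd w t) * C2) \<le> ?K * Lq_norm q T (\<lambda>t. snd z t - snd w t)"
      proof -
        have "(LINT t|M. norm (snd z t - snd w t) * C2) = C2 * (LINT t|M. norm (snd z t - snd w t))" by simp
        also have "\<dots> \<le> C2 * ((T + 1) * Lq_norm q T (\<lambda>t. snd z t - snd w t))"
          using D(2) C2(1) by (rule mult_left_mono)
        also have "\<dots> = C2 * (T + 1) * Lq_norm q T (\<lambda>t. snd z t - snd w t)" by simp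
        also have "\<dots> \<le> ?K * Lq_norm q T (\<lambda>t. snd z t - snd w t)"
          using Lq_norm_nonneg by (intro mult_right_mono) auto
        finally show ?thesis .
      qed
      moreover have "integrable M (\<lambda>t. norm (snd z t - snd w t) * C2)" using D(1) by simp
      moreover have "integrable M (\<lambda>t. C1)" by simp
      ultimately show "\<exists>b1 b2. integrable M b1 \<and> (LINT t|M. b1 t) \<le> ?K
        \<and> integrable M (\<lambda>t. norm (snd z t - snd w t) * b2 t)
        \<and> (LINT t|M. norm (snd z t - snd w t) * b2 t) \<le> ?K * Lq_norm q T (\<lambda>t. snd z t - snd w t)
        \<and> (AE t in M. \<forall>x y s. norm x \<le> norm x0 + (T + 1) * R \<longrightarrow> norm y \<le> norm x0 + (T + 1) * R \<longrightarrow>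
            norm s \<le> max (norm (snd z t)) (norm (snd w t)) \<longrightarrow>
            norm (grad_x \<theta> x (snd z t) t) \<le> b1 t \<and> norm (grad_u \<theta> y s t) \<le> b2 t)"
        unfolding S_def[symmetric] by (intro exI[of _ "\<lambda>t. C1"] exI[of _ "\<lambda>t. C2"]) simp
    qed
  next
    case False
    let ?r = "enn2real q"
    let ?l = "\<lambda>a. if ?r - 1 = 0 then 1 else a powr (?r - 1)"
    have r: "1 \<le> ?r" using q False by (rule one_le_enn2real)
    from growth False have gr: "growth_condition T (grad_x \<theta>) ?r 1"
      "growth_condition T (grad_u \<theta>) (?r - 1) (conj_exponent q)" by blast+
    obtain C1 \<omega>1 where \<omega>1: "0 < C1" "\<omega>1 \<in> Lq_space 1 T"
      "AE t in M. \<forall>x u. norm x \<le> S \<longrightarrow> norm (grad_x \<theta> x u t) \<le> C1 * (if ?r = 0 then 1 else norm u powr ?r) + \<omega>1 t"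
      using gr(1) S unfolding growth_condition_def by blast
    obtain C2 \<omega>2 where \<omega>2: "0 < C2" "\<omega>2 \<in> Lq_space (conj_exponent q) T" "AE t in M. 0 \<le> \<omega>2 t"
      "AE t in M. \<forall>x u. norm x \<le> S \<longrightarrow> norm (grad_u \<theta> x u t) \<le> C2 * ?l (norm u) + \<omega>2 t"
      using gr(2) S unfolding growth_condition_def by blast
    obtain K2 where K2: "0 \<le> K2"
      "\<And>h :: real \<Rightarrow> real^'m. h \<in> Lq_space q T \<Longrightarrow>
        integrable M (\<lambda>t. norm (h t) * \<omega>2 t) \<and> (LINT t|M. norm (h t) * \<omega>2 t) \<le> K2 * Lq_norm q T h"
      by (rule conjugate_product_bound[OF q False \<omega>2(2,3)]) blast
    have i1: "integrable M \<omega>1" by (rule Lq_integral_bound(1)[OF order_refl \<omega>1(2)])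
    \<comment> \<open>\<open>Ka\<close> bounds the integral of the majorant of
      \<open>grad_x\<close>; \<open>Kb\<close> adds the constants for the power part and the
      \<open>\<omega>2\<close> part of the majorant of \<open>grad_u\<close>.\<close>
    define Ka where "Ka = C1 * R powr ?r + (LINT t|M. \<omega>1 t)"
    define Kb where "Kb = C2 * (1 + 2 * R powr ?r) + K2"
    have Kb: "0 \<le> Kb" using \<omega>2(1) K2(1) by (simp add: Kb_def)
    show ?thesis
    proof (rule that[of "max Ka Kb"])
      show "0 \<le> max Ka Kb" using Kb by simp
      fix z w assume zw: "z \<in> A" "w \<in> A" "X_norm p q T z \<le> R" "X_norm p q T w \<le> R"
      let ?u = "snd z" and ?v = "snd w"
      have uv: "?u \<in> Lq_space q T" "Lq_norm q T ?u \<le> R" "?v \<in> Lq_space q T" "Lq_norm q T ?v \<le> R"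
        using zw admissible_control(2) control_norm_bound by blast+
      have d: "(\<lambda>t. ?u t - ?v t) \<in> Lq_space q T" by (intro Lq_diff q uv)
      let ?m = "\<lambda>t. max (norm (?u t)) (norm (?v t))"
      let ?b1 = "\<lambda>t. C1 * norm (?u t) powr ?r + \<omega>1 t"
      let ?b2 = "\<lambda>t. C2 * ?l (?m t) + \<omega>2 t"
      note P = power_product_bound[OF q False uv d]
      note Q = K2(2)[OF d]
      have 1: "integrable M ?b1" using Lq_finite_bound(1)[OF q False uv(1)] i1 by simp
      have "(LINT t|M. ?b1 t) = C1 * Lq_norm q T ?u powr ?r + (LINT t|M. \<omega>1 t)"
        using Lq_finite_bound[OF q False uv(1)] i1 by simp
      also have "\<dots> \<le> Ka" unfolding Ka_def
        using uv(2) r \<omega>1(1) Lq_norm_nonneg by (intro add_right_mono mult_left_mono powr_mono2) auto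
      finally have 2: "(LINT t|M. ?b1 t) \<le> max Ka Kb" by simp
      have eq: "norm (?u t - ?v t) * ?b2 t = C2 * (norm (?u t - ?v t) * ?l (?m t)) + norm (?u t - ?v t) * \<omega>2 t" for t
        by (simp add: algebra_simps)
      have 3: "integrable M (\<lambda>t. norm (?u t - ?v t) * ?b2 t)"
        unfolding eq by (intro Bochner_Integration.integrable_add integrable_mult_right P(1) conjunct1[OF Q])
      have "(LINT t|M. norm (?u t - ?v t) * ?b2 t)
          = C2 * (LINT t|M. norm (?u t - ?v t) * ?l (?m t)) + (LINT t|M. norm (?u t - ?v t) * \<omega>2 t)"
        unfolding eq using P(1) conjunct1[OF Q]
        by (subst Bochner_Integration.integral_add) (auto intro: integrable_mult_right simp del: if_cancel)
      also have "\<dots> \<le> C2 * ((1 + 2 * R powr ?r) * Lq_norm q T (\<lambda>t. ?u t - ?v t)) + K2 * Lq_norm q T (\<lambda>t. ?u t - ?v t)"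
        using P(2) conjunct2[OF Q] \<omega>2(1) by (intro add_mono mult_left_mono) auto
      also have "\<dots> = Kb * Lq_norm q T (\<lambda>t. ?u t - ?v t)" by (simp add: Kb_def algebra_simps)
      also have "\<dots> \<le> max Ka Kb * Lq_norm q T (\<lambda>t. ?u t - ?v t)"
        using Lq_norm_nonneg by (intro mult_right_mono) auto
      finally have 4: "(LINT t|M. norm (?u t - ?v t) * ?b2 t) \<le> max Ka Kb * Lq_norm q T (\<lambda>t. ?u t - ?v t)" .
      have 5: "AE t in M. \<forall>x y s. norm x \<le> S \<longrightarrow> norm y \<le> S \<longrightarrow> norm s \<le> ?m t \<longrightarrow>
            norm (grad_x \<theta> x (?u t) t) \<le> ?b1 t \<and> norm (grad_u \<theta> y s t) \<le> ?b2 t"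
        using \<omega>1(3) \<omega>2(4)
      proof eventually_elim
        case (elim t)
        show ?case
        proof (intro allI impI conjI)
          fix x y :: "real^'d" and s :: "real^'m"
          assume *: "norm x \<le> S" "norm y \<le> S" "norm s \<le> ?m t"
          show "norm (grad_x \<theta> x (?u t) t) \<le> ?b1 t" 
            using elim(1)[rule_format, OF *(1), of "?u t"] r by simp
          have "?l (norm s) \<le> ?l (?m t)" using *(3) r by (auto intro: powr_mono2)
          then have "C2 * ?l (norm s) + \<omega>2 t \<le> ?b2 t" using \<omega>2(1) by (intro add_right_mono mult_left_mono) auto
          moreover have "norm (grad_u \<theta> y s t) \<le> C2 * ?l (norm s) + \<omega>2 t" using elim(2) *(2) by blast
          ultimately show "norm (grad_u \<theta> y s t) \<le> ?b2 t" by (rule order_trans[rotated])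
        qed
      qed
      show "\<exists>b1 b2. integrable M b1 \<and> (LINT t|M. b1 t) \<le> max Ka Kb
        \<and> integrable M (\<lambda>t. norm (?u t - ?v t) * b2 t)
        \<and> (LINT t|M. norm (?u t - ?v t) * b2 t) \<le> max Ka Kb * Lq_norm q T (\<lambda>t. ?u t - ?v t)
        \<and> (AE t in M. \<forall>x y s. norm x \<le> norm x0 + (T + 1) * R \<longrightarrow> norm y \<le> norm x0 + (T + 1) * R \<longrightarrow>
            norm s \<le> ?m t \<longrightarrow> norm (grad_x \<theta> x (?u t) t) \<le> b1 t \<and> norm (grad_u \<theta> y s t) \<le> b2 t)"
        unfolding S_def[symmetric] by (rule exI[of _ ?b1], rule exI[of _ ?b2], intro conjI 1 2 3 4 5)
    qed
  qed
qed

text \<open>State differences are uniformly at most \<open>T + 1\<close> times the distance, which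
  leaves the integral of \<open>b1\<close>; control differences are absorbed by the product bound
  for \<open>b2\<close>. The constant is the sum of both contributions.\<close>

lemma cost_Lipschitz_on_bounded:
  assumes R: "0 < R"
  obtains K where "0 \<le> K"
    "\<And>z w. z \<in> A \<Longrightarrow> w \<in> A \<Longrightarrow> X_norm p q T z \<le> R \<Longrightarrow> X_norm p q T w \<le> R \<Longrightarrow>
      \<bar>cost T \<theta> z - cost T \<theta> w\<bar> \<le> K * X_dist p q T z w"
proof (rule gradient_majorants[OF R])
  fix K assume K: "0 \<le> K"
    "\<And>z w. z \<in> A \<Longrightarrow> w \<in> A \<Longrightarrow> X_norm p q T z \<le> R \<Longrightarrow> X_norm p q T w \<le> R \<Longrightarrow>
      \<exists>b1 b2. integrable M b1 \<and> (LINT t|M. b1 t) \<le> K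
        \<and> integrable M (\<lambda>t. norm (snd z t - snd w t) * b2 t)
        \<and> (LINT t|M. norm (snd z t - snd w t) * b2 t) \<le> K * Lq_norm q T (\<lambda>t. snd z t - snd w t)
        \<and> (AE t in M. \<forall>x y s. norm x \<le> norm x0 + (T + 1) * R \<longrightarrow> norm y \<le> norm x0 + (T + 1) * R \<longrightarrow>
            norm s \<le> max (norm (snd z t)) (norm (snd w t)) \<longrightarrow>
            norm (grad_x \<theta> x (snd z t) t) \<le> b1 t \<and> norm (grad_u \<theta> y s t) \<le> b2 t)"
  show thesis
  proof (rule that[of "(T + 1) * K + K"])
    show "0 \<le> (T + 1) * K + K" using K(1) T_pos by simp
    fix z w assume zw: "z \<in> A" "w \<in> A" "X_norm p q T z \<le> R" "X_norm p q T w \<le> R"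
    obtain b1 b2 where b: "integrable M b1" "(LINT t|M. b1 t) \<le> K"
      "integrable M (\<lambda>t. norm (snd z t - snd w t) * b2 t)"
      "(LINT t|M. norm (snd z t - snd w t) * b2 t) \<le> K * Lq_norm q T (\<lambda>t. snd z t - snd w t)"
      "AE t in M. \<forall>x y s. norm x \<le> norm x0 + (T + 1) * R \<longrightarrow> norm y \<le> norm x0 + (T + 1) * R \<longrightarrow>
            norm s \<le> max (norm (snd z t)) (norm (snd w t)) \<longrightarrow>
            norm (grad_x \<theta> x (snd z t) t) \<le> b1 t \<and> norm (grad_u \<theta> y s t) \<le> b2 t"
      using K(2)[OF zw] by blast
    let ?d = "X_dist p q T z w"
    let ?h = "\<lambda>t. \<theta> (fst z t) (snd z t) t - \<theta> (fst w t) (snd w t) t"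
    let ?b = "\<lambda>t. (T + 1) * ?d * b1 t + norm (snd z t - snd w t) * b2 t"
    have "AE t in M. t \<in> {0..T}" by (rule AE_M_I)
    with b(5) have le: "AE t in M. norm (?h t) \<le> ?b t"
    proof eventually_elim
      case (elim t)
      have nz: "norm (fst z t) \<le> norm x0 + (T + 1) * R" "norm (fst w t) \<le> norm x0 + (T + 1) * R"
        using state_norm_bound zw elim(2) by blast+
      have g: "norm (grad_x \<theta> s (snd z t) t) \<le> b1 t" if "s \<in> closed_segment (fst z t) (fst w t)" for s
      proof -
        have "norm s \<le> norm x0 + (T + 1) * R" using that nz by (rule norm_closed_segment_le)
        \<comment> \<open>The majorant statement bounds both gradients jointly; the control point 0
          instantiates it to extract the bound for \<open>grad_x\<close>.\<close>
        moreover have "norm (0 :: real^'m) \<le> max (norm (snd z t)) (norm (snd w t))" by (simp add: le_max_iff_disj)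
        ultimately show ?thesis using elim(1) by blast
      qed
      have "norm (grad_u \<theta> (fst w t) s t) \<le> b2 t" if "s \<in> closed_segment (snd z t) (snd w t)" for s
      proof -
        have "norm s \<le> max (norm (snd z t)) (norm (snd w t))" using that by (rule norm_closed_segment_le) auto
        then show ?thesis using elim(1) nz by blast
      qed
      then have "\<bar>?h t\<bar> \<le> b1 t * norm (fst z t - fst w t) + b2 t * norm (snd z t - snd w t)"
        using elim(2) g by (intro integrand_diff_bound)
      also have "b1 t * norm (fst z t - fst w t) \<le> b1 t * ((T + 1) * ?d)"
      proof (rule mult_left_mono[OF state_diff_le_X_dist[OF zw(1,2) elim(2)]])
        show "0 \<le> b1 t" using g[of "fst z t"] norm_ge_zero order_trans by (metis ends_in_segment(1))
      qed
      finally show ?case by (simp add: algebra_simps)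
    qed
    have i: "integrable M ?h" using integrand_integrable zw by (intro Bochner_Integration.integrable_diff) auto
    have ib: "integrable M ?b" using b(1,3) by auto
    have "cost T \<theta> z - cost T \<theta> w = (LINT t|M. ?h t)"
      using integrand_integrable zw by (simp add: cost_def case_prod_unfold)
    then have "\<bar>cost T \<theta> z - cost T \<theta> w\<bar> \<le> (LINT t|M. norm (?h t))"
      using integral_norm_bound[of M ?h] by simp
    also have "\<dots> \<le> (LINT t|M. ?b t)" using i ib le by (intro integral_mono_AE) auto
    also have "\<dots> = (T + 1) * ?d * (LINT t|M. b1 t) + (LINT t|M. norm (snd z t - snd w t) * b2 t)"
      using b(1,3) by simp
    also have "\<dots> \<le> (T + 1) * ?d * K + K * ?d"
    proof (rule add_mono)
      show "(T + 1) * ?d * (LINT t|M. b1 t) \<le> (T + 1) * ?d * K"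
        using b(2) T_pos X_dist_nonneg[of z w] by (intro mult_left_mono) auto
      have "K * Lq_norm q T (\<lambda>t. snd z t - snd w t) \<le> K * ?d"
        using X_dist_components(2)[OF zw(1,2)] K(1) by (rule mult_left_mono)
      then show "(LINT t|M. norm (snd z t - snd w t) * b2 t) \<le> K * ?d" using b(4) by simp
    qed
    also have "\<dots> = ((T + 1) * K + K) * ?d" by (simp add: algebra_simps)
    finally show "\<bar>cost T \<theta> z - cost T \<theta> w\<bar> \<le> ((T + 1) * K + K) * ?d" .
  qed
qed

end

section \<open>Descent of the terminal error\<close>

text \<open>Let a and d be the distances from \<open>\<xi>\<close> to \<open>xT\<close> and from
  \<open>\<eta>\<close> to \<open>\<xi>\<close>. Expanding the square, the angle gives at most a^2 -
  2 \<beta> a d + d^2 for the squared new distance; d \<le> \<beta> a reduces this to a^2 - \<beta>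
  a d, which is at most (a - \<beta> d / 2)^2.\<close>

lemma negative_angle_descent:
  fixes \<xi> \<eta> xT :: "'a::real_inner"
  assumes \<xi>: "\<xi> \<noteq> xT" and \<eta>: "\<eta> \<noteq> \<xi>" and \<beta>: "0 < \<beta>" "\<beta> \<le> 1"
    and angle: "((\<xi> - xT) /\<^sub>R norm (\<xi> - xT)) \<bullet> ((\<eta> - \<xi>) /\<^sub>R norm (\<eta> - \<xi>)) \<le> - \<beta>"
    and close: "norm (\<eta> - \<xi>) \<le> \<beta> * norm (\<xi> - xT)"
  shows "norm (\<eta> - xT) \<le> norm (\<xi> - xT) - \<beta> / 2 * norm (\<eta> - \<xi>)"
proof -
  define a where "a = norm (\<xi> - xT)"
  define d where "d = norm (\<eta> - \<xi>)"
  have ad: "0 < a" "0 < d" using \<xi> \<eta> by (auto simp: a_def d_def)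
  have "((\<xi> - xT) \<bullet> (\<eta> - \<xi>)) / (a * d) \<le> - \<beta>"
    using angle by (simp add: a_def d_def divide_inverse mult_ac)
  then have ip: "(\<xi> - xT) \<bullet> (\<eta> - \<xi>) \<le> - (\<beta> * (a * d))" using ad by (simp add: pos_divide_le_eq)
  have expand: "(norm (x + y))\<^sup>2 = (norm x)\<^sup>2 + 2 * (x \<bullet> y) + (norm y)\<^sup>2" for x y :: 'a
    unfolding power2_norm_eq_inner by (simp add: inner_add_left inner_add_right inner_commute)
  have "(norm (\<eta> - xT))\<^sup>2 = (norm ((\<xi> - xT) + (\<eta> - \<xi>)))\<^sup>2" by simp
  also have "\<dots> = a\<^sup>2 + 2 * ((\<xi> - xT) \<bullet> (\<eta> - \<xi>)) + d\<^sup>2"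
    unfolding a_def d_def by (rule expand)
  also have "\<dots> \<le> a\<^sup>2 - 2 * (\<beta> * (a * d)) + d * (\<beta> * a)"
  proof -
    have "d * d \<le> d * (\<beta> * a)" using close ad(2) by (intro mult_left_mono) (auto simp: a_def d_def)
    moreover have "d * (\<beta> * a) = \<beta> * (a * d)" by simp
    ultimately show ?thesis using ip unfolding power2_eq_square by linarith
  qed
  also have "\<dots> \<le> (a - \<beta> / 2 * d)\<^sup>2"
    using zero_le_power2[of "\<beta> * d"] by (simp add: power2_eq_square algebra_simps)
  finally have sq: "(norm (\<eta> - xT))\<^sup>2 \<le> (a - \<beta> / 2 * d)\<^sup>2" .
  \<comment> \<open>Taking square roots requires a nonnegative right side; here
    \<open>\<beta> \<le> 1\<close> enters.\<close>
  have "d \<le> 1 * a"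
    using close mult_right_mono[OF \<beta>(2), of a] ad(1) unfolding a_def d_def by linarith
  moreover have "\<beta> / 2 * d \<le> 1 * d" using \<beta> ad(2) by (intro mult_right_mono) auto
  ultimately have "0 \<le> a - \<beta> / 2 * d" by linarith
  with sq show ?thesis unfolding a_def d_def by (rule power2_le_imp_le)
qed

context control_system
begin

lemma Lq_norm_le_add_diff:
  assumes "1 \<le> r" "u \<in> Lq_space r T" "v \<in> Lq_space r T"
  shows "Lq_norm r T u \<le> Lq_norm r T v + Lq_norm r T (\<lambda>t. u t - v t)"
  using Lq_add(2)[OF assms(1,3) Lq_diff[OF assms]] by simp

lemma X_norm_le_add_dist:
  assumes "y \<in> A" "z \<in> A"
  shows "X_norm p q T y \<le> X_norm p q T z + X_dist p q T y z"
  using Lq_norm_le_add_diff[OF p state_Lq state_Lq, OF assms]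
    Lq_norm_le_add_diff[OF p vel_Lq vel_Lq, OF assms]
    Lq_norm_le_add_diff[OF q admissible_control(2) admissible_control(2), OF assms]
  by (simp add: X_norm_eq X_dist_eq assms)

lemma end_error_Lipschitz:
  assumes "y \<in> A" "z \<in> A"
  shows "\<bar>end_error T xT y - end_error T xT z\<bar> \<le> (T + 1) * X_dist p q T y z"
proof -
  have "\<bar>norm (fst y T - xT) - norm (fst z T - xT)\<bar> \<le> norm (fst y T - fst z T)"
    using norm_triangle_ineq3[of "fst y T - xT" "fst z T - xT"] by simp
  also have "\<dots> \<le> (T + 1) * X_dist p q T y z"
    by (rule state_diff_le_X_dist[OF assms]) (use T_pos in simp)
  finally show ?thesis by (simp add: end_error_def case_prod_unfold)
qed

text \<open>A close \<open>\<eta> n\<close> lowers the error by at least \<open>\<beta> / 2\<close>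
  per unit of displacement of the end point, and the neighbourhood \<open>V\<close> provides a
  process whose distance is at most \<open>C\<close> times this displacement. The quotient is the
  rate \<open>\<beta> / (2 * C)\<close>.\<close>

lemma end_error_descent:
  assumes z: "z \<in> A" and z_ne: "fst z T \<noteq> xT"
    and \<beta>: "0 < \<beta>" "\<beta> \<le> 1" and C: "0 < C" and e: "0 < e"
    and \<eta>: "\<And>n. \<eta> n \<in> reachable T A" "\<And>n. \<eta> n \<noteq> fst z T" "\<eta> \<longlonglongrightarrow> fst z T"
    and angle: "\<And>n. ((fst z T - xT) /\<^sub>R norm (fst z T - xT)) \<bullet> ((\<eta> n - fst z T) /\<^sub>R norm (\<eta> n - fst z T)) \<le> - \<beta>"
    and V: "open V" "fst z T \<in> V"
      "\<forall>\<xi>\<in>V \<inter> reachable T A. \<exists>(y, v)\<in>A. y T = \<xi> \<and>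
        Lq_norm q T (\<lambda>t. snd z t - v t) + W_norm p T (\<lambda>t. fst z t - y t) \<le> C * norm (fst z T - y T)"
  obtains y where "y \<in> A" "0 < X_dist p q T y z" "X_dist p q T y z < e"
    "end_error T xT y \<le> end_error T xT z - \<beta> / (2 * C) * X_dist p q T y z"
proof -
  let ?a = "norm (fst z T - xT)"
  have a: "0 < ?a" using z_ne by simp
  have "eventually (\<lambda>n. \<eta> n \<in> V) sequentially" using \<eta>(3) V(1,2) by (rule topological_tendstoD)
  \<comment> \<open>The first bound is the closeness required by
    \<open>negative_angle_descent\<close>; the second keeps the step below \<open>e\<close> after
    multiplication by \<open>C\<close>.\<close>
  moreover have "eventually (\<lambda>n. dist (\<eta> n) (fst z T) < min (\<beta> * ?a) (e / C)) sequentially"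
    using \<eta>(3) a \<beta> e C by (intro tendstoD) auto
  ultimately have "eventually (\<lambda>n. \<eta> n \<in> V \<and> dist (\<eta> n) (fst z T) < min (\<beta> * ?a) (e / C)) sequentially"
    by (rule eventually_conj)
  then obtain n where n: "\<eta> n \<in> V" "norm (\<eta> n - fst z T) < \<beta> * ?a" "norm (\<eta> n - fst z T) < e / C"
    by (auto simp: eventually_sequentially dist_norm)
  obtain y where y: "y \<in> A" "fst y T = \<eta> n"
    "Lq_norm q T (\<lambda>t. snd z t - snd y t) + W_norm p T (\<lambda>t. fst z t - fst y t) \<le> C * norm (fst z T - fst y T)"
    using bspec[OF V(3), of "\<eta> n"] n(1) \<eta>(1)[of n] by (auto simp: case_prod_unfold)
  let ?d = "X_dist p q T y z" and ?h = "norm (\<eta> n - fst z T)"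
  have d: "?d \<le> C * ?h"
    using y X_dist_commute[OF y(1) z] by (simp add: X_dist_def X_norm_def case_prod_unfold norm_minus_commute add.commute)
  have h: "0 < ?h" using \<eta>(2)[of n] by simp
  \<comment> \<open>Distinct end points force a positive distance, which mere difference of
    processes would not do under a pseudometric.\<close>
  have "?h \<le> (T + 1) * ?d" using state_diff_le_X_dist[OF y(1) z, of T] T_pos y(2) by simp
  then have "0 < (T + 1) * ?d" using h by linarith
  then have pos: "0 < ?d" using T_pos by (simp add: zero_less_mult_iff)
  have "C * ?h < e" using n(3) C by (simp add: pos_less_divide_eq mult.commute)
  then have less: "?d < e" using d by simp
  have "norm (\<eta> n - xT) \<le> ?a - \<beta> / 2 * ?h"
    by (rule negative_angle_descent[OF z_ne \<eta>(2) \<beta> angle]) (use n(2) in simp)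
  moreover have "\<beta> / (2 * C) * ?d \<le> \<beta> / (2 * C) * (C * ?h)"
    using d \<beta> C by (intro mult_left_mono) auto
  moreover have "\<beta> / (2 * C) * (C * ?h) = \<beta> / 2 * ?h" using C by simp
  ultimately have "end_error T xT y \<le> end_error T xT z - \<beta> / (2 * C) * ?d"
    by (simp add: end_error_def case_prod_unfold y(2))
  with y(1) pos less show ?thesis by (rule that)
qed

end

section \<open>Choice of the penalty parameter and application of the abstract result\<close>

context optimal_control
begin

lemma X_norm_nonneg: "0 \<le> X_norm p q T z"
  by (simp add: X_norm_def W_norm_def case_prod_unfold Lq_norm_nonneg)

text \<open>Restricting to radius 1 keeps all nearby processes in one bounded set, where a single
  Lipschitz constant applies.\<close>

lemma cost_continuous:
  assumes z: "z \<in> A" and e: "0 < e"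
  shows "\<exists>r>0. \<forall>y\<in>A. X_dist p q T y z < r \<longrightarrow> \<bar>cost T \<theta> y - cost T \<theta> z\<bar> < e"
proof -
  have "0 < X_norm p q T z + 1" using X_norm_nonneg[of z] by simp
  then obtain K where K: "0 \<le> K" "\<And>z' w. z' \<in> A \<Longrightarrow> w \<in> A \<Longrightarrow> X_norm p q T z' \<le> X_norm p q T z + 1 \<Longrightarrow>
      X_norm p q T w \<le> X_norm p q T z + 1 \<Longrightarrow> \<bar>cost T \<theta> z' - cost T \<theta> w\<bar> \<le> K * X_dist p q T z' w"
    by (rule cost_Lipschitz_on_bounded) blast
  show ?thesis
  proof (intro exI[of _ "min 1 (e / (K + 1))"] conjI ballI impI)
    fix y assume y: "y \<in> A" "X_dist p q T y z < min 1 (e / (K + 1))"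
    have "\<bar>cost T \<theta> y - cost T \<theta> z\<bar> \<le> K * X_dist p q T y z"
      using X_norm_le_add_dist[OF y(1) z] y by (intro K(2) z) auto
    also have "\<dots> \<le> (K + 1) * X_dist p q T y z" using X_dist_nonneg[of y z] by (simp add: algebra_simps)
    also have "\<dots> < e" using y(2) K(1) by (simp add: pos_less_divide_eq mult.commute)
    finally show "\<bar>cost T \<theta> y - cost T \<theta> z\<bar> < e" .
  qed (use e K(1) in simp)
qed

theorem penalty_completely_exact:
  assumes opt: "\<exists>z. globally_optimal (cost T \<theta>) (feasible T xT A) z"
    and nta: "negative_tangent_angle (reachable T A) xT"
    and c: "optimal_value (cost T \<theta>) (feasible T xT A) < ereal c"
    and lam0: "0 < lam0" and \<delta>: "0 < \<delta>"
    and bounded: "X_bounded p q T (sublevel T \<theta> xT A lam0 c \<inter> near_feasible T xT A \<delta>)"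
    and S: "property_S p q T A (sublevel T \<theta> xT A lam0 c \<inter> (near_feasible T xT A \<delta> - feasible T xT A))"
    and below: "bdd_below (penalty T \<theta> xT lam0 ` A)"
  shows "\<exists>lam_star\<ge>0. \<forall>lam\<ge>lam_star. completely_exact (X_dist p q T) A (feasible T xT A)
           (cost T \<theta>) (penalty T \<theta> xT lam) (sublevel T \<theta> xT A lam c)"
proof -
  let ?I = "cost T \<theta>" and ?\<phi> = "end_error T xT" and ?d = "X_dist p q T"
  have pen: "penalty T \<theta> xT lam z = ?I z + lam * ?\<phi> z" for lam z by (simp add: penalty_def)
  have \<phi>: "?\<phi> z = norm (fst z T - xT)" for z by (simp add: end_error_def case_prod_unfold)
  obtain z0 where z0: "globally_optimal ?I (feasible T xT A) z0" using opt by blast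
  then have z0A: "z0 \<in> A" "?\<phi> z0 = 0" by (auto simp: globally_optimal_def feasible_def)
  have Iz0: "?I z0 < c"
  proof -
    have "ereal (?I z0) \<le> optimal_value ?I (feasible T xT A)"
      using z0 unfolding optimal_value_def globally_optimal_def by (intro INF_greatest) auto
    then show ?thesis using c by (metis ereal_less(2) less_ereal.simps(1) order_le_less_trans)
  qed
  obtain m where m: "\<And>z. z \<in> A \<Longrightarrow> m \<le> penalty T \<theta> xT lam0 z" using below by (auto simp: bdd_below_def)
  have mc: "m < c" using m[OF z0A(1)] Iz0 z0A(2) by (simp add: pen)
  obtain V \<beta>0 where V: "open V" "xT \<in> V" "\<beta>0 > 0"
    "\<And>\<xi>. \<xi> \<in> V \<inter> reachable T A \<Longrightarrow> \<xi> \<noteq> xT \<Longrightarrow>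
      \<exists>\<eta> :: nat \<Rightarrow> real^'d. (\<forall>n. \<eta> n \<in> reachable T A \<and> \<eta> n \<noteq> \<xi>) \<and> \<eta> \<longlonglongrightarrow> \<xi> \<and>
        (\<forall>n. ((\<xi> - xT) /\<^sub>R norm (\<xi> - xT)) \<bullet> ((\<eta> n - \<xi>) /\<^sub>R norm (\<eta> n - \<xi>)) \<le> - \<beta>0)"
    using nta unfolding negative_tangent_angle_def by blast
  \<comment> \<open>Lowering \<open>\<beta>0\<close> preserves the angle condition and provides the
    bound 1 that \<open>negative_angle_descent\<close> requires.\<close>
  define \<beta> where "\<beta> = min \<beta>0 1"
  have \<beta>: "0 < \<beta>" "\<beta> \<le> 1" "\<beta> \<le> \<beta>0" using V(3) by (auto simp: \<beta>_def)
  obtain \<rho> where \<rho>: "0 < \<rho>" "ball xT \<rho> \<subseteq> V" using V(1,2) open_contains_ball by blast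
  \<comment> \<open>An error below \<open>\<delta>'\<close> gives near-feasibility and also an end
    point in the neighbourhood of the tangent angle property.\<close>
  define \<delta>' where "\<delta>' = min \<delta> \<rho>"
  have \<delta>': "0 < \<delta>'" "\<delta>' \<le> \<delta>" "\<delta>' \<le> \<rho>" using \<delta> \<rho> by (auto simp: \<delta>'_def)
  obtain C where C: "0 < C" "\<forall>(x, u) \<in> sublevel T \<theta> xT A lam0 c \<inter> (near_feasible T xT A \<delta> - feasible T xT A).
      \<exists>V. open V \<and> x T \<in> V \<and> (\<forall>\<xi> \<in> V \<inter> reachable T A. \<exists>(y, v) \<in> A. y T = \<xi> \<and>
        Lq_norm q T (\<lambda>t. u t - v t) + W_norm p T (\<lambda>t. x t - y t) \<le> C * norm (x T - y T))"
    using S unfolding property_S_def by blast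
  obtain R0 where R0: "\<And>z. z \<in> sublevel T \<theta> xT A lam0 c \<inter> near_feasible T xT A \<delta> \<Longrightarrow> X_norm p q T z \<le> R0"
    using bounded unfolding X_bounded_def by blast
  \<comment> \<open>The margin 1 leaves room for steps shorter than 1, so that both ends of a step
    lie where \<open>K\<close> is a Lipschitz constant of the cost.\<close>
  define R where "R = max R0 0 + 1"
  have "0 < R" by (simp add: R_def)
  then obtain K where K: "0 \<le> K" "\<And>z w. z \<in> A \<Longrightarrow> w \<in> A \<Longrightarrow> X_norm p q T z \<le> R \<Longrightarrow> X_norm p q T w \<le> R \<Longrightarrow>
      \<bar>?I z - ?I w\<bar> \<le> K * ?d z w"
    by (rule cost_Lipschitz_on_bounded) blast
  define a where "a = \<beta> / (2 * C)"
  have a: "0 < a" using \<beta> C by (simp add: a_def)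
  \<comment> \<open>The first entry forces the error below \<open>\<delta>'\<close> on the sublevel
    set for \<open>lam\<close>; the second gives \<open>lam * a \<ge> K + 1\<close>, hence descent
    of the penalty function at rate 1.\<close>
  define lam_star where "lam_star = max (lam0 + (c - m) / \<delta>') ((K + 1) / a)"
  have "completely_exact ?d A (feasible T xT A) ?I (penalty T \<theta> xT lam) (sublevel T \<theta> xT A lam c)"
    if lam: "lam_star \<le> lam" for lam
  proof -
    have lam1: "(c - m) / \<delta>' \<le> lam - lam0" using lam by (simp add: lam_star_def)
    have "0 < (c - m) / \<delta>'" using mc \<delta>' by simp
    then have lam2: "lam0 \<le> lam" using lam1 by simp
    have lam3: "K + 1 \<le> lam * a" using lam a by (simp add: lam_star_def pos_divide_le_eq)
    have descent: "\<exists>y\<in>A. 0 < ?d y z \<and> ?d y z < e \<and> ?\<phi> y \<le> ?\<phi> z - a * ?d y z \<and>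
        ?I y + lam * ?\<phi> y \<le> ?I z + lam * ?\<phi> z - 1 * ?d y z"
      if z: "z \<in> A" and zc: "?I z + lam * ?\<phi> z < c" and z\<phi>: "0 < ?\<phi> z" and e: "0 < e" for z e
    proof -
      have "lam0 * ?\<phi> z \<le> lam * ?\<phi> z" using lam2 z\<phi> by (intro mult_right_mono) auto
      then have sub: "z \<in> sublevel T \<theta> xT A lam0 c" using z zc by (simp add: sublevel_def pen)
      \<comment> \<open>The penalty value for \<open>lam0\<close> is at least \<open>m\<close>, so
        the surplus \<open>lam - lam0\<close> times the error must fit below
        \<open>c - m\<close>.\<close>
      have "(c - m) / \<delta>' * ?\<phi> z \<le> (lam - lam0) * ?\<phi> z" using lam1 z\<phi> by (intro mult_right_mono) auto
      also have "\<dots> < c - m" using m[OF z] zc by (simp add: pen algebra_simps)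
      finally have "?\<phi> z < \<delta>'" using mc \<delta>' by (simp add: pos_divide_less_eq)
      then have near: "?\<phi> z < \<delta>" "?\<phi> z < \<rho>" using \<delta>' by auto
      have mem: "z \<in> sublevel T \<theta> xT A lam0 c \<inter> near_feasible T xT A \<delta>" "z \<notin> feasible T xT A"
        using sub z near(1) z\<phi> by (auto simp: near_feasible_def feasible_def)
      have zT: "fst z T \<noteq> xT" using z\<phi> by (auto simp: \<phi>)
      have "fst z T \<in> V \<inter> reachable T A"
        using near(2) \<rho>(2) z by (auto simp: \<phi> reachable_def dist_norm norm_minus_commute subset_iff case_prod_unfold)
      then obtain \<eta> :: "nat \<Rightarrow> real^'d" where \<eta>: "\<forall>n. \<eta> n \<in> reachable T A \<and> \<eta> n \<noteq> fst z T" "\<eta> \<longlonglongrightarrow> fst z T"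
        "\<forall>n. ((fst z T - xT) /\<^sub>R norm (fst z T - xT)) \<bullet> ((\<eta> n - fst z T) /\<^sub>R norm (\<eta> n - fst z T)) \<le> - \<beta>0"
        using V(4) zT by blast
      obtain W where W: "open W" "fst z T \<in> W"
        "\<forall>\<xi>\<in>W \<inter> reachable T A. \<exists>(y, v)\<in>A. y T = \<xi> \<and>
          Lq_norm q T (\<lambda>t. snd z t - v t) + W_norm p T (\<lambda>t. fst z t - y t) \<le> C * norm (fst z T - y T)"
        using bspec[OF C(2), of "(fst z, snd z)"] mem by auto
      obtain y where y: "y \<in> A" "0 < ?d y z" "?d y z < min e 1" "?\<phi> y \<le> ?\<phi> z - a * ?d y z"
      proof (rule end_error_descent[OF z zT \<beta>(1,2) C(1) _ _ _ \<eta>(2) _ W])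
        show "0 < min e 1" using e by simp
        show "((fst z T - xT) /\<^sub>R norm (fst z T - xT)) \<bullet> ((\<eta> n - fst z T) /\<^sub>R norm (\<eta> n - fst z T)) \<le> - \<beta>" for n
          using spec[OF \<eta>(3), of n] \<beta>(3) by linarith
      qed (use \<eta>(1) in \<open>auto simp: a_def\<close>)
      have "X_norm p q T z \<le> R" "X_norm p q T y \<le> R"
        using R0[OF mem(1)] X_norm_le_add_dist[OF y(1) z] y(3) by (auto simp: R_def)
      then have "?I y \<le> ?I z + K * ?d y z" using K(2)[OF y(1) z] by linarith
      moreover have "lam * ?\<phi> y \<le> lam * ?\<phi> z - lam * a * ?d y z"
        using mult_left_mono[OF y(4), of lam] lam0 lam2 by (simp add: algebra_simps)
      moreover have "(K + 1) * ?d y z \<le> lam * a * ?d y z" using lam3 y(2) by (intro mult_right_mono) auto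
      ultimately have "?I y + lam * ?\<phi> y \<le> ?I z + lam * ?\<phi> z - 1 * ?d y z" by (simp add: algebra_simps)
      then show ?thesis using y by auto
    qed
    \<comment> \<open>\<open>T + 1\<close> is the Lipschitz constant of the end point evaluation,
      and the rate 1 of the penalty function is what remains of \<open>lam * a\<close> after
      subtracting \<open>K\<close>.\<close>
    interpret E: descent_to_feasibility ?d A ?I ?\<phi> lam c a 1 "T + 1"
    proof
      show "\<exists>w\<in>A. (\<lambda>n. ?d (Y n) w) \<longlonglongrightarrow> 0"
        if "\<And>n. Y n \<in> A" "summable (\<lambda>n. ?d (Y n) (Y (Suc n)))" for Y
        using that by (rule admissible_complete)
    qed (fact X_dist_nonneg X_dist_commute X_dist_triangle end_error_Lipschitz cost_continuous
        a descent zero_less_one | use T_pos in \<open>simp add: \<phi> X_dist_refl\<close>)+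
    have "{z \<in> A. ?\<phi> z = 0} = feasible T xT A" by (simp add: feasible_def)
    moreover have "E.\<Phi> = penalty T \<theta> xT lam" by (simp add: fun_eq_iff E.\<Phi>_def pen)
    moreover have "{z \<in> A. penalty T \<theta> xT lam z < c} = sublevel T \<theta> xT A lam c" by (simp add: sublevel_def)
    ultimately show ?thesis using E.completely_exact[OF _ Iz0] z0 by simp
  qed
  moreover have "0 \<le> lam_star" using lam0 mc \<delta>' by (simp add: lam_star_def le_max_iff_disj)
  ultimately show ?thesis by blast
qed

end

theorem theorem10:
  fixes p q :: ennreal and T c :: real
    and x0 xT :: "real^'d" and U :: "(real \<Rightarrow> real^'m) set"
    and \<theta> :: "real^'d \<Rightarrow> real^'m \<Rightarrow> real \<Rightarrow> real"
    and f :: "real^'d \<Rightarrow> real^'m \<Rightarrow> real \<Rightarrow> real^'d"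
    and A \<Omega> :: "('d, 'm) traj set"
  assumes "1 \<le> p" and "1 \<le> q" and "T > 0"
    and "U \<noteq> {}" and "Lq_closed q T U"
    and A_eq: "A = admissible p q T f x0 U"
    and \<Omega>_eq: "\<Omega> = feasible T xT A"
    and "xT \<in> reachable T A" and "xT islimpt reachable T A"
    and "jointly_continuous T \<theta>"
    and "\<forall>x u. \<forall>t\<in>{0..T}. (\<lambda>y. \<theta> y u t) differentiable (at x)"
    and "\<forall>x u. \<forall>t\<in>{0..T}. (\<lambda>v. \<theta> x v t) differentiable (at u)"
    and "jointly_continuous T (grad_x \<theta>)" and "jointly_continuous T (grad_u \<theta>)"
    and "jointly_continuous T f"
    and "q = \<infinity> \<or>
         growth_condition T \<theta> (enn2real q) 1 \<and>
         growth_condition T (grad_x \<theta>) (enn2real q) 1 \<and>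
         growth_condition T (grad_u \<theta>) (enn2real q - 1) (conj_exponent q)"
    and "\<exists>z. globally_optimal (cost T \<theta>) \<Omega> z"
    and "negative_tangent_angle (reachable T A) xT"
    and "optimal_value (cost T \<theta>) \<Omega> < ereal c"
    and "\<exists>lam0>0. \<exists>\<delta>>0.
           X_bounded p q T (sublevel T \<theta> xT A lam0 c \<inter> near_feasible T xT A \<delta>) \<and>
           property_S p q T A
             (sublevel T \<theta> xT A lam0 c \<inter> (near_feasible T xT A \<delta> - \<Omega>)) \<and>
           bdd_below (penalty T \<theta> xT lam0 ` A)"
  shows "\<exists>lam_star\<ge>0. \<forall>lam\<ge>lam_star.
           completely_exact (X_dist p q T) A \<Omega> (cost T \<theta>) (penalty T \<theta> xT lam)
             (sublevel T \<theta> xT A lam c)"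
proof -
  interpret optimal_control T p q x0 f U \<theta>
    using assms by unfold_locales auto
  obtain lam0 \<delta> where "0 < lam0" "0 < \<delta>"
    "X_bounded p q T (sublevel T \<theta> xT A lam0 c \<inter> near_feasible T xT A \<delta>)"
    "property_S p q T A (sublevel T \<theta> xT A lam0 c \<inter> (near_feasible T xT A \<delta> - \<Omega>))"
    "bdd_below (penalty T \<theta> xT lam0 ` A)"
    using assms(20) by blast
  then show ?thesis
    using penalty_completely_exact assms(17,18,19) unfolding A_eq \<Omega>_eq by blast
qed

end
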